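(* Let $d,m\ge1$ be integers and let $\beta$ be a real number with $md<\beta$. Let $b\in H^\infty(\mathbb B_d)$ with $\|b\|_\infty\le1$ and $|b(0)|<1$. Then the polynomials form a dense subset of $\mathcal H_\beta(b,m)$, the Hilbert space of functions on $\mathbb B_d$ with reproducing kernel $$\frac{(1-b(z)\overline{b(w)})^m}{(1-\langle z,w\rangle)^\beta},\qquad z,w\in\mathbb B_d .$$
   Context: $\mathbb B_d=\{z\in\mathbb C^d:\|z\|<1\}$ is the open unit ball, $H^\infty(\mathbb B_d)$ is the algebra of (scalar-valued) bounded analytic functions on $\mathbb B_d$ with supremum norm. Polynomials are the analytic polynomials in $z_1,\dots,z_d$; the claim includes that they belong to the space. *)

theory Defs
  imports "HOL-Complex_Analysis.Complex_Analysis"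
begin

definition cinner :: "complex^'d \<Rightarrow> complex^'d \<Rightarrow> complex" where
  "cinner z w = (\<Sum>i\<in>UNIV. z $ i * cnj (w $ i))"

text \<open>Analyticity in several variables on an open set: the real Frechet derivative
  exists at every point and is complex linear.\<close>

definition analytic_several_on :: "(complex^'d \<Rightarrow> complex) \<Rightarrow> (complex^'d) set \<Rightarrow> bool" where
  "analytic_several_on f S \<longleftrightarrow>
     (\<forall>z\<in>S. \<exists>D. (f has_derivative D) (at z) \<and> (\<forall>c v. D (c *s v) = c * D v))"

text \<open>The norm on \<^typ>\<open>complex^'d\<close> is the Euclidean one, so \<^term>\<open>ball 0 1\<close> is the
  Euclidean unit ball. Values of \<^term>\<open>b\<close> outside the ball are irrelevant.\<close>

definition H_infty :: "(complex^'d \<Rightarrow> complex) set" where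
  "H_infty = {b. analytic_several_on b (ball 0 1) \<and> bounded (b ` ball 0 1)}"

definition H_infty_norm :: "(complex^'d \<Rightarrow> complex) \<Rightarrow> real" where
  "H_infty_norm b = (SUP z\<in>ball 0 1. norm (b z))"

definition ip_norm :: "(('a \<Rightarrow> complex) \<Rightarrow> ('a \<Rightarrow> complex) \<Rightarrow> complex) \<Rightarrow> ('a \<Rightarrow> complex) \<Rightarrow> real" where
  "ip_norm ip f = sqrt (Re (ip f f))"

text \<open>A function on \<^term>\<open>X\<close> is represented by its extension by zero to the whole type,
  so that equality of functions on \<^term>\<open>X\<close> is equality in HOL.\<close>

definition zero_ext :: "'a set \<Rightarrow> ('a \<Rightarrow> complex) \<Rightarrow> 'a \<Rightarrow> complex" where
  "zero_ext X f = (\<lambda>z. if z \<in> X then f z else 0)"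

locale hilbert_function_space =
  fixes X :: "'a set"
    and H :: "('a \<Rightarrow> complex) set"
    and ip :: "('a \<Rightarrow> complex) \<Rightarrow> ('a \<Rightarrow> complex) \<Rightarrow> complex"
  assumes vanish_outside: "\<And>f z. f \<in> H \<Longrightarrow> z \<notin> X \<Longrightarrow> f z = 0"
    and zero_mem: "(\<lambda>z. 0) \<in> H"
    and add_mem: "\<And>f g. f \<in> H \<Longrightarrow> g \<in> H \<Longrightarrow> (\<lambda>z. f z + g z) \<in> H"
    and scale_mem: "\<And>c f. f \<in> H \<Longrightarrow> (\<lambda>z. c * f z) \<in> H"
    and ip_add: "\<And>f g h. f \<in> H \<Longrightarrow> g \<in> H \<Longrightarrow> h \<in> H \<Longrightarrow>
                   ip (\<lambda>z. f z + g z) h = ip f h + ip g h"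
    and ip_scale: "\<And>c f h. f \<in> H \<Longrightarrow> h \<in> H \<Longrightarrow> ip (\<lambda>z. c * f z) h = c * ip f h"
    and ip_cnj: "\<And>f g. f \<in> H \<Longrightarrow> g \<in> H \<Longrightarrow> ip g f = cnj (ip f g)"
    and ip_nonneg: "\<And>f. f \<in> H \<Longrightarrow> 0 \<le> Re (ip f f)"
    and ip_definite: "\<And>f. f \<in> H \<Longrightarrow> ip f f = 0 \<Longrightarrow> f = (\<lambda>z. 0)"
    and complete: "\<And>F :: nat \<Rightarrow> 'a \<Rightarrow> complex.
          (\<And>n. F n \<in> H) \<Longrightarrow>
          (\<forall>\<epsilon>>0. \<exists>N. \<forall>j\<ge>N. \<forall>k\<ge>N. ip_norm ip (\<lambda>z. F j z - F k z) < \<epsilon>) \<Longrightarrow>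
          \<exists>f\<in>H. (\<lambda>n. ip_norm ip (\<lambda>z. F n z - f z)) \<longlonglongrightarrow> 0"

locale reproducing_kernel_hilbert_space = hilbert_function_space X H ip
  for X :: "'a set" and H ip +
  fixes K :: "'a \<Rightarrow> 'a \<Rightarrow> complex"
  assumes kernel_mem: "\<And>w. w \<in> X \<Longrightarrow> zero_ext X (\<lambda>z. K z w) \<in> H"
    and reproducing: "\<And>f w. f \<in> H \<Longrightarrow> w \<in> X \<Longrightarrow> ip f (zero_ext X (\<lambda>z. K z w)) = f w"

text \<open>For \<^term>\<open>z\<close>, \<^term>\<open>w\<close> in the unit ball, \<^term>\<open>1 - cinner z w\<close> has positive real part,
  and \<open>powr\<close> is the principal branch of the power.\<close>

definition Hb_kernel ::
  "real \<Rightarrow> (complex^'d \<Rightarrow> complex) \<Rightarrow> nat \<Rightarrow> complex^'d \<Rightarrow> complex^'d \<Rightarrow> complex" where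
  "Hb_kernel \<beta> b m z w = (1 - b z * cnj (b w)) ^ m / (1 - cinner z w) powr complex_of_real \<beta>"

definition analytic_polynomials :: "(complex^'d \<Rightarrow> complex) set" where
  "analytic_polynomials =
     {\<lambda>z. \<Sum>\<alpha>\<in>A. c \<alpha> * (\<Prod>i\<in>UNIV. (z $ i) ^ \<alpha> i) | (A :: ('d \<Rightarrow> nat) set) c. finite A}"

definition dense_subset_of ::
  "('a \<Rightarrow> complex) set \<Rightarrow> (('a \<Rightarrow> complex) \<Rightarrow> ('a \<Rightarrow> complex) \<Rightarrow> complex) \<Rightarrow> ('a \<Rightarrow> complex) set \<Rightarrow> bool"
where
  "dense_subset_of H ip S \<longleftrightarrow>
     S \<subseteq> H \<and> (\<forall>f\<in>H. \<forall>\<epsilon>>0. \<exists>p\<in>S. ip_norm ip (\<lambda>z. f z - p z) < \<epsilon>)"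

end

theory Submission
  imports Defs "HOL-Probability.Probability"
begin

text \<open>
  Put \<open>\<gamma> = \<beta>/m > d\<close> and \<open>L(z,w) = (1 - b(z) cnj(b(w))) / (1 - \<langle>z,w\<rangle>)\<^sup>\<gamma>\<close>, so that the kernel is
  \<open>L\<^sup>m\<close>. By the Schur product theorem a product of members of the space of \<open>L\<close> lies in the space of
  \<open>L\<^sup>m\<close>, with norm at most the product of the norms, and the kernel functions of \<open>L\<^sup>m\<close> are \<open>m\<close>-th
  powers of those of \<open>L\<close>; hence everything follows from the case \<open>m = 1\<close>.

  For \<open>m = 1\<close> the inequality \<open>\<gamma> > d\<close> makes the space of \<open>(1 - \<langle>z,w\<rangle>)\<close> to the power \<open>-\<gamma>\<close> a weighted
  Bergman space: its norm is the \<open>L\<^sup>2\<close> norm of a rotation invariant probability measure on the ball.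
  For a combination \<open>h\<close> of Bergman kernels let \<open>h' = P(cnj b \<cdot> h)\<close> (\<open>P\<close> the Bergman projection) and
  \<open>g = cnj b \<cdot> h - h'\<close>. The combination of kernels of \<open>L\<close> with the same coefficients is \<open>h - b h'\<close>, and
  its squared norm is \<open>\<parallel>h\<parallel>\<^sup>2 - \<parallel>h'\<parallel>\<^sup>2 = \<integral> (1 - |b|\<^sup>2) |h|\<^sup>2 + \<parallel>g\<parallel>\<^sup>2\<close>. By the Schwarz-Pick lemma
  \<open>1 - |b|\<^sup>2\<close> is at least a constant times \<open>1 - |z|\<^sup>2\<close>, so this norm controls \<open>h\<close> and \<open>h'\<close> in
  \<open>L\<^sup>2((1 - |z|\<^sup>2) d\<mu>)\<close>, where monomials are still orthogonal and point evaluations bounded; in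
  particular polynomials are in the space. If \<open>h\<^sub>n - b h\<^sub>n'\<close> converges to an \<open>f\<close> orthogonal to all
  polynomials, then the Taylor coefficients of \<open>h\<^sub>n\<close> tend to \<open>0\<close>, whence \<open>h\<^sub>n\<close> tends to \<open>0\<close> in the weighted
  norm. Those of \<open>h\<^sub>n' = cnj b \<cdot> h\<^sub>n - g\<^sub>n\<close> do too, because \<open>g\<^sub>n\<close> is \<open>L\<^sup>2\<close>-convergent and orthogonal to
  polynomials, and therefore \<open>f = 0\<close>.
\<close>

section \<open>Semi-inner products\<close>

text \<open>The obstacle is that 1 - |b|^2 may vanish at the boundary, so the norm of h - b h' does
  not control h or h' in L^2 of the measure itself, while g is orthogonal to polynomials only there.
  The weights 1 - |z|^(2j) reconcile the two: such a weight is at most j (1 - |z|^2), so it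
  tolerates h, and it differs from 1 by |z|^(2j), whose effect on a fixed g disappears as j grows.
  As monomials are orthogonal under all these weights, each of them reads off the same Taylor
  coefficients up to positive factors. The condition \<gamma> > d enters through the factor
  (\<gamma> - d) / (\<gamma> + n) by which the weight 1 - |z|^2 shrinks the squared norm of a
  monomial of degree n: the weight can be undone degree by degree. No L^2 space is completed, since
  all integrands are bounded and continuous and all h are finite combinations of kernel functions.
  Membership in a kernel space is handled as an inequality for finite combinations, which is what
  makes it multiplicative. The measure is built from Gamma variables because their Laplace
  transforms give the monomial moments without polar coordinates.\<close>

locale semi_inner_product =
  fixes V :: "('a \<Rightarrow> complex) set"
    and ip :: "('a \<Rightarrow> complex) \<Rightarrow> ('a \<Rightarrow> complex) \<Rightarrow> complex"
  assumes zero_mem: "(\<lambda>z. 0) \<in> V"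
    and add_mem: "f \<in> V \<Longrightarrow> g \<in> V \<Longrightarrow> (\<lambda>z. f z + g z) \<in> V"
    and scale_mem: "f \<in> V \<Longrightarrow> (\<lambda>z. c * f z) \<in> V"
    and ip_add: "f \<in> V \<Longrightarrow> g \<in> V \<Longrightarrow> h \<in> V \<Longrightarrow> ip (\<lambda>z. f z + g z) h = ip f h + ip g h"
    and ip_scale: "f \<in> V \<Longrightarrow> h \<in> V \<Longrightarrow> ip (\<lambda>z. c * f z) h = c * ip f h"
    and ip_cnj: "f \<in> V \<Longrightarrow> g \<in> V \<Longrightarrow> ip g f = cnj (ip f g)"
    and ip_nonneg: "f \<in> V \<Longrightarrow> 0 \<le> Re (ip f f)"
begin

lemma diff_mem:
  assumes "f \<in> V" "g \<in> V"
  shows "(\<lambda>z. f z - g z) \<in> V"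
proof -
  have "(\<lambda>z. f z + (-1) * g z) \<in> V" by (rule add_mem[OF assms(1) scale_mem[OF assms(2)]])
  then show ?thesis by simp
qed

lemma ip_diff:
  assumes "f \<in> V" "g \<in> V" "h \<in> V"
  shows "ip (\<lambda>z. f z - g z) h = ip f h - ip g h"
proof -
  have "ip (\<lambda>z. f z + (-1) * g z) h = ip f h + (-1) * ip g h"
    by (simp only: ip_add[OF assms(1) scale_mem[OF assms(2)] assms(3)] ip_scale[OF assms(2,3)])
  then show ?thesis by simp
qed

lemma ip_add_right:
  assumes "f \<in> V" "g \<in> V" "h \<in> V"
  shows "ip h (\<lambda>z. f z + g z) = ip h f + ip h g"
  using ip_cnj[OF add_mem[OF assms(1,2)] assms(3)] ip_cnj[OF assms(1,3)] ip_cnj[OF assms(2,3)]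
    ip_add[OF assms] by simp

lemma ip_diff_right:
  assumes "f \<in> V" "g \<in> V" "h \<in> V"
  shows "ip h (\<lambda>z. f z - g z) = ip h f - ip h g"
  using ip_cnj[OF diff_mem[OF assms(1,2)] assms(3)] ip_cnj[OF assms(1,3)] ip_cnj[OF assms(2,3)]
    ip_diff[OF assms] by simp

lemma ip_scale_right:
  assumes "f \<in> V" "h \<in> V"
  shows "ip h (\<lambda>z. c * f z) = cnj c * ip h f"
  using ip_cnj[OF scale_mem[OF assms(1)] assms(2)] ip_cnj[OF assms] ip_scale[OF assms] by simp

lemma ip_zero: "h \<in> V \<Longrightarrow> ip (\<lambda>z. 0) h = 0"
  using ip_scale[of h h 0] by simp

lemma sum_mem: "(\<And>i. i \<in> I \<Longrightarrow> F i \<in> V) \<Longrightarrow> (\<lambda>z. \<Sum>i\<in>I. F i z) \<in> V"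
  by (induction I rule: infinite_finite_induct) (auto simp: zero_mem add_mem)

lemma ip_sum:
  "(\<And>i. i \<in> I \<Longrightarrow> F i \<in> V) \<Longrightarrow> h \<in> V \<Longrightarrow> ip (\<lambda>z. \<Sum>i\<in>I. F i z) h = (\<Sum>i\<in>I. ip (F i) h)"
  by (induction I rule: infinite_finite_induct) (auto simp: ip_zero ip_add sum_mem)

lemma ip_self: "f \<in> V \<Longrightarrow> ip f f = of_real (Re (ip f f))"
  by (metis Reals_cnj_iff ip_cnj of_real_Re)

lemma ip_norm_nonneg: "0 \<le> ip_norm ip f" if "f \<in> V"
  using that by (simp add: ip_norm_def ip_nonneg)

lemma ip_norm_sq: "f \<in> V \<Longrightarrow> (ip_norm ip f)\<^sup>2 = Re (ip f f)"
  by (simp add: ip_norm_def ip_nonneg)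

lemma ip_norm_scale: "f \<in> V \<Longrightarrow> ip_norm ip (\<lambda>z. c * f z) = cmod c * ip_norm ip f"
proof -
  assume f: "f \<in> V"
  have "ip (\<lambda>z. c * f z) (\<lambda>z. c * f z) = (c * cnj c) * ip f f"
    using f by (simp add: ip_scale ip_scale_right scale_mem)
  also have "\<dots> = of_real ((cmod c)\<^sup>2) * ip f f"
    by (simp only: complex_norm_square)
  finally have "Re (ip (\<lambda>z. c * f z) (\<lambda>z. c * f z)) = (cmod c)\<^sup>2 * Re (ip f f)" by simp
  then show ?thesis by (simp add: ip_norm_def real_sqrt_mult)
qed

lemma ip_norm_diff_commute:
  "f \<in> V \<Longrightarrow> g \<in> V \<Longrightarrow> ip_norm ip (\<lambda>z. f z - g z) = ip_norm ip (\<lambda>z. g z - f z)"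
  using ip_norm_scale[of "\<lambda>z. f z - g z" "-1"] diff_mem[of f g] by simp

lemma Re_ip_add_scale:
  assumes "f \<in> V" "g \<in> V"
  shows "Re (ip (\<lambda>z. f z + c * g z) (\<lambda>z. f z + c * g z)) =
         Re (ip f f) + 2 * Re (c * ip g f) + (cmod c)\<^sup>2 * Re (ip g g)"
proof -
  have m: "(\<lambda>z. c * g z) \<in> V" using assms scale_mem by blast
  have "Re (ip (\<lambda>z. c * g z) (\<lambda>z. c * g z)) = (cmod c)\<^sup>2 * Re (ip g g)"
    using ip_norm_scale[OF assms(2), of c] ip_norm_sq[OF m] ip_norm_sq[OF assms(2)]
    by (simp add: power_mult_distrib)
  moreover have "Re (ip f (\<lambda>z. c * g z)) = Re (c * ip g f)"
    using ip_cnj[OF m assms(1)] ip_scale[OF assms(2,1), of c] by simp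
  moreover have "Re (ip (\<lambda>z. c * g z) f) = Re (c * ip g f)"
    using ip_scale[OF assms(2,1), of c] by simp
  ultimately show ?thesis
    using assms m by (simp add: ip_add ip_add_right add_mem)
qed

text \<open>The form may be degenerate, so the vanishing of \<open>B\<close> is a separate case:
  there the inequality \<open>key\<close> is affine in \<open>t\<close> and forces
  \<open>n = 0\<close>.\<close>

lemma Cauchy_Schwarz_ip:
  assumes f: "f \<in> V" and g: "g \<in> V"
  shows "cmod (ip f g) \<le> ip_norm ip f * ip_norm ip g"
proof -
  define n where "n = (cmod (ip f g))\<^sup>2"
  define A where "A = Re (ip f f)"
  define B where "B = Re (ip g g)"
  have AB: "A \<ge> 0" "B \<ge> 0" using assms ip_nonneg by (auto simp: A_def B_def)
  have key: "0 \<le> A - 2 * t * n + t\<^sup>2 * n * B" for t :: real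
  proof -
    \<comment> \<open>The factor \<open>ip f g\<close> makes the cross term the real number
      \<open>- t * n\<close>, which leaves a quadratic in the real parameter
      \<open>t\<close>.\<close>
    let ?c = "- of_real t * ip f g"
    have "0 \<le> Re (ip (\<lambda>z. f z + ?c * g z) (\<lambda>z. f z + ?c * g z))"
      using assms by (intro ip_nonneg add_mem scale_mem)
    also have "\<dots> = A + 2 * Re (?c * ip g f) + (cmod ?c)\<^sup>2 * B"
      using Re_ip_add_scale[OF f g, of ?c] by (simp only: A_def B_def)
    also have "Re (?c * ip g f) = - t * n"
    proof -
      have "?c * ip g f = - of_real t * (ip f g * cnj (ip f g))"
        using ip_cnj[OF f g] by simp
      also have "\<dots> = - of_real t * of_real n" by (simp only: n_def complex_norm_square)
      also have "\<dots> = of_real (- t * n)" by simp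
      finally show ?thesis by (simp only: Re_complex_of_real)
    qed
    also have "(cmod ?c)\<^sup>2 = t\<^sup>2 * n" by (simp add: norm_mult power_mult_distrib n_def)
    finally show ?thesis by simp
  qed
  have "n \<le> A * B"
  proof (cases "B = 0")
    case True
    have "n = 0"
    proof (rule ccontr)
      assume "n \<noteq> 0"
      \<comment> \<open>With \<open>B = 0\<close> this choice of \<open>t\<close> makes the right
        side of \<open>key\<close> equal to -1.\<close>
      then show False using key[of "(A + 1) / (2 * n)"] True by simp
    qed
    then show ?thesis using AB by simp
  next
    case False
    then have "B > 0" using AB by simp
    then show ?thesis using key[of "1 / B"] by (simp add: field_simps power2_eq_square)
  qed
  then have "sqrt n \<le> sqrt A * sqrt B" by (metis real_sqrt_le_iff real_sqrt_mult)
  then show ?thesis by (simp add: n_def A_def B_def ip_norm_def)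
qed

lemma ip_norm_triangle:
  assumes f: "f \<in> V" and g: "g \<in> V"
  shows "ip_norm ip (\<lambda>z. f z + g z) \<le> ip_norm ip f + ip_norm ip g"
proof (rule power2_le_imp_le)
  have "(ip_norm ip (\<lambda>z. f z + g z))\<^sup>2 = (ip_norm ip f)\<^sup>2 + 2 * Re (ip g f) + (ip_norm ip g)\<^sup>2"
    using Re_ip_add_scale[OF f g, of 1] assms by (simp add: ip_norm_sq add_mem)
  moreover have "Re (ip g f) \<le> ip_norm ip f * ip_norm ip g"
    using Cauchy_Schwarz_ip[OF g f] complex_Re_le_cmod[of "ip g f"] by (simp add: mult.commute)
  ultimately show "(ip_norm ip (\<lambda>z. f z + g z))\<^sup>2 \<le> (ip_norm ip f + ip_norm ip g)\<^sup>2"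
    by (simp add: power2_sum)
qed (use assms ip_norm_nonneg in simp)

lemma ip_norm_triangle_diff:
  assumes "f \<in> V" "g \<in> V" "h \<in> V"
  shows "ip_norm ip (\<lambda>z. f z - h z) \<le> ip_norm ip (\<lambda>z. f z - g z) + ip_norm ip (\<lambda>z. g z - h z)"
  using ip_norm_triangle[OF diff_mem[OF assms(1,2)] diff_mem[OF assms(2,3)]] by simp

lemma ip_norm_le_add_diff:
  assumes "f \<in> V" "g \<in> V"
  shows "ip_norm ip f \<le> ip_norm ip g + ip_norm ip (\<lambda>z. f z - g z)"
  using ip_norm_triangle[OF assms(2) diff_mem[OF assms]] by simp

lemma norm_ip_diff_le:
  assumes "f \<in> V" "g \<in> V" "f' \<in> V" "g' \<in> V"
  shows "cmod (ip f g - ip f' g') \<le>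
    ip_norm ip (\<lambda>z. f z - f' z) * ip_norm ip g + ip_norm ip f' * ip_norm ip (\<lambda>z. g z - g' z)"
proof -
  have "ip f g - ip f' g' = ip (\<lambda>z. f z - f' z) g + ip f' (\<lambda>z. g z - g' z)"
    using assms by (simp add: ip_diff ip_diff_right)
  then show ?thesis
    using Cauchy_Schwarz_ip[OF diff_mem[OF assms(1,3)] assms(2)]
      Cauchy_Schwarz_ip[OF assms(3) diff_mem[OF assms(2,4)]]
    by (metis (no_types, lifting) add_mono norm_triangle_le)
qed

lemma tendsto_ip_const:
  assumes "\<And>n. F n \<in> V" "f \<in> V" "h \<in> V" "(\<lambda>n. ip_norm ip (\<lambda>z. F n z - f z)) \<longlonglongrightarrow> 0"
  shows "(\<lambda>n. ip (F n) h) \<longlonglongrightarrow> ip f h"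
proof (rule LIM_zero_cancel, rule tendsto_norm_zero_cancel, rule tendsto_sandwich[OF _ _ tendsto_const])
  show "\<forall>\<^sub>F n in sequentially. 0 \<le> cmod (ip (F n) h - ip f h)" by simp
  have "cmod (ip (F n) h - ip f h) \<le> ip_norm ip (\<lambda>z. F n z - f z) * ip_norm ip h" for n
    using Cauchy_Schwarz_ip[OF diff_mem[OF assms(1)[of n] assms(2)] assms(3)] assms
    by (simp add: ip_diff)
  then show "\<forall>\<^sub>F n in sequentially.
      cmod (ip (F n) h - ip f h) \<le> ip_norm ip (\<lambda>z. F n z - f z) * ip_norm ip h" by simp
  show "(\<lambda>n. ip_norm ip (\<lambda>z. F n z - f z) * ip_norm ip h) \<longlonglongrightarrow> 0"
    using tendsto_mult_right[OF assms(4), of "ip_norm ip h"] by simp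
qed

section \<open>Cauchy sequences for a semi-inner product\<close>

definition Cauchy_ip :: "(nat \<Rightarrow> 'a \<Rightarrow> complex) \<Rightarrow> bool" where
  "Cauchy_ip F \<longleftrightarrow> (\<forall>\<epsilon>>0. \<exists>N. \<forall>j\<ge>N. \<forall>k\<ge>N. ip_norm ip (\<lambda>z. F j z - F k z) < \<epsilon>)"

lemma Cauchy_ip_bounded:
  assumes "\<And>n. F n \<in> V" "Cauchy_ip F"
  obtains C where "C > 0" "\<And>n. ip_norm ip (F n) \<le> C"
proof -
  obtain N where N: "\<And>j k. j \<ge> N \<Longrightarrow> k \<ge> N \<Longrightarrow> ip_norm ip (\<lambda>z. F j z - F k z) < 1"
    using assms(2) unfolding Cauchy_ip_def by (meson zero_less_one)
  define C where "C = (\<Sum>i\<le>N. ip_norm ip (F i)) + 1"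
  have nn: "0 \<le> ip_norm ip (F i)" for i using assms ip_norm_nonneg by blast
  have "ip_norm ip (F n) \<le> C" for n
  proof (cases "n \<le> N")
    case True
    then have "ip_norm ip (F n) \<le> (\<Sum>i\<le>N. ip_norm ip (F i))"
      by (intro member_le_sum) (auto simp: nn)
    then show ?thesis by (simp add: C_def)
  next
    case False
    have "ip_norm ip (F N) \<le> (\<Sum>i\<le>N. ip_norm ip (F i))"
      by (intro member_le_sum) (auto simp: nn)
    moreover have "ip_norm ip (F n) \<le> ip_norm ip (F N) + 1"
      using ip_norm_le_add_diff[of "F n" "F N"] N[of n N] False assms by fastforce
    ultimately show ?thesis by (simp add: C_def)
  qed
  moreover have "C > 0" using sum_nonneg[of "{..N}" "\<lambda>i. ip_norm ip (F i)"] nn by (simp add: C_def)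
  ultimately show ?thesis using that by blast
qed

lemma Cauchy_ip_convergent:
  assumes "\<And>n. F n \<in> V" "\<And>n. G n \<in> V" "Cauchy_ip F" "Cauchy_ip G"
  shows "convergent (\<lambda>n. ip (F n) (G n))"
proof -
  obtain C where C: "C > 0" "\<And>n. ip_norm ip (F n) \<le> C" using Cauchy_ip_bounded assms(1,3) by blast
  obtain D where D: "D > 0" "\<And>n. ip_norm ip (G n) \<le> D" using Cauchy_ip_bounded assms(2,4) by blast
  have "Cauchy (\<lambda>n. ip (F n) (G n))"
  proof (rule metric_CauchyI)
    fix e :: real assume e: "e > 0"
    obtain N where N: "\<And>j k. j \<ge> N \<Longrightarrow> k \<ge> N \<Longrightarrow> ip_norm ip (\<lambda>z. F j z - F k z) < e / (2 * D)"
      using assms(3) e D unfolding Cauchy_ip_def by (meson divide_pos_pos mult_pos_pos zero_less_numeral)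
    obtain M where M: "\<And>j k. j \<ge> M \<Longrightarrow> k \<ge> M \<Longrightarrow> ip_norm ip (\<lambda>z. G j z - G k z) < e / (2 * C)"
      using assms(4) e C unfolding Cauchy_ip_def by (meson divide_pos_pos mult_pos_pos zero_less_numeral)
    have "dist (ip (F j) (G j)) (ip (F k) (G k)) < e" if "j \<ge> max N M" "k \<ge> max N M" for j k
    proof -
      have "cmod (ip (F j) (G j) - ip (F k) (G k)) \<le>
         ip_norm ip (\<lambda>z. F j z - F k z) * ip_norm ip (G j) + ip_norm ip (F k) * ip_norm ip (\<lambda>z. G j z - G k z)"
        by (rule norm_ip_diff_le) (use assms in auto)
      also have "ip_norm ip (\<lambda>z. F j z - F k z) * ip_norm ip (G j) \<le> ip_norm ip (\<lambda>z. F j z - F k z) * D"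
        by (intro mult_left_mono D ip_norm_nonneg diff_mem assms)
      also have "\<dots> < e / (2 * D) * D" using N[of j k] that D by (intro mult_strict_right_mono) auto
      also have "ip_norm ip (F k) * ip_norm ip (\<lambda>z. G j z - G k z) \<le> C * ip_norm ip (\<lambda>z. G j z - G k z)"
        by (intro mult_right_mono C ip_norm_nonneg diff_mem assms)
      also have "\<dots> \<le> C * (e / (2 * C))" using M[of j k] that C by (intro mult_left_mono) auto
      finally show ?thesis using C D by (simp add: dist_norm)
    qed
    then show "\<exists>M. \<forall>m\<ge>M. \<forall>n\<ge>M. dist (ip (F m) (G m)) (ip (F n) (G n)) < e" by blast
  qed
  then show ?thesis by (simp add: Cauchy_convergent_iff)
qed

text \<open>The squared norm of \<open>F n\<close> is the pairing of \<open>F n\<close> with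
  \<open>F n - F k\<close> plus its pairing with \<open>F k\<close>: the first is small by the
  Cauchy property, the second for large \<open>k\<close>. This upgrades weak to norm convergence
  without a limit element. It makes the completion of a kernel form well defined and serves again in
  the density argument.\<close>

lemma Cauchy_ip_null:
  assumes F: "\<And>n. F n \<in> V" "Cauchy_ip F" and "\<And>n. (\<lambda>k. ip (F n) (F k)) \<longlonglongrightarrow> 0"
  shows "(\<lambda>n. ip_norm ip (F n)) \<longlonglongrightarrow> 0"
proof -
  obtain C where C: "C > 0" "\<And>n. ip_norm ip (F n) \<le> C" using Cauchy_ip_bounded F by blast
  have nn: "0 \<le> ip_norm ip (F n)" for n using F ip_norm_nonneg by blast
  show ?thesis
  proof (rule LIMSEQ_I)
    fix e :: real assume e: "e > 0"
    obtain N where N: "\<And>j k. j \<ge> N \<Longrightarrow> k \<ge> N \<Longrightarrow> ip_norm ip (\<lambda>z. F j z - F k z) < e\<^sup>2 / (2 * C)"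
      using F(2) e C unfolding Cauchy_ip_def
      by (meson divide_pos_pos mult_pos_pos zero_less_numeral zero_less_power)
    have "ip_norm ip (F n) < e" if n: "n \<ge> N" for n
    proof -
      have "\<forall>\<^sub>F k in sequentially. cmod (ip (F n) (F k)) < e\<^sup>2 / 2"
        using order_tendstoD(2)[OF tendsto_norm[OF assms(3)[of n]], of "e\<^sup>2 / 2"] e by simp
      then obtain k where k: "cmod (ip (F n) (F k)) < e\<^sup>2 / 2" "k \<ge> N"
        by (metis (mono_tags, lifting) eventually_sequentially nat_le_linear)
      have "ip (F n) (F n) = ip (F n) (\<lambda>z. F n z - F k z) + ip (F n) (F k)"
        using F by (simp add: ip_diff_right)
      then have "cmod (ip (F n) (F n)) \<le> cmod (ip (F n) (\<lambda>z. F n z - F k z)) + cmod (ip (F n) (F k))"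
        by (metis norm_triangle_ineq)
      also have "cmod (ip (F n) (\<lambda>z. F n z - F k z)) \<le> ip_norm ip (F n) * ip_norm ip (\<lambda>z. F n z - F k z)"
        using F by (intro Cauchy_Schwarz_ip diff_mem)
      also have "\<dots> \<le> C * (e\<^sup>2 / (2 * C))"
        using C N[OF n k(2)] F by (intro mult_mono) (auto intro!: ip_norm_nonneg diff_mem)
      also have "\<dots> = e\<^sup>2 / 2" using C by simp
      finally have "cmod (ip (F n) (F n)) < e\<^sup>2" using k by simp
      moreover have "(ip_norm ip (F n))\<^sup>2 \<le> cmod (ip (F n) (F n))"
        using F ip_norm_sq complex_Re_le_cmod by metis
      ultimately have "(ip_norm ip (F n))\<^sup>2 < e\<^sup>2" by simp
      then show ?thesis using e by (simp add: power2_less_imp_less)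
    qed
    then show "\<exists>no. \<forall>n\<ge>no. norm (ip_norm ip (F n) - 0) < e" using nn by auto
  qed
qed

lemma Cauchy_ip_scale:
  assumes "\<And>n. F n \<in> V" "Cauchy_ip F"
  shows "Cauchy_ip (\<lambda>n z. c * F n z)"
  unfolding Cauchy_ip_def
proof (intro allI impI)
  fix e :: real assume e: "e > 0"
  \<comment> \<open>The added 1 covers \<open>c = 0\<close>.\<close>
  obtain N where N: "\<And>j k. j \<ge> N \<Longrightarrow> k \<ge> N \<Longrightarrow> ip_norm ip (\<lambda>z. F j z - F k z) < e / (cmod c + 1)"
    using assms(2) e unfolding Cauchy_ip_def by (meson add_nonneg_pos divide_pos_pos norm_ge_zero zero_less_one)
  have "ip_norm ip (\<lambda>z. c * F j z - c * F k z) < e" if "j \<ge> N" "k \<ge> N" for j k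
  proof -
    have d: "(\<lambda>z. F j z - F k z) \<in> V" using assms diff_mem by blast
    have "ip_norm ip (\<lambda>z. c * F j z - c * F k z) = cmod c * ip_norm ip (\<lambda>z. F j z - F k z)"
      using ip_norm_scale[OF d, of c] by (simp add: right_diff_distrib)
    also have "\<dots> \<le> (cmod c + 1) * ip_norm ip (\<lambda>z. F j z - F k z)"
      using ip_norm_nonneg[OF d] by (intro mult_right_mono) auto
    also have "\<dots> < (cmod c + 1) * (e / (cmod c + 1))"
      using N[OF that] by (intro mult_strict_left_mono) (auto simp: add_nonneg_pos)
    also have "\<dots> = e" using norm_ge_zero[of c] by (simp add: field_simps add_nonneg_eq_0_iff)
    finally show ?thesis .
  qed
  then show "\<exists>N. \<forall>j\<ge>N. \<forall>k\<ge>N. ip_norm ip (\<lambda>z. c * F j z - c * F k z) < e" by blast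
qed

lemma Cauchy_ip_diff:
  assumes "\<And>n. F n \<in> V" "\<And>n. G n \<in> V" "Cauchy_ip F" "Cauchy_ip G"
  shows "Cauchy_ip (\<lambda>n z. F n z - G n z)"
  unfolding Cauchy_ip_def
proof (intro allI impI)
  fix e :: real assume e: "e > 0"
  obtain N where N: "\<And>j k. j \<ge> N \<Longrightarrow> k \<ge> N \<Longrightarrow> ip_norm ip (\<lambda>z. F j z - F k z) < e / 2"
    using assms(3) e unfolding Cauchy_ip_def by (meson half_gt_zero)
  obtain M where M: "\<And>j k. j \<ge> M \<Longrightarrow> k \<ge> M \<Longrightarrow> ip_norm ip (\<lambda>z. G j z - G k z) < e / 2"
    using assms(4) e unfolding Cauchy_ip_def by (meson half_gt_zero)
  have "ip_norm ip (\<lambda>z. (F j z - G j z) - (F k z - G k z)) < e" if "j \<ge> max N M" "k \<ge> max N M" for j k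
  proof -
    have "ip_norm ip (\<lambda>z. (F j z - F k z) + (G k z - G j z)) < e / 2 + e / 2"
      using N[of j k] M[of k j] that assms
      by (intro order_le_less_trans[OF ip_norm_triangle] add_strict_mono diff_mem) auto
    then show ?thesis by (simp add: algebra_simps)
  qed
  then show "\<exists>N. \<forall>j\<ge>N. \<forall>k\<ge>N. ip_norm ip (\<lambda>z. (F j z - G j z) - (F k z - G k z)) < e" by blast
qed

lemma Cauchy_ip_add:
  assumes "\<And>n. F n \<in> V" "\<And>n. G n \<in> V" "Cauchy_ip F" "Cauchy_ip G"
  shows "Cauchy_ip (\<lambda>n z. F n z + G n z)"
  using Cauchy_ip_diff[OF assms(1) scale_mem[OF assms(2)] assms(3)
      Cauchy_ip_scale[OF assms(2,4)], of "-1"] by simp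

lemma Cauchy_ip_const: "f \<in> V \<Longrightarrow> Cauchy_ip (\<lambda>n. f)"
  using ip_zero[OF zero_mem] by (simp add: Cauchy_ip_def ip_norm_def)

lemma convergent_imp_Cauchy_ip:
  assumes F: "\<And>n. F n \<in> V" and f: "f \<in> V" and lim: "(\<lambda>n. ip_norm ip (\<lambda>z. F n z - f z)) \<longlonglongrightarrow> 0"
  shows "Cauchy_ip F"
  unfolding Cauchy_ip_def
proof (intro allI impI)
  fix e :: real assume e: "e > 0"
  have "\<forall>\<^sub>F n in sequentially. ip_norm ip (\<lambda>z. F n z - f z) < e / 2"
    using order_tendstoD(2)[OF lim, of "e / 2"] e by simp
  then obtain N where N: "\<forall>n\<ge>N. ip_norm ip (\<lambda>z. F n z - f z) < e / 2"
    unfolding eventually_sequentially by blast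
  have "ip_norm ip (\<lambda>z. F j z - F k z) < e" if jk: "j \<ge> N" "k \<ge> N" for j k
  proof -
    have "ip_norm ip (\<lambda>z. F j z - F k z) \<le> ip_norm ip (\<lambda>z. F j z - f z) + ip_norm ip (\<lambda>z. f z - F k z)"
      by (rule ip_norm_triangle_diff[OF F f F])
    also have "ip_norm ip (\<lambda>z. f z - F k z) = ip_norm ip (\<lambda>z. F k z - f z)"
      by (rule ip_norm_diff_commute[OF f F])
    also have "ip_norm ip (\<lambda>z. F j z - f z) + ip_norm ip (\<lambda>z. F k z - f z) < e / 2 + e / 2"
      using N jk by (intro add_strict_mono) auto
    finally show ?thesis by simp
  qed
  then show "\<exists>N. \<forall>j\<ge>N. \<forall>k\<ge>N. ip_norm ip (\<lambda>z. F j z - F k z) < e" by blast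
qed

end

sublocale hilbert_function_space \<subseteq> semi_inner_product H ip
  by (rule semi_inner_product.intro)
    (fact zero_mem add_mem scale_mem ip_add ip_scale ip_cnj ip_nonneg)+

section \<open>Hilbert function spaces\<close>

context hilbert_function_space
begin

lemma mem_complete:
  assumes "\<And>n. F n \<in> H" "Cauchy_ip F"
  obtains f where "f \<in> H" "(\<lambda>n. ip_norm ip (\<lambda>z. F n z - f z)) \<longlonglongrightarrow> 0"
proof -
  have "\<exists>f\<in>H. (\<lambda>n. ip_norm ip (\<lambda>z. F n z - f z)) \<longlonglongrightarrow> 0"
    using assms(2) unfolding Cauchy_ip_def by (intro complete assms(1))
  then show ?thesis using that by blast
qed

text \<open>The representing vector minimises \<open>\<parallel>v\<parallel>\<^sup>2 - 2 Re (\<phi> v)\<close> over the closure of \<open>S\<close>.\<close>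

lemma Riesz_on_subspace:
  assumes S: "S \<subseteq> H" "(\<lambda>z. 0) \<in> S" "\<And>f g. f \<in> S \<Longrightarrow> g \<in> S \<Longrightarrow> (\<lambda>z. f z + g z) \<in> S"
      "\<And>c f. f \<in> S \<Longrightarrow> (\<lambda>z. c * f z) \<in> S"
    and \<phi>_add: "\<And>f g. f \<in> S \<Longrightarrow> g \<in> S \<Longrightarrow> \<phi> (\<lambda>z. f z + g z) = \<phi> f + \<phi> g"
    and \<phi>_scale: "\<And>c f. f \<in> S \<Longrightarrow> \<phi> (\<lambda>z. c * f z) = c * \<phi> f"
    and C: "C \<ge> 0" "\<And>f. f \<in> S \<Longrightarrow> cmod (\<phi> f) \<le> C * ip_norm ip f"
  shows "\<exists>g\<in>H. \<exists>F. (\<forall>n :: nat. F n \<in> S) \<and> (\<lambda>n. ip_norm ip (\<lambda>z. F n z - g z)) \<longlonglongrightarrow> 0 \<and>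
    (\<forall>f\<in>S. ip f g = \<phi> f) \<and> ip_norm ip g \<le> C"
proof -
  define J where "J v = Re (ip v v) - 2 * Re (\<phi> v)" for v
  have SH: "v \<in> H" if "v \<in> S" for v using S(1) that by blast
  have lower: "- C\<^sup>2 \<le> J v" if v: "v \<in> S" for v
  proof -
    let ?n = "ip_norm ip v"
    have "Re (\<phi> v) \<le> C * ?n" using C(2)[OF v] complex_Re_le_cmod[of "\<phi> v"] by linarith
    then have "?n\<^sup>2 - 2 * (C * ?n) \<le> J v" using ip_norm_sq[OF SH[OF v]] by (simp add: J_def)
    moreover have "0 \<le> (?n - C)\<^sup>2" by simp
    ultimately show ?thesis by (simp add: power2_diff mult_ac)
  qed
  define m where "m = Inf (J ` S)"
  have bdd: "bdd_below (J ` S)" by (rule bdd_belowI2) (rule lower)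
  have m_le: "m \<le> J v" if "v \<in> S" for v
    unfolding m_def using bdd that by (auto intro: cInf_lower)
  have "\<exists>v\<in>S. J v < m + 1 / real (Suc n)" for n
    using cInf_lessD[of "J ` S" "m + 1 / real (Suc n)"] S(2) by (fastforce simp: m_def)
  then obtain F where F: "\<And>n. F n \<in> S" "\<And>n. J (F n) < m + 1 / real (Suc n)" by metis
  have FH: "F n \<in> H" for n using F SH by blast
  \<comment> \<open>Parallelogram law with the midpoint \<open>?h\<close>, where \<open>J\<close> is
    again at least \<open>m\<close>: near-minimisers are close to one another.\<close>
  have par: "(ip_norm ip (\<lambda>z. u z - v z))\<^sup>2 \<le> 2 * (J u - m) + 2 * (J v - m)" if u: "u \<in> S" and v: "v \<in> S" for u v
  proof -
    note uv = SH[OF u] SH[OF v]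
    let ?h = "\<lambda>z. (1/2) * (u z + v z)"
    have hS: "?h \<in> S" using S u v by blast
    have "Re (ip (\<lambda>z. u z - v z) (\<lambda>z. u z - v z)) + 4 * Re (ip ?h ?h)
        = 2 * Re (ip u u) + 2 * Re (ip v v)"
    proof -
      have "(ip_norm ip ?h)\<^sup>2 = (1/4) * (ip_norm ip (\<lambda>z. u z + v z))\<^sup>2"
        unfolding ip_norm_scale[OF add_mem[OF uv]] by (simp add: power_mult_distrib power2_eq_square norm_divide)
      then have "Re (ip ?h ?h) = (1/4) * Re (ip (\<lambda>z. u z + v z) (\<lambda>z. u z + v z))"
        unfolding ip_norm_sq[OF SH[OF hS]] ip_norm_sq[OF add_mem[OF uv]] .
      then show ?thesis using uv
        by (simp add: ip_add ip_add_right ip_diff ip_diff_right add_mem diff_mem)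
    qed
    moreover have "Re (\<phi> ?h) = (Re (\<phi> u) + Re (\<phi> v)) / 2"
      unfolding \<phi>_scale[OF S(3)[OF u v]] \<phi>_add[OF u v] by simp
    ultimately have "Re (ip (\<lambda>z. u z - v z) (\<lambda>z. u z - v z)) = 2 * J u + 2 * J v - 4 * J ?h"
      by (simp add: J_def)
    moreover have "m \<le> J ?h" using m_le hS by blast
    ultimately show ?thesis using ip_norm_sq[OF diff_mem[OF uv]] by simp
  qed
  have "Cauchy_ip F"
    unfolding Cauchy_ip_def
  proof (intro allI impI)
    fix e :: real assume e: "e > 0"
    obtain N where N: "1 / real (Suc N) < e\<^sup>2 / 4" using nat_approx_posE[of "e\<^sup>2 / 4"] e by auto
    have "ip_norm ip (\<lambda>z. F j z - F k z) < e" if "j \<ge> N" "k \<ge> N" for j k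
    proof -
      have J: "J (F i) - m < e\<^sup>2 / 4" if "i \<ge> N" for i
      proof -
        have "1 / real (Suc i) \<le> 1 / real (Suc N)" using that by (auto simp: field_simps)
        then show ?thesis using F(2)[of i] N by linarith
      qed
      have "(ip_norm ip (\<lambda>z. F j z - F k z))\<^sup>2 < e\<^sup>2"
      proof -
        have "a \<le> 2 * x + 2 * y \<Longrightarrow> x < d / 4 \<Longrightarrow> y < d / 4 \<Longrightarrow> a < d" for a x y d :: real by simp
        from this[OF par[OF F(1)[of j] F(1)[of k]] J[OF that(1)] J[OF that(2)]] show ?thesis .
      qed
      then show ?thesis using e by (simp add: power2_less_imp_less)
    qed
    then show "\<exists>N. \<forall>j\<ge>N. \<forall>k\<ge>N. ip_norm ip (\<lambda>z. F j z - F k z) < e" by blast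
  qed
  then obtain g where g: "g \<in> H" "(\<lambda>n. ip_norm ip (\<lambda>z. F n z - g z)) \<longlonglongrightarrow> 0"
    using mem_complete[of F] FH by blast
  have rep: "ip v g = \<phi> v" if v: "v \<in> S" for v
  proof -
    define e where "e = ip v g - \<phi> v"
    have "(\<lambda>n. ip (F n) v) \<longlonglongrightarrow> ip g v" using tendsto_ip_const FH g SH[OF v] by blast
    then have "(\<lambda>n. cnj (ip (F n) v)) \<longlonglongrightarrow> cnj (ip g v)" by (rule tendsto_cnj)
    then have lim: "(\<lambda>n. ip v (F n) - \<phi> v) \<longlonglongrightarrow> e"
      using ip_cnj[OF FH SH[OF v]] ip_cnj[OF g(1) SH[OF v]]
      by (auto simp: e_def intro: tendsto_diff)
    \<comment> \<open>First variation: adding \<open>c\<close> times \<open>v\<close> to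
      \<open>F n\<close> cannot bring \<open>J\<close> below \<open>m\<close>, and in the limit only
      the linear and the quadratic term in \<open>c\<close> remain.\<close>
    have var: "0 \<le> 2 * Re (c * e) + (cmod c)\<^sup>2 * Re (ip v v)" for c
    proof -
      have "0 \<le> 2 * Re (c * (ip v (F n) - \<phi> v)) + (cmod c)\<^sup>2 * Re (ip v v) + 1 / real (Suc n)" for n
      proof -
        have "(\<lambda>z. F n z + c * v z) \<in> S" using S F v by blast
        then have "m \<le> J (\<lambda>z. F n z + c * v z)" by (rule m_le)
        also have "\<dots> = J (F n) + 2 * Re (c * (ip v (F n) - \<phi> v)) + (cmod c)\<^sup>2 * Re (ip v v)"
          using Re_ip_add_scale[OF FH[of n] SH[OF v], of c] \<phi>_add[OF F(1)[of n] S(4)[OF v]] \<phi>_scale[OF v]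
          by (simp add: J_def algebra_simps)
        finally show ?thesis using F(2)[of n] by simp
      qed
      moreover have "(\<lambda>n. 2 * Re (c * (ip v (F n) - \<phi> v)) + (cmod c)\<^sup>2 * Re (ip v v) + 1 / real (Suc n))
          \<longlonglongrightarrow> 2 * Re (c * e) + (cmod c)\<^sup>2 * Re (ip v v) + 0"
        by (intro tendsto_intros lim LIMSEQ_Suc[OF lim_1_over_n])
      ultimately have "0 \<le> 2 * Re (c * e) + (cmod c)\<^sup>2 * Re (ip v v) + 0"
        by (intro LIMSEQ_le_const) auto
      then show ?thesis by simp
    qed
    have "e = 0"
    proof (rule ccontr)
      assume ne: "e \<noteq> 0"
      define N where "N = Re (ip v v)"
      define n where "n = (cmod e)\<^sup>2"
      \<comment> \<open>For \<open>c\<close> equal to \<open>- t\<close> times \<open>cnj e\<close>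
        the variation inequality demands \<open>2 \<le> t * N\<close>; this \<open>t\<close> keeps
        \<open>t * N\<close> below 1, also when \<open>N = 0\<close>.\<close>
      define t where "t = 1 / (N + 1)"
      have N: "N \<ge> 0" using ip_nonneg SH[OF v] by (simp add: N_def)
      have n: "n > 0" using ne by (simp add: n_def)
      have t: "t > 0" using N by (simp add: t_def)
      have "- of_real t * cnj e * e = - of_real t * of_real n"
        by (simp only: n_def complex_norm_square mult.commute mult.left_commute)
      also have "\<dots> = of_real (- t * n)" by simp
      finally have "Re (- of_real t * cnj e * e) = - t * n" by (simp only: Re_complex_of_real)
      then have "0 \<le> - 2 * (t * n) + t\<^sup>2 * n * N"
        using var[of "- of_real t * cnj e"]
        by (simp add: N_def n_def norm_mult power_mult_distrib)
      then have "2 * (t * n) \<le> (t * n) * (t * N)" by (simp add: power2_eq_square mult_ac)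
      then have "2 \<le> t * N" using t n by simp
      moreover have "t * N < 1" using N by (simp add: t_def)
      ultimately show False by simp
    qed
    then show ?thesis by (simp add: e_def)
  qed
  \<comment> \<open>The limit \<open>g\<close> need not lie in \<open>S\<close>, so the bound on the
    functional is applied to \<open>F n\<close> and passed to the limit.\<close>
  have "ip_norm ip g \<le> C"
  proof (cases "ip_norm ip g = 0")
    case False
    then have pos: "ip_norm ip g > 0" using ip_norm_nonneg[OF g(1)] by simp
    have 1: "(\<lambda>n. cmod (ip (F n) g)) \<longlonglongrightarrow> cmod (ip g g)"
      using tendsto_norm[OF tendsto_ip_const[OF FH g(1) g(1) g(2)]] .
    have 2: "(\<lambda>n. C * (ip_norm ip g + ip_norm ip (\<lambda>z. F n z - g z))) \<longlonglongrightarrow> C * (ip_norm ip g + 0)"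
      by (intro tendsto_intros g)
    have "cmod (ip (F n) g) \<le> C * (ip_norm ip g + ip_norm ip (\<lambda>z. F n z - g z))" for n
      using rep[OF F(1)[of n]] C(2)[OF F(1)[of n]]
        mult_left_mono[OF ip_norm_le_add_diff[OF FH[of n] g(1)] C(1)] by simp
    then have "cmod (ip g g) \<le> C * (ip_norm ip g + 0)"
      by (intro LIMSEQ_le[OF 1 2]) auto
    then have "(ip_norm ip g)\<^sup>2 \<le> C * ip_norm ip g"
      using ip_norm_sq[OF g(1)] complex_Re_le_cmod[of "ip g g"] by simp
    then show ?thesis using pos by (simp add: power2_eq_square)
  qed (use C in simp)
  then show ?thesis using g F(1) rep by blast
qed

text \<open>Representing the functional \<open>ip v f\<close> of \<open>v \<in> S\<close> by a limit
  \<open>g\<close> of elements of \<open>S\<close> amounts to projecting \<open>f\<close>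
  orthogonally; then \<open>f - g\<close> is orthogonal to \<open>S\<close> and therefore
  zero.\<close>

lemma dense_of_trivial_complement:
  assumes S: "S \<subseteq> H" "(\<lambda>z. 0) \<in> S" "\<And>f g. f \<in> S \<Longrightarrow> g \<in> S \<Longrightarrow> (\<lambda>z. f z + g z) \<in> S"
      "\<And>c f. f \<in> S \<Longrightarrow> (\<lambda>z. c * f z) \<in> S"
    and triv: "\<And>f. f \<in> H \<Longrightarrow> (\<And>v. v \<in> S \<Longrightarrow> ip v f = 0) \<Longrightarrow> f = (\<lambda>z. 0)"
    and f: "f \<in> H"
  obtains F where "\<And>n :: nat. F n \<in> S" "(\<lambda>n. ip_norm ip (\<lambda>z. F n z - f z)) \<longlonglongrightarrow> 0"
proof -
  have SH: "v \<in> H" if "v \<in> S" for v using S(1) that by blast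
  have *: "ip (\<lambda>z. u z + v z) f = ip u f + ip v f" if "u \<in> S" "v \<in> S" for u v
    using that f by (simp add: ip_add SH)
  have **: "ip (\<lambda>z. c * u z) f = c * ip u f" if "u \<in> S" for c u
    using that f by (simp add: ip_scale SH)
  have ***: "cmod (ip u f) \<le> ip_norm ip f * ip_norm ip u" if "u \<in> S" for u
    using Cauchy_Schwarz_ip[OF SH[OF that] f] by (simp add: mult.commute)
  have "\<exists>g\<in>H. \<exists>F. (\<forall>n :: nat. F n \<in> S) \<and> (\<lambda>n. ip_norm ip (\<lambda>z. F n z - g z)) \<longlonglongrightarrow> 0 \<and>
    (\<forall>v\<in>S. ip v g = ip v f) \<and> ip_norm ip g \<le> ip_norm ip f"
    by (rule Riesz_on_subspace[OF S]) (use * ** *** ip_norm_nonneg[OF f] in auto)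
  then obtain g F where g: "g \<in> H" "\<And>n :: nat. F n \<in> S"
    "(\<lambda>n. ip_norm ip (\<lambda>z. F n z - g z)) \<longlonglongrightarrow> 0" "\<And>v. v \<in> S \<Longrightarrow> ip v g = ip v f"
    by blast
  have "(\<lambda>z. f z - g z) = (\<lambda>z. 0)"
    by (rule triv[OF diff_mem[OF f g(1)]]) (simp add: ip_diff_right f g SH)
  then have "f = g" by (metis eq_iff_diff_eq_0 ext)
  then show ?thesis using that g by blast
qed

end

section \<open>Positive definite kernels\<close>

definition fin_support :: "'a set \<Rightarrow> ('a \<Rightarrow> complex) set" where
  "fin_support X = {u. finite {x. u x \<noteq> 0} \<and> {x. u x \<noteq> 0} \<subseteq> X}"

text \<open>The Gram form: in the space with kernel \<open>K\<close> it is the inner product of the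
  combinations of the functions \<open>\<lambda>z. K z x\<close> with coefficients \<open>u\<close>
  and \<open>v\<close>. This explains the order of arguments in \<open>K y x\<close>.\<close>

definition kernel_form ::
  "('a \<Rightarrow> 'a \<Rightarrow> complex) \<Rightarrow> ('a \<Rightarrow> complex) \<Rightarrow> ('a \<Rightarrow> complex) \<Rightarrow> complex" where
  "kernel_form K u v = (\<Sum>x | u x \<noteq> 0. \<Sum>y | v y \<noteq> 0. u x * cnj (v y) * K y x)"

text \<open>The positivity clause constrains only the real part of the form, so hermitian symmetry
  is stated separately.\<close>

definition pos_kernel :: "'a set \<Rightarrow> ('a \<Rightarrow> 'a \<Rightarrow> complex) \<Rightarrow> bool" where
  "pos_kernel X K \<longleftrightarrow> (\<forall>x\<in>X. \<forall>y\<in>X. K x y = cnj (K y x)) \<and>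
     (\<forall>u\<in>fin_support X. 0 \<le> Re (kernel_form K u u))"

text \<open>In the space with kernel \<open>K\<close> this says that \<open>q\<close> is a member of norm at most \<open>C\<close>.\<close>

definition dominated :: "'a set \<Rightarrow> ('a \<Rightarrow> 'a \<Rightarrow> complex) \<Rightarrow> ('a \<Rightarrow> complex) \<Rightarrow> real \<Rightarrow> bool" where
  "dominated X K q C \<longleftrightarrow>
     (\<forall>u\<in>fin_support X. cmod (\<Sum>x | u x \<noteq> 0. u x * cnj (q x)) \<le> C * ip_norm (kernel_form K) u)"

lemma fin_support_finite: "u \<in> fin_support X \<Longrightarrow> finite {x. u x \<noteq> 0}"
  and fin_support_mem: "u \<in> fin_support X \<Longrightarrow> u x \<noteq> 0 \<Longrightarrow> x \<in> X"
  by (auto simp: fin_support_def)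

lemma sum_support_superset:
  fixes g :: "'a \<Rightarrow> complex"
  assumes "finite A" "{x. u x \<noteq> 0} \<subseteq> A" "\<And>x. u x = 0 \<Longrightarrow> g x = 0"
  shows "(\<Sum>x | u x \<noteq> 0. g x) = sum g A"
  using assms by (intro sum.mono_neutral_left) auto

lemma kernel_form_superset:
  assumes "finite A" "{x. u x \<noteq> 0} \<subseteq> A" "finite B" "{x. v x \<noteq> 0} \<subseteq> B"
  shows "kernel_form K u v = (\<Sum>x\<in>A. \<Sum>y\<in>B. u x * cnj (v y) * K y x)"
proof -
  have "kernel_form K u v = (\<Sum>x | u x \<noteq> 0. \<Sum>y\<in>B. u x * cnj (v y) * K y x)"
    unfolding kernel_form_def by (intro sum.cong refl sum_support_superset assms) auto
  also have "\<dots> = (\<Sum>x\<in>A. \<Sum>y\<in>B. u x * cnj (v y) * K y x)"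
    by (intro sum_support_superset assms) auto
  finally show ?thesis .
qed

lemma fin_support_zero: "(\<lambda>z. 0) \<in> fin_support X"
  by (simp add: fin_support_def)

lemma fin_support_add:
  assumes "u \<in> fin_support X" "v \<in> fin_support X"
  shows "(\<lambda>z. u z + v z) \<in> fin_support X"
proof -
  have "{z. u z + v z \<noteq> 0} \<subseteq> {z. u z \<noteq> 0} \<union> {z. v z \<noteq> 0}" by auto
  then show ?thesis using assms unfolding fin_support_def
    by (auto intro: finite_subset[of _ "{z. u z \<noteq> 0} \<union> {z. v z \<noteq> 0}"])
qed

lemma fin_support_mult:
  assumes "u \<in> fin_support X"
  shows "(\<lambda>z. u z * g z) \<in> fin_support X" "(\<lambda>z. g z * u z) \<in> fin_support X"
  using assms unfolding fin_support_def by (auto intro: finite_subset[of _ "{z. u z \<noteq> 0}"])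

lemma fin_support_diff:
  assumes "u \<in> fin_support X" "v \<in> fin_support X"
  shows "(\<lambda>x. u x - v x) \<in> fin_support X"
  using fin_support_add[OF assms(1) fin_support_mult(2)[OF assms(2), of "\<lambda>_. -1"]] by simp

lemma kernel_form_add:
  assumes "u \<in> fin_support X" "v \<in> fin_support X" "w \<in> fin_support X"
  shows "kernel_form K (\<lambda>z. u z + v z) w = kernel_form K u w + kernel_form K v w"
proof -
  define A where "A = {z. u z \<noteq> 0} \<union> {z. v z \<noteq> 0} \<union> {z. w z \<noteq> 0}"
  have A: "finite A" using assms by (auto simp: A_def fin_support_def)
  have sub: "{z. u z + v z \<noteq> 0} \<subseteq> A" "{z. u z \<noteq> 0} \<subseteq> A" "{z. v z \<noteq> 0} \<subseteq> A" "{z. w z \<noteq> 0} \<subseteq> A"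
    by (auto simp: A_def)
  note s = kernel_form_superset[OF A _ A sub(4)]
  show ?thesis
    unfolding s[OF sub(1)] s[OF sub(2)] s[OF sub(3)] by (simp add: distrib_right sum.distrib)
qed

lemma kernel_form_scale:
  assumes "u \<in> fin_support X" "w \<in> fin_support X"
  shows "kernel_form K (\<lambda>z. c * u z) w = c * kernel_form K u w"
proof -
  define A where "A = {z. u z \<noteq> 0} \<union> {z. w z \<noteq> 0}"
  have A: "finite A" using assms by (auto simp: A_def fin_support_def)
  have sub: "{z. c * u z \<noteq> 0} \<subseteq> A" "{z. u z \<noteq> 0} \<subseteq> A" "{z. w z \<noteq> 0} \<subseteq> A"
    by (auto simp: A_def)
  note s = kernel_form_superset[OF A _ A sub(3)]
  show ?thesis
    unfolding s[OF sub(1)] s[OF sub(2)] by (simp add: sum_distrib_left mult.assoc)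
qed

lemma kernel_form_cnj:
  assumes "pos_kernel X K" "u \<in> fin_support X" "v \<in> fin_support X"
  shows "kernel_form K v u = cnj (kernel_form K u v)"
proof -
  have "cnj (kernel_form K u v) = (\<Sum>x | u x \<noteq> 0. \<Sum>y | v y \<noteq> 0. v y * cnj (u x) * K x y)"
    unfolding kernel_form_def cnj_sum
  proof (intro sum.cong refl)
    fix x y assume "x \<in> {x. u x \<noteq> 0}" "y \<in> {y. v y \<noteq> 0}"
    then have "x \<in> X" "y \<in> X" using assms fin_support_mem by fastforce+
    then have "K x y = cnj (K y x)" using assms(1) unfolding pos_kernel_def by blast
    then show "cnj (u x * cnj (v y) * K y x) = v y * cnj (u x) * K x y" by simp
  qed
  also have "\<dots> = kernel_form K v u" unfolding kernel_form_def by (rule sum.swap)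
  finally show ?thesis by simp
qed

lemma semi_inner_product_kernel_form:
  "pos_kernel X K \<Longrightarrow> semi_inner_product (fin_support X) (kernel_form K)"
proof (rule semi_inner_product.intro)
  fix u assume "pos_kernel X K" "u \<in> fin_support X"
  then show "0 \<le> Re (kernel_form K u u)" by (auto simp: pos_kernel_def)
qed (auto intro: fin_support_zero fin_support_add fin_support_mult kernel_form_add kernel_form_scale kernel_form_cnj)

definition point_mass :: "'a \<Rightarrow> 'a \<Rightarrow> complex" where
  "point_mass w = (\<lambda>x. if x = w then 1 else 0)"

lemma fin_support_point_mass: "w \<in> X \<Longrightarrow> point_mass w \<in> fin_support X"
  by (auto simp: fin_support_def point_mass_def)

definition kernel_comb :: "'a set \<Rightarrow> ('a \<Rightarrow> 'a \<Rightarrow> complex) \<Rightarrow> ('a \<Rightarrow> complex) \<Rightarrow> 'a \<Rightarrow> complex" where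
  "kernel_comb X K u = zero_ext X (\<lambda>z. \<Sum>x | u x \<noteq> 0. u x * K z x)"

lemma support_point_mass: "{x. point_mass w x \<noteq> 0} = {w}"
  by (auto simp: point_mass_def)

lemma kernel_form_point_mass:
  assumes "w \<in> X"
  shows "kernel_form K u (point_mass w) = kernel_comb X K u w"
  using assms by (simp add: kernel_form_def kernel_comb_def zero_ext_def support_point_mass)
    (simp add: point_mass_def)

lemma kernel_comb_point_mass: "kernel_comb X K (point_mass w) = zero_ext X (\<lambda>z. K z w)"
  unfolding kernel_comb_def support_point_mass by (simp add: point_mass_def)

lemma kernel_form_eval:
  assumes "u \<in> fin_support X" "v \<in> fin_support X"
  shows "kernel_form K u v = (\<Sum>y | v y \<noteq> 0. cnj (v y) * kernel_comb X K u y)"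
proof -
  have "kernel_form K u v = (\<Sum>y | v y \<noteq> 0. \<Sum>x | u x \<noteq> 0. u x * cnj (v y) * K y x)"
    unfolding kernel_form_def by (rule sum.swap)
  also have "\<dots> = (\<Sum>y | v y \<noteq> 0. cnj (v y) * kernel_comb X K u y)"
  proof (intro sum.cong refl)
    fix y assume "y \<in> {y. v y \<noteq> 0}"
    then have "y \<in> X" using assms fin_support_mem by fastforce
    then show "(\<Sum>x | u x \<noteq> 0. u x * cnj (v y) * K y x) = cnj (v y) * kernel_comb X K u y"
      by (simp add: kernel_comb_def zero_ext_def sum_distrib_left mult_ac)
  qed
  finally show ?thesis .
qed

lemma kernel_comb_add:
  assumes "u \<in> fin_support X" "v \<in> fin_support X"
  shows "kernel_comb X K (\<lambda>z. u z + v z) = (\<lambda>z. kernel_comb X K u z + kernel_comb X K v z)"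
proof
  fix z
  show "kernel_comb X K (\<lambda>z. u z + v z) z = kernel_comb X K u z + kernel_comb X K v z"
    using kernel_form_add[OF assms fin_support_point_mass[of z]]
    by (cases "z \<in> X") (simp_all add: kernel_form_point_mass, simp add: kernel_comb_def zero_ext_def)
qed

lemma kernel_comb_scale:
  assumes "u \<in> fin_support X"
  shows "kernel_comb X K (\<lambda>z. c * u z) = (\<lambda>z. c * kernel_comb X K u z)"
proof
  fix z
  show "kernel_comb X K (\<lambda>z. c * u z) z = c * kernel_comb X K u z"
    using kernel_form_scale[OF assms fin_support_point_mass[of z]]
    by (cases "z \<in> X") (simp_all add: kernel_form_point_mass, simp add: kernel_comb_def zero_ext_def)
qed

lemma kernel_comb_zero: "kernel_comb X K (\<lambda>z. 0) = (\<lambda>z. 0)"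
  by (simp add: kernel_comb_def zero_ext_def fun_eq_iff)

section \<open>The reproducing kernel Hilbert space of a positive kernel\<close>

context
  fixes X :: "'a set" and K :: "'a \<Rightarrow> 'a \<Rightarrow> complex"
  assumes pos: "pos_kernel X K"
begin

interpretation S: semi_inner_product "fin_support X" "kernel_form K"
  by (rule semi_inner_product_kernel_form[OF pos])

text \<open>Elements of the completion are realised as functions, namely as pointwise limits of
  kernel combinations along Cauchy sequences of coefficients. This replaces equivalence classes of
  Cauchy sequences.\<close>

definition approximates :: "(nat \<Rightarrow> 'a \<Rightarrow> complex) \<Rightarrow> ('a \<Rightarrow> complex) \<Rightarrow> bool" where
  "approximates U f \<longleftrightarrow> (\<forall>n. U n \<in> fin_support X) \<and> S.Cauchy_ip U \<and>
     (\<forall>z. (\<lambda>n. kernel_comb X K (U n) z) \<longlonglongrightarrow> f z)"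

definition kernel_space :: "('a \<Rightarrow> complex) set" where
  "kernel_space = {f. \<exists>U. approximates U f}"

definition approximant :: "('a \<Rightarrow> complex) \<Rightarrow> nat \<Rightarrow> 'a \<Rightarrow> complex" where
  "approximant f = (SOME U. approximates U f)"

text \<open>Computed along one chosen approximating sequence for each function;
  \<open>kernel_form_tendsto_unique\<close> shows that the choice is immaterial.\<close>

definition kernel_ip :: "('a \<Rightarrow> complex) \<Rightarrow> ('a \<Rightarrow> complex) \<Rightarrow> complex" where
  "kernel_ip f g = lim (\<lambda>n. kernel_form K (approximant f n) (approximant g n))"

lemma approximatesD:
  assumes "approximates U f"
  shows "U n \<in> fin_support X" "S.Cauchy_ip U" "(\<lambda>n. kernel_comb X K (U n) z) \<longlonglongrightarrow> f z"
  using assms by (auto simp: approximates_def)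

lemma approximates_approximant: "f \<in> kernel_space \<Longrightarrow> approximates (approximant f) f"
  unfolding kernel_space_def approximant_def mem_Collect_eq by (rule someI_ex[where P = "\<lambda>U. approximates U f"])

lemma approximates_add:
  assumes "approximates U f" "approximates V g"
  shows "approximates (\<lambda>n z. U n z + V n z) (\<lambda>z. f z + g z)"
  unfolding approximates_def
proof (intro conjI allI)
  note U = approximatesD[OF assms(1)] and V = approximatesD[OF assms(2)]
  show "(\<lambda>z. U n z + V n z) \<in> fin_support X" for n by (rule S.add_mem[OF U(1) V(1)])
  show "S.Cauchy_ip (\<lambda>n z. U n z + V n z)" by (rule S.Cauchy_ip_add[OF U(1) V(1) U(2) V(2)])
  show "(\<lambda>n. kernel_comb X K (\<lambda>z. U n z + V n z) z) \<longlonglongrightarrow> f z + g z" for z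
    unfolding kernel_comb_add[OF U(1) V(1)] by (intro tendsto_intros U V)
qed

lemma approximates_scale:
  assumes "approximates U f"
  shows "approximates (\<lambda>n z. c * U n z) (\<lambda>z. c * f z)"
  unfolding approximates_def
proof (intro conjI allI)
  note U = approximatesD[OF assms(1)]
  show "(\<lambda>z. c * U n z) \<in> fin_support X" for n by (rule S.scale_mem[OF U(1)])
  show "S.Cauchy_ip (\<lambda>n z. c * U n z)" by (rule S.Cauchy_ip_scale[OF U(1,2)])
  show "(\<lambda>n. kernel_comb X K (\<lambda>z. c * U n z) z) \<longlonglongrightarrow> c * f z" for z
    unfolding kernel_comb_scale[OF U(1)] by (intro tendsto_intros U)
qed

lemma approximates_diff:
  assumes "approximates U f" "approximates V g"
  shows "approximates (\<lambda>n z. U n z - V n z) (\<lambda>z. f z - g z)"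
  using approximates_add[OF assms(1) approximates_scale[OF assms(2), of "-1"]] by simp

lemma approximates_const:
  assumes "u \<in> fin_support X"
  shows "approximates (\<lambda>n. u) (kernel_comb X K u)"
  using assms S.Cauchy_ip_const by (simp add: approximates_def)

text \<open>Pairing \<open>U k\<close> with a fixed \<open>U n\<close> is, up to conjugation, a
  finite combination of values of \<open>kernel_comb X K (U k)\<close>, hence tends to zero, and
  \<open>Cauchy_ip_null\<close> applies. Passing to the pointwise limit therefore loses nothing of
  the completion.\<close>

lemma approximates_zero_null:
  assumes "approximates U (\<lambda>z. 0)"
  shows "(\<lambda>n. ip_norm (kernel_form K) (U n)) \<longlonglongrightarrow> 0"
proof (rule S.Cauchy_ip_null)
  note U = approximatesD[OF assms]
  show "(\<lambda>k. kernel_form K (U n) (U k)) \<longlonglongrightarrow> 0" for n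
  proof -
    have "(\<lambda>k. cnj (\<Sum>y | U n y \<noteq> 0. cnj (U n y) * kernel_comb X K (U k) y)) \<longlonglongrightarrow>
        cnj (\<Sum>y | U n y \<noteq> 0. cnj (U n y) * 0)"
      by (intro tendsto_intros U)
    moreover have "kernel_form K (U n) (U k) = cnj (\<Sum>y | U n y \<noteq> 0. cnj (U n y) * kernel_comb X K (U k) y)" for k
      using kernel_form_cnj[OF pos U(1) U(1), of k n] kernel_form_eval[OF U(1) U(1), of K k n] by simp
    ultimately show ?thesis by simp
  qed
qed (use approximatesD[OF assms] in auto)

text \<open>The differences of \<open>U\<close> and \<open>U'\<close> and of \<open>V\<close> and
  \<open>V'\<close> approximate the zero function, so they are null in norm, while the sequences
  themselves are bounded.\<close>

lemma kernel_form_tendsto_unique: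
  assumes "approximates U f" "approximates U' f" "approximates V g" "approximates V' g"
  shows "(\<lambda>n. kernel_form K (U n) (V n) - kernel_form K (U' n) (V' n)) \<longlonglongrightarrow> 0"
proof -
  note U = approximatesD[OF assms(1)] and U' = approximatesD[OF assms(2)]
    and V = approximatesD[OF assms(3)] and V' = approximatesD[OF assms(4)]
  obtain C where C: "C > 0" "\<And>n. ip_norm (kernel_form K) (U' n) \<le> C"
    using S.Cauchy_ip_bounded[OF U'(1,2)] by blast
  obtain D where D: "D > 0" "\<And>n. ip_norm (kernel_form K) (V n) \<le> D"
    using S.Cauchy_ip_bounded[OF V(1,2)] by blast
  let ?N = "ip_norm (kernel_form K)"
  have u: "(\<lambda>n. ?N (\<lambda>z. U n z - U' n z)) \<longlonglongrightarrow> 0"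
    using approximates_diff[OF assms(1,2)] by (intro approximates_zero_null) simp
  have v: "(\<lambda>n. ?N (\<lambda>z. V n z - V' n z)) \<longlonglongrightarrow> 0"
    using approximates_diff[OF assms(3,4)] by (intro approximates_zero_null) simp
  have "(\<lambda>n. ?N (\<lambda>z. U n z - U' n z) * D + C * ?N (\<lambda>z. V n z - V' n z)) \<longlonglongrightarrow> 0 * D + C * 0"
    by (intro tendsto_intros u v)
  then have lim: "(\<lambda>n. ?N (\<lambda>z. U n z - U' n z) * D + C * ?N (\<lambda>z. V n z - V' n z)) \<longlonglongrightarrow> 0" by simp
  have "cmod (kernel_form K (U n) (V n) - kernel_form K (U' n) (V' n)) \<le>
      ?N (\<lambda>z. U n z - U' n z) * D + C * ?N (\<lambda>z. V n z - V' n z)" for n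
  proof -
    have "cmod (kernel_form K (U n) (V n) - kernel_form K (U' n) (V' n)) \<le>
      ?N (\<lambda>z. U n z - U' n z) * ?N (V n) + ?N (U' n) * ?N (\<lambda>z. V n z - V' n z)"
      by (rule S.norm_ip_diff_le[OF U(1) V(1) U'(1) V'(1)])
    also have "\<dots> \<le> ?N (\<lambda>z. U n z - U' n z) * D + C * ?N (\<lambda>z. V n z - V' n z)"
      using S.ip_norm_nonneg[OF S.diff_mem[OF U(1) U'(1)]] S.ip_norm_nonneg[OF S.diff_mem[OF V(1) V'(1)]]
      by (intro add_mono mult_left_mono mult_right_mono C D)
    finally show ?thesis .
  qed
  then show ?thesis by (intro Lim_null_comparison[OF _ lim]) simp
qed

lemma kernel_ip_tendsto:
  assumes "approximates U f" "approximates V g"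
  shows "(\<lambda>n. kernel_form K (U n) (V n)) \<longlonglongrightarrow> kernel_ip f g"
proof -
  have a: "approximates (approximant f) f" "approximates (approximant g) g"
    using assms approximates_approximant by (auto simp: kernel_space_def)
  have "convergent (\<lambda>n. kernel_form K (approximant f n) (approximant g n))"
    by (intro S.Cauchy_ip_convergent approximatesD[OF a(1)] approximatesD[OF a(2)])
  then have "(\<lambda>n. kernel_form K (approximant f n) (approximant g n)) \<longlonglongrightarrow> kernel_ip f g"
    unfolding kernel_ip_def by (simp add: convergent_LIMSEQ_iff)
  from tendsto_add[OF kernel_form_tendsto_unique[OF assms(1) a(1) assms(2) a(2)] this]
  show ?thesis by simp
qed

lemma ip_norm_kernel_ip_tendsto:
  assumes "approximates U f"
  shows "(\<lambda>n. ip_norm (kernel_form K) (U n)) \<longlonglongrightarrow> ip_norm kernel_ip f"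
  unfolding ip_norm_def by (intro tendsto_intros kernel_ip_tendsto assms)

lemma semi_inner_product_kernel_ip: "semi_inner_product kernel_space kernel_ip"
proof (rule semi_inner_product.intro)
  show "(\<lambda>z. 0) \<in> kernel_space"
    using approximates_const[OF fin_support_zero] by (auto simp: kernel_space_def kernel_comb_zero)
next
  fix f g assume "f \<in> kernel_space" "g \<in> kernel_space"
  then show "(\<lambda>z. f z + g z) \<in> kernel_space"
    unfolding kernel_space_def mem_Collect_eq by (blast intro: approximates_add)
next
  fix f c assume "f \<in> kernel_space"
  then show "(\<lambda>z. c * f z) \<in> kernel_space"
    unfolding kernel_space_def mem_Collect_eq by (blast intro: approximates_scale)
next
  fix f g h assume "f \<in> kernel_space" "g \<in> kernel_space" "h \<in> kernel_space"
  then obtain U V W where a: "approximates U f" "approximates V g" "approximates W h"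
    by (auto simp: kernel_space_def)
  note U = approximatesD[OF a(1)] and V = approximatesD[OF a(2)] and W = approximatesD[OF a(3)]
  have "(\<lambda>n. kernel_form K (U n) (W n) + kernel_form K (V n) (W n)) \<longlonglongrightarrow> kernel_ip (\<lambda>z. f z + g z) h"
    using kernel_ip_tendsto[OF approximates_add[OF a(1,2)] a(3)] by (simp add: S.ip_add U V W)
  moreover have "(\<lambda>n. kernel_form K (U n) (W n) + kernel_form K (V n) (W n)) \<longlonglongrightarrow> kernel_ip f h + kernel_ip g h"
    by (intro tendsto_add kernel_ip_tendsto a)
  ultimately show "kernel_ip (\<lambda>z. f z + g z) h = kernel_ip f h + kernel_ip g h"
    by (rule LIMSEQ_unique)
next
  fix f h c assume "f \<in> kernel_space" "h \<in> kernel_space"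
  then obtain U W where a: "approximates U f" "approximates W h"
    by (auto simp: kernel_space_def)
  note U = approximatesD[OF a(1)] and W = approximatesD[OF a(2)]
  have "(\<lambda>n. c * kernel_form K (U n) (W n)) \<longlonglongrightarrow> kernel_ip (\<lambda>z. c * f z) h"
    using kernel_ip_tendsto[OF approximates_scale[OF a(1)] a(2)] by (simp add: S.ip_scale U W)
  moreover have "(\<lambda>n. c * kernel_form K (U n) (W n)) \<longlonglongrightarrow> c * kernel_ip f h"
    by (intro tendsto_mult tendsto_const kernel_ip_tendsto a)
  ultimately show "kernel_ip (\<lambda>z. c * f z) h = c * kernel_ip f h"
    by (rule LIMSEQ_unique)
next
  fix f g assume "f \<in> kernel_space" "g \<in> kernel_space"
  then obtain U W where a: "approximates U f" "approximates W g"
    by (auto simp: kernel_space_def)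
  note U = approximatesD[OF a(1)] and W = approximatesD[OF a(2)]
  have "(\<lambda>n. kernel_form K (W n) (U n)) \<longlonglongrightarrow> cnj (kernel_ip f g)"
    using tendsto_cnj[OF kernel_ip_tendsto[OF a]] S.ip_cnj[OF U(1) W(1)] by simp
  with kernel_ip_tendsto[OF a(2,1)] show "kernel_ip g f = cnj (kernel_ip f g)"
    by (rule LIMSEQ_unique)
next
  fix f assume "f \<in> kernel_space"
  then obtain U where a: "approximates U f" by (auto simp: kernel_space_def)
  have "(\<lambda>n. Re (kernel_form K (U n) (U n))) \<longlonglongrightarrow> Re (kernel_ip f f)"
    by (intro tendsto_intros kernel_ip_tendsto a)
  then show "0 \<le> Re (kernel_ip f f)"
    by (rule LIMSEQ_le_const) (use S.ip_nonneg approximatesD[OF a] in auto)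
qed

interpretation M: semi_inner_product kernel_space kernel_ip
  by (rule semi_inner_product_kernel_ip)

lemma kernel_comb_mem_space: "u \<in> fin_support X \<Longrightarrow> kernel_comb X K u \<in> kernel_space"
  using approximates_const by (auto simp: kernel_space_def)

lemma kernel_comb_dense:
  assumes "f \<in> kernel_space" "e > 0"
  obtains u where "u \<in> fin_support X" "ip_norm kernel_ip (\<lambda>z. f z - kernel_comb X K u z) < e"
proof -
  obtain V where V: "approximates V f" using assms by (auto simp: kernel_space_def)
  obtain N where N: "\<And>j k. j \<ge> N \<Longrightarrow> k \<ge> N \<Longrightarrow> ip_norm (kernel_form K) (\<lambda>z. V j z - V k z) < e / 2"
    using approximatesD(2)[OF V] assms unfolding S.Cauchy_ip_def by (meson half_gt_zero)
  have VN: "V N \<in> fin_support X" by (rule approximatesD[OF V])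
  have lim: "(\<lambda>k. ip_norm (kernel_form K) (\<lambda>z. V k z - V N z)) \<longlonglongrightarrow>
      ip_norm kernel_ip (\<lambda>z. f z - kernel_comb X K (V N) z)"
    by (intro ip_norm_kernel_ip_tendsto approximates_diff V approximates_const VN)
  have "ip_norm kernel_ip (\<lambda>z. f z - kernel_comb X K (V N) z) \<le> e / 2"
    by (rule LIMSEQ_le_const2[OF lim]) (use N[of _ N] in \<open>auto intro!: exI[of _ N] less_imp_le\<close>)
  then show ?thesis using that[OF VN] assms by simp
qed

text \<open>The Moore-Aronszajn construction. It supplies the existence half of the final theorem
  and an ambient Hilbert space for the argument at exponent one.\<close>

lemma kernel_space_RKHS: "reproducing_kernel_hilbert_space X kernel_space kernel_ip K"
proof (intro reproducing_kernel_hilbert_space.intro hilbert_function_space.intro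
    reproducing_kernel_hilbert_space_axioms.intro)
  fix f z assume "f \<in> kernel_space" "z \<notin> X"
  then obtain U where U: "approximates U f" by (auto simp: kernel_space_def)
  have "(\<lambda>n. kernel_comb X K (U n) z) \<longlonglongrightarrow> f z" by (rule approximatesD[OF U])
  then have "(\<lambda>n::nat. 0) \<longlonglongrightarrow> f z" using \<open>z \<notin> X\<close> by (simp add: kernel_comb_def zero_ext_def)
  then show "f z = 0" by (simp add: LIMSEQ_const_iff)
next
  fix f w assume "f \<in> kernel_space" "w \<in> X"
  then obtain U where U: "approximates U f" by (auto simp: kernel_space_def)
  have "(\<lambda>n. kernel_form K (U n) (point_mass w)) \<longlonglongrightarrow> kernel_ip f (kernel_comb X K (point_mass w))"
    by (intro kernel_ip_tendsto U approximates_const fin_support_point_mass \<open>w \<in> X\<close>)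
  then have "(\<lambda>n. kernel_comb X K (U n) w) \<longlonglongrightarrow> kernel_ip f (zero_ext X (\<lambda>z. K z w))"
    by (simp add: kernel_form_point_mass[OF \<open>w \<in> X\<close>] kernel_comb_point_mass)
  then show "kernel_ip f (zero_ext X (\<lambda>z. K z w)) = f w"
    using approximatesD(3)[OF U] by (rule LIMSEQ_unique)
next
  fix w assume "w \<in> X"
  then show "zero_ext X (\<lambda>z. K z w) \<in> kernel_space"
    using kernel_comb_mem_space[OF fin_support_point_mass] by (simp add: kernel_comb_point_mass)
next
  fix f assume f: "f \<in> kernel_space" "kernel_ip f f = 0"
  then obtain U where U: "approximates U f" by (auto simp: kernel_space_def)
  note U' = approximatesD[OF U]
  \<comment> \<open>Zero norm makes the approximating sequence null, and Cauchy-Schwarz against a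
    point mass then makes all point values tend to zero.\<close>
  have n0: "(\<lambda>n. ip_norm (kernel_form K) (U n)) \<longlonglongrightarrow> 0"
    using ip_norm_kernel_ip_tendsto[OF U] f by (simp add: ip_norm_def)
  show "f = (\<lambda>z. 0)"
  proof
    fix z
    have lim: "(\<lambda>n. kernel_comb X K (U n) z) \<longlonglongrightarrow> f z" by (rule U')
    show "f z = 0"
    proof (cases "z \<in> X")
      case True
      note pm = fin_support_point_mass[OF True]
      have "(\<lambda>n. kernel_comb X K (U n) z) \<longlonglongrightarrow> 0"
      proof (rule Lim_null_comparison)
        show "\<forall>\<^sub>F n in sequentially. norm (kernel_comb X K (U n) z) \<le>
            ip_norm (kernel_form K) (U n) * ip_norm (kernel_form K) (point_mass z)"
          using S.Cauchy_Schwarz_ip[OF U'(1) pm] by (simp add: kernel_form_point_mass[OF True])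
        show "(\<lambda>n. ip_norm (kernel_form K) (U n) * ip_norm (kernel_form K) (point_mass z)) \<longlonglongrightarrow> 0"
          using tendsto_mult_right[OF n0] by simp
      qed
      then show ?thesis using lim LIMSEQ_unique by blast
    next
      case False
      then have "(\<lambda>n::nat. 0) \<longlonglongrightarrow> f z" using lim by (simp add: kernel_comb_def zero_ext_def)
      then show ?thesis by (simp add: LIMSEQ_const_iff)
    qed
  qed
next
  fix F :: "nat \<Rightarrow> 'a \<Rightarrow> complex"
  assume F: "\<And>n. F n \<in> kernel_space"
    and "\<forall>\<epsilon>>0. \<exists>N. \<forall>j\<ge>N. \<forall>k\<ge>N. ip_norm kernel_ip (\<lambda>z. F j z - F k z) < \<epsilon>"
  then have cauchy: "M.Cauchy_ip F" by (simp add: M.Cauchy_ip_def)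
  \<comment> \<open>Each \<open>F n\<close> is replaced by a kernel combination at distance below
    \<open>1 / (n + 1)\<close>. The resulting coefficients are Cauchy for the Gram form, and the
    pointwise limit of their combinations is the limit sought.\<close>
  have "\<exists>u. u \<in> fin_support X \<and>
      ip_norm kernel_ip (\<lambda>z. F n z - kernel_comb X K u z) < 1 / real (Suc n)" for n
    using kernel_comb_dense[OF F, of "1 / real (Suc n)" n] by (metis of_nat_0_less_iff zero_less_Suc zero_less_divide_1_iff)
  then obtain U where U: "\<And>n. U n \<in> fin_support X"
      "\<And>n. ip_norm kernel_ip (\<lambda>z. F n z - kernel_comb X K (U n) z) < 1 / real (Suc n)" by metis
  define c where "c n = kernel_comb X K (U n)" for n
  have c: "c n \<in> kernel_space" for n unfolding c_def by (rule kernel_comb_mem_space[OF U(1)])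
  have Fc: "(\<lambda>n. ip_norm kernel_ip (\<lambda>z. F n z - c n z)) \<longlonglongrightarrow> 0"
  proof (rule tendsto_sandwich[OF _ _ tendsto_const LIMSEQ_Suc[OF lim_1_over_n]])
    show "\<forall>\<^sub>F n in sequentially. 0 \<le> ip_norm kernel_ip (\<lambda>z. F n z - c n z)"
      using M.ip_norm_nonneg[OF M.diff_mem[OF F c]] by simp
    show "\<forall>\<^sub>F n in sequentially. ip_norm kernel_ip (\<lambda>z. F n z - c n z) \<le> 1 / of_nat (Suc n)"
      unfolding c_def by (intro always_eventually allI less_imp_le U(2))
  qed
  have "S.Cauchy_ip U"
    unfolding S.Cauchy_ip_def
  proof (intro allI impI)
    fix e :: real assume e: "e > 0"
    obtain N where N: "\<And>j k. j \<ge> N \<Longrightarrow> k \<ge> N \<Longrightarrow> ip_norm kernel_ip (\<lambda>z. F j z - F k z) < e / 3"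
      using cauchy e unfolding M.Cauchy_ip_def by (meson divide_pos_pos zero_less_numeral)
    have "\<forall>\<^sub>F n in sequentially. ip_norm kernel_ip (\<lambda>z. F n z - c n z) < e / 3"
      using order_tendstoD(2)[OF Fc, of "e / 3"] e by simp
    then obtain M where M: "\<And>n. n \<ge> M \<Longrightarrow> ip_norm kernel_ip (\<lambda>z. F n z - c n z) < e / 3"
      by (auto simp: eventually_sequentially)
    have "ip_norm (kernel_form K) (\<lambda>z. U j z - U k z) < e" if "j \<ge> max N M" "k \<ge> max N M" for j k
    proof -
      have "(\<lambda>n::nat. ip_norm (kernel_form K) (\<lambda>z. U j z - U k z)) \<longlonglongrightarrow> ip_norm kernel_ip (\<lambda>z. c j z - c k z)"
        unfolding c_def by (intro ip_norm_kernel_ip_tendsto approximates_diff approximates_const U)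
      then have "ip_norm (kernel_form K) (\<lambda>z. U j z - U k z) = ip_norm kernel_ip (\<lambda>z. c j z - c k z)"
        by (simp add: LIMSEQ_const_iff)
      also have "\<dots> \<le> ip_norm kernel_ip (\<lambda>z. c j z - F j z) + ip_norm kernel_ip (\<lambda>z. F j z - c k z)"
        by (rule M.ip_norm_triangle_diff[OF c F c])
      also have "ip_norm kernel_ip (\<lambda>z. F j z - c k z) \<le>
          ip_norm kernel_ip (\<lambda>z. F j z - F k z) + ip_norm kernel_ip (\<lambda>z. F k z - c k z)"
        by (rule M.ip_norm_triangle_diff[OF F F c])
      also have "ip_norm kernel_ip (\<lambda>z. c j z - F j z) = ip_norm kernel_ip (\<lambda>z. F j z - c j z)"
        by (rule M.ip_norm_diff_commute[OF c F])
      finally show ?thesis using N[of j k] M[of j] M[of k] that by simp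
    qed
    then show "\<exists>N. \<forall>j\<ge>N. \<forall>k\<ge>N. ip_norm (kernel_form K) (\<lambda>z. U j z - U k z) < e" by blast
  qed
  note cU = this
  define f where "f z = lim (\<lambda>n. c n z)" for z
  have lim: "(\<lambda>n. c n z) \<longlonglongrightarrow> f z" for z
  proof (cases "z \<in> X")
    case True
    have "convergent (\<lambda>n. kernel_form K (U n) (point_mass z))"
      by (intro S.Cauchy_ip_convergent U fin_support_point_mass True cU S.Cauchy_ip_const)
    then show ?thesis
      by (simp add: kernel_form_point_mass[OF True] f_def c_def convergent_LIMSEQ_iff)
  next
    case False
    then have "c n z = 0" for n by (simp add: c_def kernel_comb_def zero_ext_def)
    then show ?thesis by (simp add: f_def)
  qed
  have Uf: "approximates U f" using U cU lim by (simp add: approximates_def c_def)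
  then have f: "f \<in> kernel_space" by (auto simp: kernel_space_def)
  have cf: "(\<lambda>n. ip_norm kernel_ip (\<lambda>z. c n z - f z)) \<longlonglongrightarrow> 0"
  proof (rule LIMSEQ_I)
    fix e :: real assume e: "e > 0"
    obtain N where N: "\<And>j k. j \<ge> N \<Longrightarrow> k \<ge> N \<Longrightarrow> ip_norm (kernel_form K) (\<lambda>z. U j z - U k z) < e / 2"
      using cU e unfolding S.Cauchy_ip_def by (meson half_gt_zero)
    have "ip_norm kernel_ip (\<lambda>z. c n z - f z) < e" if n: "n \<ge> N" for n
    proof -
      have l: "(\<lambda>k. ip_norm (kernel_form K) (\<lambda>z. U n z - U k z)) \<longlonglongrightarrow> ip_norm kernel_ip (\<lambda>z. c n z - f z)"
        unfolding c_def by (intro ip_norm_kernel_ip_tendsto approximates_diff approximates_const U Uf)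
      have "ip_norm kernel_ip (\<lambda>z. c n z - f z) \<le> e / 2"
        by (rule LIMSEQ_le_const2[OF l]) (use N[OF n] in \<open>auto intro!: exI[of _ N] less_imp_le\<close>)
      then show ?thesis using e by simp
    qed
    then show "\<exists>no. \<forall>n\<ge>no. norm (ip_norm kernel_ip (\<lambda>z. c n z - f z) - 0) < e"
      using M.ip_norm_nonneg[OF M.diff_mem[OF c f]] by auto
  qed
  have "(\<lambda>n. ip_norm kernel_ip (\<lambda>z. F n z - f z)) \<longlonglongrightarrow> 0"
  proof (rule tendsto_sandwich[OF _ _ tendsto_const])
    show "\<forall>\<^sub>F n in sequentially. 0 \<le> ip_norm kernel_ip (\<lambda>z. F n z - f z)"
      using M.ip_norm_nonneg[OF M.diff_mem[OF F f]] by simp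
    show "\<forall>\<^sub>F n in sequentially. ip_norm kernel_ip (\<lambda>z. F n z - f z) \<le>
        ip_norm kernel_ip (\<lambda>z. F n z - c n z) + ip_norm kernel_ip (\<lambda>z. c n z - f z)"
      using M.ip_norm_triangle_diff[OF F c f] by simp
    show "(\<lambda>n. ip_norm kernel_ip (\<lambda>z. F n z - c n z) + ip_norm kernel_ip (\<lambda>z. c n z - f z)) \<longlonglongrightarrow> 0"
      using tendsto_add[OF Fc cf] by simp
  qed
  then show "\<exists>f\<in>kernel_space. (\<lambda>n. ip_norm kernel_ip (\<lambda>z. F n z - f z)) \<longlonglongrightarrow> 0"
    using f by blast
qed (fact M.zero_mem M.add_mem M.scale_mem M.ip_add M.ip_scale M.ip_cnj M.ip_nonneg)+

end

lemma kernel_combs_zero: "(\<lambda>z. 0) \<in> kernel_comb X K ` fin_support X"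
  using imageI[OF fin_support_zero, of "kernel_comb X K" X] by (simp only: kernel_comb_zero)

lemma kernel_combs_add:
  assumes "f \<in> kernel_comb X K ` fin_support X" "g \<in> kernel_comb X K ` fin_support X"
  shows "(\<lambda>z. f z + g z) \<in> kernel_comb X K ` fin_support X"
proof -
  obtain u v where "u \<in> fin_support X" "v \<in> fin_support X"
    and fg: "f = kernel_comb X K u" "g = kernel_comb X K v"
    using assms by blast
  then show ?thesis
    using imageI[OF fin_support_add[of u X v], of "kernel_comb X K"] kernel_comb_add[of u X v K] by simp
qed

lemma kernel_combs_scale:
  assumes "f \<in> kernel_comb X K ` fin_support X"
  shows "(\<lambda>z. c * f z) \<in> kernel_comb X K ` fin_support X"
proof -
  obtain u where "u \<in> fin_support X" and f: "f = kernel_comb X K u" using assms by blast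
  then show ?thesis
    using imageI[OF fin_support_mult(2)[of u X "\<lambda>_. c"], of "kernel_comb X K"]
      kernel_comb_scale[of u X K c] by simp
qed

section \<open>Membership in a reproducing kernel Hilbert space\<close>

context reproducing_kernel_hilbert_space
begin

lemma kernel_comb_eq:
  assumes "u \<in> fin_support X"
  shows "kernel_comb X K u = (\<lambda>z. \<Sum>x | u x \<noteq> 0. u x * zero_ext X (\<lambda>z. K z x) z)"
  by (auto simp: kernel_comb_def zero_ext_def fun_eq_iff)

lemma kernel_comb_mem: "u \<in> fin_support X \<Longrightarrow> kernel_comb X K u \<in> H"
  unfolding kernel_comb_eq by (intro sum_mem scale_mem kernel_mem) (auto dest: fin_support_mem)

lemma ip_kernel_comb:
  assumes u: "u \<in> fin_support X" and f: "f \<in> H"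
  shows "ip (kernel_comb X K u) f = (\<Sum>x | u x \<noteq> 0. u x * cnj (f x))"
proof -
  have k: "zero_ext X (\<lambda>z. K z x) \<in> H" if "u x \<noteq> 0" for x
    using u that kernel_mem fin_support_mem by metis
  have "ip (kernel_comb X K u) f = (\<Sum>x | u x \<noteq> 0. ip (\<lambda>z. u x * zero_ext X (\<lambda>z. K z x) z) f)"
    unfolding kernel_comb_eq[OF u] using k f by (intro ip_sum scale_mem) auto
  also have "\<dots> = (\<Sum>x | u x \<noteq> 0. u x * cnj (f x))"
  proof (intro sum.cong refl)
    fix x assume x: "x \<in> {x. u x \<noteq> 0}"
    then have "ip (zero_ext X (\<lambda>z. K z x)) f = cnj (f x)"
      using ip_cnj[OF f k] reproducing[OF f] u fin_support_mem by fastforce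
    then show "ip (\<lambda>z. u x * zero_ext X (\<lambda>z. K z x) z) f = u x * cnj (f x)"
      using x k f by (simp add: ip_scale)
  qed
  finally show ?thesis .
qed

lemma ip_kernel_comb_comb:
  assumes "u \<in> fin_support X" "v \<in> fin_support X"
  shows "ip (kernel_comb X K u) (kernel_comb X K v) = kernel_form K u v"
proof -
  have "ip (kernel_comb X K u) (kernel_comb X K v) = cnj (ip (kernel_comb X K v) (kernel_comb X K u))"
    by (rule ip_cnj[OF kernel_comb_mem[OF assms(2)] kernel_comb_mem[OF assms(1)]])
  also have "\<dots> = (\<Sum>y | v y \<noteq> 0. cnj (v y) * kernel_comb X K u y)"
    by (simp add: ip_kernel_comb[OF assms(2) kernel_comb_mem[OF assms(1)]])
  also have "\<dots> = kernel_form K u v" by (rule kernel_form_eval[OF assms, symmetric])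
  finally show ?thesis .
qed

lemma ip_norm_kernel_comb:
  "u \<in> fin_support X \<Longrightarrow> ip_norm ip (kernel_comb X K u) = ip_norm (kernel_form K) u"
  by (simp add: ip_norm_def ip_kernel_comb_comb)

lemma pos_kernel: "pos_kernel X K"
  unfolding pos_kernel_def
proof (intro conjI ballI)
  fix x y assume x: "x \<in> X" and y: "y \<in> X"
  have "ip (zero_ext X (\<lambda>z. K z y)) (zero_ext X (\<lambda>z. K z x)) = K x y"
    using reproducing[OF kernel_mem[OF y] x] x by (simp add: zero_ext_def)
  moreover have "ip (zero_ext X (\<lambda>z. K z x)) (zero_ext X (\<lambda>z. K z y)) = K y x"
    using reproducing[OF kernel_mem[OF x] y] y by (simp add: zero_ext_def)
  ultimately show "K x y = cnj (K y x)"
    using ip_cnj[OF kernel_mem[OF x] kernel_mem[OF y]] by simp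
next
  fix u assume u: "u \<in> fin_support X"
  show "0 \<le> Re (kernel_form K u u)"
    using ip_nonneg[OF kernel_comb_mem[OF u]] by (simp add: ip_kernel_comb_comb[OF u u])
qed

lemma mem_dominated:
  assumes "f \<in> H"
  shows "dominated X K f (ip_norm ip f)"
  unfolding dominated_def
proof
  fix u assume u: "u \<in> fin_support X"
  show "cmod (\<Sum>x | u x \<noteq> 0. u x * cnj (f x)) \<le> ip_norm ip f * ip_norm (kernel_form K) u"
    using Cauchy_Schwarz_ip[OF kernel_comb_mem[OF u] assms]
    by (simp add: ip_kernel_comb[OF u assms] ip_norm_kernel_comb[OF u] mult.commute)
qed

text \<open>Converse of \<open>mem_dominated\<close>: domination means that the sum of
  \<open>u x * cnj (q x)\<close> is a bounded functional on the span of the kernel functions.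
  Testing its Riesz representer against the kernel function at \<open>w\<close> gives the value
  \<open>q w\<close>.\<close>

lemma dominated_mem:
  assumes dom: "dominated X K q C" and C: "C \<ge> 0"
  shows "zero_ext X q \<in> H" "ip_norm ip (zero_ext X q) \<le> C"
proof -
  define \<psi> where "\<psi> u = (\<Sum>x | u x \<noteq> 0. u x * cnj (q x))" for u
  have \<psi>_sup: "\<psi> u = (\<Sum>x\<in>A. u x * cnj (q x))" if "finite A" "{x. u x \<noteq> 0} \<subseteq> A" for u A
    unfolding \<psi>_def using that by (intro sum_support_superset) auto
  have \<psi>_add: "\<psi> (\<lambda>z. u z + v z) = \<psi> u + \<psi> v" if "u \<in> fin_support X" "v \<in> fin_support X" for u v
  proof -
    define A where "A = {z. u z \<noteq> 0} \<union> {z. v z \<noteq> 0}"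
    have A: "finite A" using that by (auto simp: A_def fin_support_def)
    have "\<psi> (\<lambda>z. u z + v z) = (\<Sum>x\<in>A. (u x + v x) * cnj (q x))"
      by (rule \<psi>_sup[OF A]) (auto simp: A_def)
    moreover have "\<psi> u = (\<Sum>x\<in>A. u x * cnj (q x))" by (rule \<psi>_sup[OF A]) (auto simp: A_def)
    moreover have "\<psi> v = (\<Sum>x\<in>A. v x * cnj (q x))" by (rule \<psi>_sup[OF A]) (auto simp: A_def)
    ultimately show ?thesis by (simp add: distrib_right sum.distrib)
  qed
  have \<psi>_scale: "\<psi> (\<lambda>z. c * u z) = c * \<psi> u" if "u \<in> fin_support X" for u c
  proof -
    have A: "finite {z. u z \<noteq> 0}" using that by (auto simp: fin_support_def)
    have "\<psi> (\<lambda>z. c * u z) = (\<Sum>x | u x \<noteq> 0. c * u x * cnj (q x))"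
      by (rule \<psi>_sup[OF A]) auto
    then show ?thesis by (simp add: \<psi>_def sum_distrib_left mult.assoc)
  qed
  have \<psi>_bound: "cmod (\<psi> u) \<le> C * ip_norm ip (kernel_comb X K u)" if "u \<in> fin_support X" for u
    using dom that unfolding dominated_def \<psi>_def by (simp add: ip_norm_kernel_comb)
  \<comment> \<open>Kernel functions may be linearly dependent, so a combination does not determine
    its coefficients; the domination bound makes the functional independent of them.\<close>
  have \<psi>_cong: "\<psi> u = \<psi> v"
    if "u \<in> fin_support X" "v \<in> fin_support X" "kernel_comb X K u = kernel_comb X K v" for u v
  proof -
    have m: "(\<lambda>z. (-1) * v z) \<in> fin_support X" by (rule fin_support_mult[OF that(2)])
    have "kernel_comb X K (\<lambda>z. u z + (-1) * v z) = (\<lambda>z. 0)"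
      unfolding kernel_comb_add[OF that(1) m] kernel_comb_scale[OF that(2)] using that(3) by simp
    then have "cmod (\<psi> (\<lambda>z. u z + (-1) * v z)) \<le> C * ip_norm ip (\<lambda>z. 0)"
      using \<psi>_bound[OF fin_support_add[OF that(1) m]] by simp
    then have "\<psi> (\<lambda>z. u z + (-1) * v z) = 0"
      using ip_zero[OF zero_mem] by (simp add: ip_norm_def)
    then show ?thesis unfolding \<psi>_add[OF that(1) m] \<psi>_scale[OF that(2)] by simp
  qed
  define S where "S = kernel_comb X K ` fin_support X"
  define coef where "coef f = (SOME u. u \<in> fin_support X \<and> kernel_comb X K u = f)" for f
  have coef: "coef f \<in> fin_support X" "kernel_comb X K (coef f) = f" if "f \<in> S" for f
    using that someI_ex[of "\<lambda>u. u \<in> fin_support X \<and> kernel_comb X K u = f"]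
    unfolding S_def coef_def by blast+
  have \<psi>_coef: "\<psi> (coef (kernel_comb X K u)) = \<psi> u" if "u \<in> fin_support X" for u
    using that by (intro \<psi>_cong coef) (auto simp: S_def)
  have "\<exists>g\<in>H. \<exists>F. (\<forall>n :: nat. F n \<in> S) \<and> (\<lambda>n. ip_norm ip (\<lambda>z. F n z - g z)) \<longlonglongrightarrow> 0 \<and>
    (\<forall>f\<in>S. ip f g = \<psi> (coef f)) \<and> ip_norm ip g \<le> C"
  proof (rule Riesz_on_subspace)
    show "S \<subseteq> H" unfolding S_def using kernel_comb_mem by blast
    show "(\<lambda>z. 0) \<in> S" unfolding S_def by (rule kernel_combs_zero)
    show "(\<lambda>z. f z + g z) \<in> S" if "f \<in> S" "g \<in> S" for f g
      using that unfolding S_def by (rule kernel_combs_add)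
    show "(\<lambda>z. c * f z) \<in> S" if "f \<in> S" for f c
      using that unfolding S_def by (rule kernel_combs_scale)
    show "\<psi> (coef (\<lambda>z. f z + g z)) = \<psi> (coef f) + \<psi> (coef g)" if fg: "f \<in> S" "g \<in> S" for f g
    proof -
      note c = coef(1)[OF fg(1)] coef(1)[OF fg(2)]
      have "kernel_comb X K (\<lambda>z. coef f z + coef g z) = (\<lambda>z. f z + g z)"
        unfolding kernel_comb_add[OF c] coef(2)[OF fg(1)] coef(2)[OF fg(2)] ..
      then show ?thesis using \<psi>_coef[OF fin_support_add[OF c]] \<psi>_add[OF c] by simp
    qed
    show "\<psi> (coef (\<lambda>z. c * f z)) = c * \<psi> (coef f)" if f: "f \<in> S" for f c
    proof -
      note c = coef(1)[OF f]
      have "kernel_comb X K (\<lambda>z. c * coef f z) = (\<lambda>z. c * f z)"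
        unfolding kernel_comb_scale[OF c] coef(2)[OF f] ..
      then show ?thesis using \<psi>_coef[OF fin_support_mult(2)[OF c, of "\<lambda>_. c"]] \<psi>_scale[OF c] by simp
    qed
    show "cmod (\<psi> (coef f)) \<le> C * ip_norm ip f" if "f \<in> S" for f
      using \<psi>_bound[OF coef(1)[OF that]] coef(2)[OF that] by simp
  qed (fact C)
  then obtain g where g: "g \<in> H" "\<And>f. f \<in> S \<Longrightarrow> ip f g = \<psi> (coef f)" "ip_norm ip g \<le> C" by blast
  have "g = zero_ext X q"
  proof
    fix w
    show "g w = zero_ext X q w"
    proof (cases "w \<in> X")
      case True
      note pm = fin_support_point_mass[OF True]
      have "ip (kernel_comb X K (point_mass w)) g = \<psi> (point_mass w)"
        using g(2)[of "kernel_comb X K (point_mass w)"] \<psi>_coef[OF pm] pm by (simp add: S_def)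
      then have "cnj (g w) = cnj (q w)"
        unfolding ip_kernel_comb[OF pm g(1)] \<psi>_def support_point_mass by (simp add: point_mass_def)
      then show ?thesis using True by (simp add: zero_ext_def)
    qed (use vanish_outside[OF g(1)] in \<open>simp add: zero_ext_def\<close>)
  qed
  then show "zero_ext X q \<in> H" "ip_norm ip (zero_ext X q) \<le> C" using g by auto
qed

text \<open>A function orthogonal to all kernel functions has only zero values.\<close>

lemma kernel_comb_dense_seq:
  assumes "f \<in> H"
  obtains U where "\<And>n :: nat. U n \<in> fin_support X"
    "(\<lambda>n. ip_norm ip (\<lambda>z. kernel_comb X K (U n) z - f z)) \<longlonglongrightarrow> 0"
proof -
  define S where "S = kernel_comb X K ` fin_support X"
  have S: "S \<subseteq> H" unfolding S_def using kernel_comb_mem by blast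
  have triv: "g = (\<lambda>z. 0)" if g: "g \<in> H" "\<And>v. v \<in> S \<Longrightarrow> ip v g = 0" for g
  proof
    fix w
    show "g w = 0"
    proof (cases "w \<in> X")
      case True
      note pm = fin_support_point_mass[OF True]
      have "ip (kernel_comb X K (point_mass w)) g = 0" using g(2) pm by (simp add: S_def)
      then show ?thesis
        unfolding ip_kernel_comb[OF pm g(1)] support_point_mass by (simp add: point_mass_def)
    qed (use vanish_outside[OF g(1)] in simp)
  qed
  obtain F where F: "\<And>n :: nat. F n \<in> S" "(\<lambda>n. ip_norm ip (\<lambda>z. F n z - f z)) \<longlonglongrightarrow> 0"
    by (rule dense_of_trivial_complement[OF S _ _ _ triv assms])
      (auto simp: S_def intro: kernel_combs_zero kernel_combs_add kernel_combs_scale)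
  then have "\<forall>n. \<exists>u. u \<in> fin_support X \<and> kernel_comb X K u = F n" by (auto simp: S_def image_iff) metis
  then obtain U where "\<forall>n. U n \<in> fin_support X \<and> kernel_comb X K (U n) = F n" by metis
  then show ?thesis using that[of U] F by simp
qed

end

section \<open>Products of positive kernels\<close>

lemma pos_kernelI:
  assumes "\<And>x y. x \<in> X \<Longrightarrow> y \<in> X \<Longrightarrow> K x y = cnj (K y x)"
    and "\<And>u. u \<in> fin_support X \<Longrightarrow> 0 \<le> Re (kernel_form K u u)"
  shows "pos_kernel X K"
  using assms unfolding pos_kernel_def by blast

lemma pos_kernel_cnj: "pos_kernel X K \<Longrightarrow> x \<in> X \<Longrightarrow> y \<in> X \<Longrightarrow> K x y = cnj (K y x)"
  unfolding pos_kernel_def by blast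

lemma kernel_form_kernel_add:
  "kernel_form (\<lambda>x y. K x y + L x y) u v = kernel_form K u v + kernel_form L u v"
  by (simp add: kernel_form_def distrib_left sum.distrib)

lemma kernel_form_kernel_scale: "kernel_form (\<lambda>x y. c * K x y) u v = c * kernel_form K u v"
  by (simp add: kernel_form_def sum_distrib_left mult.left_commute)

lemma kernel_form_rank_one:
  "kernel_form (\<lambda>x y. q x * cnj (q y)) u u = of_real ((cmod (\<Sum>x | u x \<noteq> 0. u x * cnj (q x)))\<^sup>2)"
proof -
  have "kernel_form (\<lambda>x y. q x * cnj (q y)) u u =
      (\<Sum>x | u x \<noteq> 0. \<Sum>y | u y \<noteq> 0. (u x * cnj (q x)) * cnj (u y * cnj (q y)))"
    unfolding kernel_form_def by (intro sum.cong refl) (simp add: mult_ac)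
  also have "\<dots> = (\<Sum>x | u x \<noteq> 0. u x * cnj (q x)) * cnj (\<Sum>x | u x \<noteq> 0. u x * cnj (q x))"
    by (simp add: sum_product)
  finally show ?thesis by (simp only: complex_norm_square)
qed

lemma Re_kernel_form_minus_rank_one:
  "Re (kernel_form (\<lambda>x y. of_real c * K x y + of_real (-1) * (q x * cnj (q y))) u u) =
    c * Re (kernel_form K u u) - (cmod (\<Sum>x | u x \<noteq> 0. u x * cnj (q x)))\<^sup>2"
proof -
  have "kernel_form (\<lambda>x y. of_real c * K x y + of_real (-1) * (q x * cnj (q y))) u u =
      of_real c * kernel_form K u u +
      of_real (-1) * of_real ((cmod (\<Sum>x | u x \<noteq> 0. u x * cnj (q x)))\<^sup>2)"
    by (simp only: kernel_form_kernel_add kernel_form_kernel_scale[of "of_real c"]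
        kernel_form_kernel_scale[of "of_real (-1)"] kernel_form_rank_one)
  also have "\<dots> = of_real c * kernel_form K u u +
      of_real (- ((cmod (\<Sum>x | u x \<noteq> 0. u x * cnj (q x)))\<^sup>2))" by simp
  finally show ?thesis by (simp only: plus_complex.sel Re_complex_of_real) simp
qed

lemma pos_kernel_add:
  assumes "pos_kernel X K" "pos_kernel X L"
  shows "pos_kernel X (\<lambda>x y. K x y + L x y)"
proof (rule pos_kernelI)
  fix x y assume xy: "x \<in> X" "y \<in> X"
  show "K x y + L x y = cnj (K y x + L y x)"
    unfolding pos_kernel_cnj[OF assms(1) xy] pos_kernel_cnj[OF assms(2) xy] by simp
qed (use assms in \<open>auto simp: kernel_form_kernel_add pos_kernel_def\<close>)

lemma pos_kernel_rank_one: "pos_kernel X (\<lambda>x y. q x * cnj (q y))"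
proof (rule pos_kernelI)
  show "0 \<le> Re (kernel_form (\<lambda>x y. q x * cnj (q y)) u u)" for u
    unfolding kernel_form_rank_one Re_complex_of_real by simp
qed simp

lemma pos_kernel_scale:
  assumes "pos_kernel X K" "c \<ge> 0"
  shows "pos_kernel X (\<lambda>x y. of_real c * K x y)"
proof (rule pos_kernelI)
  fix x y assume xy: "x \<in> X" "y \<in> X"
  show "of_real c * K x y = cnj (of_real c * K y x)" unfolding pos_kernel_cnj[OF assms(1) xy] by simp
qed (use assms in \<open>auto simp: kernel_form_kernel_scale pos_kernel_def\<close>)

text \<open>Cholesky factorisation, by splitting off one rank-one summand for each point.\<close>

lemma pos_kernel_factorization:
  fixes K :: "'a \<Rightarrow> 'a \<Rightarrow> complex"
  assumes "finite A" "pos_kernel A K"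
  shows "\<exists>n v. \<forall>x\<in>A. \<forall>y\<in>A. K x y = (\<Sum>i<n::nat. v i x * cnj (v i y))"
  using assms
proof (induction A arbitrary: K)
  case (insert a A)
  let ?A = "insert a A"
  interpret S: semi_inner_product "fin_support ?A" "kernel_form K"
    by (rule semi_inner_product_kernel_form[OF insert.prems])
  define r where "r = Re (K a a)"
  have pa: "point_mass a \<in> fin_support ?A" by (rule fin_support_point_mass) simp
  have aa: "kernel_form K (point_mass a) (point_mass a) = K a a"
    unfolding kernel_form_def support_point_mass by (simp add: point_mass_def)
  have Kaa: "K a a = of_real r" using S.ip_self[OF pa] by (simp add: aa r_def)
  have r0: "r \<ge> 0" using S.ip_nonneg[OF pa] by (simp add: aa r_def)
  have row: "kernel_form K u (point_mass a) = (\<Sum>x | u x \<noteq> 0. u x * K a x)" for u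
    unfolding kernel_form_def support_point_mass by (simp add: point_mass_def)
  have cs: "(cmod (\<Sum>x | u x \<noteq> 0. u x * K a x))\<^sup>2 \<le> Re (kernel_form K u u) * r" if "u \<in> fin_support ?A" for u
  proof -
    have "(cmod (kernel_form K u (point_mass a)))\<^sup>2 \<le> (ip_norm (kernel_form K) u * ip_norm (kernel_form K) (point_mass a))\<^sup>2"
      by (intro power_mono S.Cauchy_Schwarz_ip that pa) simp
    also have "\<dots> = Re (kernel_form K u u) * r"
      by (simp add: power_mult_distrib S.ip_norm_sq that pa aa r_def)
    finally show ?thesis by (simp add: row)
  qed
  \<comment> \<open>For \<open>r = 0\<close> the division yields \<open>q = 0\<close>. This is the
    right choice, since \<open>cs\<close> then makes the whole row of \<open>a\<close>
    vanish.\<close>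
  define q where "q x = K x a / of_real (sqrt r)" for x
  define K' where "K' x y = K x y + of_real (-1) * (q x * cnj (q y))" for x y
  have herm: "K x y = cnj (K y x)" if "x \<in> ?A" "y \<in> ?A" for x y
    using pos_kernel_cnj[OF insert.prems that] .
  have "pos_kernel ?A K'"
  proof (rule pos_kernelI)
    fix x y assume xy: "x \<in> ?A" "y \<in> ?A"
    show "K' x y = cnj (K' y x)" unfolding K'_def herm[OF xy] by simp
  next
    fix u assume u: "u \<in> fin_support ?A"
    have s: "(\<Sum>x | u x \<noteq> 0. u x * cnj (q x)) = (\<Sum>x | u x \<noteq> 0. u x * K a x) / of_real (sqrt r)"
      unfolding sum_divide_distrib
    proof (intro sum.cong refl)
      fix x assume "x \<in> {x. u x \<noteq> 0}"
      then have "x \<in> ?A" using u fin_support_mem by fastforce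
      then have "cnj (K x a) = K a x" using herm[of a x] by simp
      then show "u x * cnj (q x) = u x * K a x / of_real (sqrt r)" by (simp add: q_def)
    qed
    have "Re (kernel_form K' u u) = Re (kernel_form K u u) - (cmod (\<Sum>x | u x \<noteq> 0. u x * cnj (q x)))\<^sup>2"
      using Re_kernel_form_minus_rank_one[of 1 K q u] by (simp add: K'_def[abs_def])
    moreover have "(cmod (\<Sum>x | u x \<noteq> 0. u x * cnj (q x)))\<^sup>2 = (cmod (\<Sum>x | u x \<noteq> 0. u x * K a x))\<^sup>2 / r"
      using r0 by (simp add: s norm_divide power_divide)
    moreover have "\<dots> \<le> Re (kernel_form K u u)"
      using cs[OF u] S.ip_nonneg[OF u] r0 by (cases "r = 0") (auto simp: field_simps)
    ultimately show "0 \<le> Re (kernel_form K' u u)" by simp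
  qed
  moreover have "fin_support A \<subseteq> fin_support ?A" by (auto simp: fin_support_def)
  ultimately have "pos_kernel A K'" unfolding pos_kernel_def by blast
  then obtain n v where v: "\<And>x y. x \<in> A \<Longrightarrow> y \<in> A \<Longrightarrow> K' x y = (\<Sum>i<n::nat. v i x * cnj (v i y))"
    using insert.IH by blast
  \<comment> \<open>Subtracting the rank-one part clears row and column \<open>a\<close>, so the old
    vectors are continued by zero at \<open>a\<close> and \<open>q\<close> is appended as the last
    one.\<close>
  define v' where "v' i x = (if i = n then q x else if x = a then 0 else v i x)" for i x
  have qa: "q x * cnj (q a) = K x a" if x: "x \<in> ?A" for x
  proof (cases "r = 0")
    case True
    have "(cmod (K a x))\<^sup>2 \<le> 0"
      using cs[OF fin_support_point_mass[OF x]] True unfolding support_point_mass by (simp add: point_mass_def)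
    then have "K x a = 0" using herm[OF x, of a] by simp
    then show ?thesis by (simp add: q_def)
  next
    case False
    have "of_real (sqrt r) * of_real (sqrt r) = (of_real r :: complex)"
      using r0 by (simp flip: of_real_mult)
    then show ?thesis using False r0 by (simp add: q_def Kaa)
  qed
  have "K x y = (\<Sum>i<Suc n. v' i x * cnj (v' i y))" if xy: "x \<in> ?A" "y \<in> ?A" for x y
  proof -
    have split: "(\<Sum>i<Suc n. v' i x * cnj (v' i y)) =
        (\<Sum>i<n. v' i x * cnj (v' i y)) + q x * cnj (q y)"
      by (simp add: v'_def)
    consider "x = a" | "y = a" | "x \<noteq> a" "y \<noteq> a" by blast
    then show ?thesis
    proof cases
      case 1
      have "cnj (q a) * q y = K y a" using qa[OF xy(2)] by (simp add: mult.commute)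
      then have "q a * cnj (q y) = cnj (K y a)" by (metis complex_cnj_cnj complex_cnj_mult)
      moreover have "(\<Sum>i<n. v' i x * cnj (v' i y)) = 0" using 1 by (auto simp: v'_def)
      ultimately show ?thesis using herm[OF xy] 1 split by simp
    next
      case 2
      moreover have "(\<Sum>i<n. v' i x * cnj (v' i y)) = 0" using 2 by (auto simp: v'_def)
      ultimately show ?thesis using qa[OF xy(1)] split by simp
    next
      case 3
      have "(\<Sum>i<n. v' i x * cnj (v' i y)) = (\<Sum>i<n. v i x * cnj (v i y))"
        using 3 by (intro sum.cong refl) (auto simp: v'_def)
      then show ?thesis using v[of x y] xy 3 split by (simp add: K'_def diff_eq_eq)
    qed
  qed
  then show ?case by blast
qed simp

text \<open>The Schur product theorem. On the finite support of \<open>u\<close> the kernel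
  \<open>K\<close> is a sum of rank-one kernels of vectors \<open>v i\<close>, and each of these
  merely multiplies \<open>u\<close> by \<open>cnj (v i)\<close> inside the form of
  \<open>L\<close>.\<close>

lemma pos_kernel_mult:
  assumes "pos_kernel X K" "pos_kernel X L"
  shows "pos_kernel X (\<lambda>x y. K x y * L x y)"
proof (rule pos_kernelI)
  fix x y assume xy: "x \<in> X" "y \<in> X"
  show "K x y * L x y = cnj (K y x * L y x)"
    unfolding pos_kernel_cnj[OF assms(1) xy] pos_kernel_cnj[OF assms(2) xy] by simp
next
  fix u assume u: "u \<in> fin_support X"
  define A where "A = {x. u x \<noteq> 0}"
  have A: "finite A" "A \<subseteq> X" using u by (auto simp: A_def fin_support_def)
  have "fin_support A \<subseteq> fin_support X" using A by (auto simp: fin_support_def)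
  then have "pos_kernel A K" using assms(1) A(2) unfolding pos_kernel_def by blast
  then obtain n v where v: "\<And>x y. x \<in> A \<Longrightarrow> y \<in> A \<Longrightarrow> K x y = (\<Sum>i<n::nat. v i x * cnj (v i y))"
    using pos_kernel_factorization[OF A(1)] by blast
  have "kernel_form (\<lambda>x y. K x y * L x y) u u =
      (\<Sum>x\<in>A. \<Sum>y\<in>A. \<Sum>i<n. (u x * cnj (v i x)) * cnj (u y * cnj (v i y)) * L y x)"
    unfolding kernel_form_def A_def[symmetric]
    by (intro sum.cong refl) (simp add: v sum_distrib_left sum_distrib_right mult_ac)
  also have "\<dots> = (\<Sum>x\<in>A. \<Sum>i<n. \<Sum>y\<in>A. (u x * cnj (v i x)) * cnj (u y * cnj (v i y)) * L y x)"
    by (intro sum.cong refl sum.swap)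
  also have "\<dots> = (\<Sum>i<n. \<Sum>x\<in>A. \<Sum>y\<in>A. (u x * cnj (v i x)) * cnj (u y * cnj (v i y)) * L y x)"
    by (rule sum.swap)
  also have "\<dots> = (\<Sum>i<n. kernel_form L (\<lambda>x. u x * cnj (v i x)) (\<lambda>x. u x * cnj (v i x)))"
    by (intro sum.cong refl kernel_form_superset[OF A(1) _ A(1), symmetric]) (auto simp: A_def)
  finally have eq: "Re (kernel_form (\<lambda>x y. K x y * L x y) u u) =
      (\<Sum>i<n. Re (kernel_form L (\<lambda>x. u x * cnj (v i x)) (\<lambda>x. u x * cnj (v i x))))" by simp
  show "0 \<le> Re (kernel_form (\<lambda>x y. K x y * L x y) u u)"
    unfolding eq
  proof (rule sum_nonneg)
    fix i
    show "0 \<le> Re (kernel_form L (\<lambda>x. u x * cnj (v i x)) (\<lambda>x. u x * cnj (v i x)))"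
      using assms(2) fin_support_mult(1)[OF u, of "\<lambda>x. cnj (v i x)"] unfolding pos_kernel_def by blast
  qed
qed

text \<open>Expanding the form of the kernel on the right turns its positivity into the square of
  the domination bound. In this shape membership is open to the Schur product theorem.\<close>

lemma dominated_iff_pos_kernel:
  assumes K: "pos_kernel X K" and C: "C \<ge> 0"
  shows "dominated X K q C \<longleftrightarrow>
    pos_kernel X (\<lambda>x y. of_real (C\<^sup>2) * K x y + of_real (-1) * (q x * cnj (q y)))" (is "_ \<longleftrightarrow> pos_kernel X ?L")
proof -
  have form: "Re (kernel_form ?L u u) =
      (C * ip_norm (kernel_form K) u)\<^sup>2 - (cmod (\<Sum>x | u x \<noteq> 0. u x * cnj (q x)))\<^sup>2"
    if "u \<in> fin_support X" for u
    using that K unfolding Re_kernel_form_minus_rank_one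
    by (simp add: ip_norm_def power_mult_distrib pos_kernel_def)
  have herm: "?L x y = cnj (?L y x)" if "x \<in> X" "y \<in> X" for x y
    unfolding pos_kernel_cnj[OF K that] by simp
  have nn: "0 \<le> C * ip_norm (kernel_form K) u" if "u \<in> fin_support X" for u
    using that K C by (simp add: ip_norm_def pos_kernel_def)
  show ?thesis
  proof
    assume d: "dominated X K q C"
    show "pos_kernel X ?L"
    proof (rule pos_kernelI[OF herm])
      fix u assume u: "u \<in> fin_support X"
      show "0 \<le> Re (kernel_form ?L u u)"
        unfolding form[OF u] using d u by (simp add: dominated_def power_mono)
    qed
  next
    assume p: "pos_kernel X ?L"
    show "dominated X K q C"
      unfolding dominated_def
    proof
      fix u assume u: "u \<in> fin_support X"
      have "(cmod (\<Sum>x | u x \<noteq> 0. u x * cnj (q x)))\<^sup>2 \<le> (C * ip_norm (kernel_form K) u)\<^sup>2"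
        using p u form[OF u] unfolding pos_kernel_def by fastforce
      then show "cmod (\<Sum>x | u x \<noteq> 0. u x * cnj (q x)) \<le> C * ip_norm (kernel_form K) u"
        using nn[OF u] by (rule power2_le_imp_le)
    qed
  qed
qed

text \<open>With \<open>?P\<close> and \<open>?Q\<close> the positive kernels that express the two
  assumptions, the kernel for the product is \<open>?P\<close> times \<open>D^2 L\<close> plus the
  rank-one kernel of \<open>p\<close> times \<open>?Q\<close>.\<close>

lemma dominated_mult:
  assumes "pos_kernel X K" "pos_kernel X L" "C \<ge> 0" "D \<ge> 0" "dominated X K p C" "dominated X L q D"
  shows "dominated X (\<lambda>x y. K x y * L x y) (\<lambda>x. p x * q x) (C * D)"
proof -
  let ?P = "\<lambda>x y. of_real (C\<^sup>2) * K x y + of_real (-1) * (p x * cnj (p y))"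
  let ?Q = "\<lambda>x y. of_real (D\<^sup>2) * L x y + of_real (-1) * (q x * cnj (q y))"
  have "pos_kernel X ?P" "pos_kernel X ?Q"
    by (fact iffD1[OF dominated_iff_pos_kernel[OF assms(1,3)] assms(5)]
        iffD1[OF dominated_iff_pos_kernel[OF assms(2,4)] assms(6)])+
  then have "pos_kernel X (\<lambda>x y. ?P x y * (of_real (D\<^sup>2) * L x y) + (p x * cnj (p y)) * ?Q x y)"
    by (intro pos_kernel_add[OF pos_kernel_mult[OF _ pos_kernel_scale[OF assms(2)]]
          pos_kernel_mult[OF pos_kernel_rank_one]] zero_le_power2)
  also have "(\<lambda>x y. ?P x y * (of_real (D\<^sup>2) * L x y) + (p x * cnj (p y)) * ?Q x y) =
    (\<lambda>x y. of_real ((C * D)\<^sup>2) * (K x y * L x y) + of_real (-1) * ((p x * q x) * cnj (p y * q y)))"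
    by (simp add: fun_eq_iff algebra_simps power_mult_distrib)
  finally show ?thesis
    by (rule iffD2[OF dominated_iff_pos_kernel[OF pos_kernel_mult[OF assms(1,2)] mult_nonneg_nonneg[OF assms(3,4)]]])
qed

lemma dominated_add:
  assumes "dominated X K p C" "dominated X K q D"
  shows "dominated X K (\<lambda>x. p x + q x) (C + D)"
  unfolding dominated_def
proof
  fix u assume u: "u \<in> fin_support X"
  have "(\<Sum>x | u x \<noteq> 0. u x * cnj (p x + q x)) =
      (\<Sum>x | u x \<noteq> 0. u x * cnj (p x)) + (\<Sum>x | u x \<noteq> 0. u x * cnj (q x))"
    by (simp add: distrib_left sum.distrib)
  then have "cmod (\<Sum>x | u x \<noteq> 0. u x * cnj (p x + q x)) \<le>
      cmod (\<Sum>x | u x \<noteq> 0. u x * cnj (p x)) + cmod (\<Sum>x | u x \<noteq> 0. u x * cnj (q x))"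
    by (simp only: norm_triangle_ineq)
  then show "cmod (\<Sum>x | u x \<noteq> 0. u x * cnj (p x + q x)) \<le> (C + D) * ip_norm (kernel_form K) u"
    using bspec[OF assms(1)[unfolded dominated_def] u] bspec[OF assms(2)[unfolded dominated_def] u]
    by (simp add: distrib_right)
qed

lemma dominated_cong:
  "\<lbrakk>dominated X K p C; \<And>x. x \<in> X \<Longrightarrow> p x = q x\<rbrakk> \<Longrightarrow> dominated X K q C"
  unfolding dominated_def
proof
  fix u assume u: "u \<in> fin_support X" and pq: "\<And>x. x \<in> X \<Longrightarrow> p x = q x"
    and d: "\<forall>u\<in>fin_support X. cmod (\<Sum>x | u x \<noteq> 0. u x * cnj (p x)) \<le> C * ip_norm (kernel_form K) u"
  have "(\<Sum>x | u x \<noteq> 0. u x * cnj (q x)) = (\<Sum>x | u x \<noteq> 0. u x * cnj (p x))"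
    using fin_support_mem[OF u] pq by (intro sum.cong refl) auto
  then show "cmod (\<Sum>x | u x \<noteq> 0. u x * cnj (q x)) \<le> C * ip_norm (kernel_form K) u"
    using d u by simp
qed

lemma dominated_mono:
  assumes K: "pos_kernel X K" and d: "dominated X K q C" and le: "C \<le> D"
  shows "dominated X K q D"
  unfolding dominated_def
proof
  fix u assume u: "u \<in> fin_support X"
  interpret semi_inner_product "fin_support X" "kernel_form K" by (rule semi_inner_product_kernel_form[OF K])
  have "cmod (\<Sum>x | u x \<noteq> 0. u x * cnj (q x)) \<le> C * ip_norm (kernel_form K) u"
    using d u by (simp add: dominated_def)
  also have "\<dots> \<le> D * ip_norm (kernel_form K) u" by (rule mult_right_mono[OF le ip_norm_nonneg[OF u]])
  finally show "cmod (\<Sum>x | u x \<noteq> 0. u x * cnj (q x)) \<le> D * ip_norm (kernel_form K) u" .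
qed

lemma dominated_scale:
  assumes "dominated X K p C"
  shows "dominated X K (\<lambda>z. c * p z) (cmod c * C)"
  unfolding dominated_def
proof
  fix u assume u: "u \<in> fin_support X"
  have "(\<Sum>x | u x \<noteq> 0. u x * cnj (c * p x)) = cnj c * (\<Sum>x | u x \<noteq> 0. u x * cnj (p x))"
    by (simp add: sum_distrib_left mult_ac)
  then show "cmod (\<Sum>x | u x \<noteq> 0. u x * cnj (c * p x)) \<le> cmod c * C * ip_norm (kernel_form K) u"
    using assms u unfolding dominated_def by (simp add: norm_mult mult.assoc mult_left_mono)
qed

section \<open>A rotation invariant probability measure on the ball\<close>

definition monomial :: "('d::finite \<Rightarrow> nat) \<Rightarrow> complex^'d \<Rightarrow> complex" where
  "monomial \<alpha> z = (\<Prod>i\<in>UNIV. (z $ i) ^ \<alpha> i)"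

definition total_degree :: "('d::finite \<Rightarrow> nat) \<Rightarrow> nat" where
  "total_degree \<alpha> = (\<Sum>i\<in>UNIV. \<alpha> i)"

section \<open>Gamma and uniform angular laws and their integrals\<close>

definition gamma_measure :: "real \<Rightarrow> real measure" where
  "gamma_measure s = density lborel (\<lambda>x. ennreal (indicator {0..} x * x powr (s - 1) * exp (- x) / Gamma s))"

definition circle_measure :: "real measure" where
  "circle_measure = density lborel (\<lambda>x. ennreal (indicator {0..2*pi} x / (2 * pi)))"

text \<open>Euler's integral after the substitution of \<open>c * x\<close>. Read from right to left
  it writes a negative power of \<open>c\<close> as an integral of exponentials, which is how the
  Beta integral and the monomial moments are computed.\<close>

lemma nn_integral_gamma_kernel:
  fixes a c :: real
  assumes "a > 0" "c > 0"
  shows "(\<integral>\<^sup>+x. ennreal (indicator {0..} x * x powr (a - 1) * exp (- (c * x))) \<partial>lborel) = ennreal (Gamma a / c powr a)"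
proof -
  have "ennreal (Gamma a) = (\<integral>\<^sup>+x. ennreal (indicator {0..} x * x powr (a - 1) / exp x) \<partial>lborel)"
    by (rule Gamma_conv_nn_integral_real[OF assms(1)])
  also have "\<dots> = \<bar>c\<bar> * (\<integral>\<^sup>+x. ennreal (indicator {0..} (0 + c * x) * (0 + c * x) powr (a - 1) / exp (0 + c * x)) \<partial>lborel)"
    using assms by (intro nn_integral_real_affine) auto
  also have "\<dots> = (\<integral>\<^sup>+x. ennreal c * ennreal (indicator {0..} (0 + c * x) * (0 + c * x) powr (a - 1) / exp (0 + c * x)) \<partial>lborel)"
    using assms by (subst nn_integral_cmult) auto
  also have "\<dots> = (\<integral>\<^sup>+x. ennreal (c powr a) * ennreal (indicator {0..} x * x powr (a - 1) * exp (- (c * x))) \<partial>lborel)"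
  proof (intro nn_integral_cong)
    fix x :: real
    have "c * (indicator {0..} (0 + c * x) * (0 + c * x) powr (a - 1) / exp (0 + c * x)) =
        c powr a * (indicator {0..} x * x powr (a - 1) * exp (- (c * x)))"
    proof (cases "x \<ge> 0")
      case True
      have "c * c powr (a - 1) = c powr a" using assms by (simp add: powr_diff)
      then show ?thesis using True assms by (simp add: powr_mult exp_minus field_simps)
    next
      case False
      then have "\<not> 0 \<le> c * x" using assms by (simp add: mult_le_0_iff not_le mult_pos_neg)
      then show ?thesis using False by simp
    qed
    then show "ennreal c * ennreal (indicator {0..} (0 + c * x) * (0 + c * x) powr (a - 1) / exp (0 + c * x)) =
        ennreal (c powr a) * ennreal (indicator {0..} x * x powr (a - 1) * exp (- (c * x)))"
      using assms by (simp flip: ennreal_mult')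
  qed
  also have "\<dots> = ennreal (c powr a) * (\<integral>\<^sup>+x. ennreal (indicator {0..} x * x powr (a - 1) * exp (- (c * x))) \<partial>lborel)"
    by (subst nn_integral_cmult) auto
  finally have eq: "ennreal (Gamma a) = ennreal (c powr a) * (\<integral>\<^sup>+x. ennreal (indicator {0..} x * x powr (a - 1) * exp (- (c * x))) \<partial>lborel)" .
  have "ennreal (Gamma a / c powr a) = ennreal (1 / c powr a) * ennreal (Gamma a)"
    using assms by (simp flip: ennreal_mult'' add: Gamma_real_pos less_imp_le)
  also have "\<dots> = (ennreal (1 / c powr a) * ennreal (c powr a)) * (\<integral>\<^sup>+x. ennreal (indicator {0..} x * x powr (a - 1) * exp (- (c * x))) \<partial>lborel)"
    unfolding eq by (simp only: mult.assoc)
  also have "ennreal (1 / c powr a) * ennreal (c powr a) = 1"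
    using assms by (simp flip: ennreal_mult'')
  finally show ?thesis by simp
qed

lemma sets_gamma_measure [measurable_cong, simp]: "sets (gamma_measure s) = sets borel"
  by (simp add: gamma_measure_def)

lemma sets_circle_measure [measurable_cong, simp]: "sets circle_measure = sets borel"
  by (simp add: circle_measure_def)

lemma space_gamma_measure [simp]: "space (gamma_measure s) = UNIV"
  by (simp add: gamma_measure_def)

lemma space_circle_measure [simp]: "space circle_measure = UNIV"
  by (simp add: circle_measure_def)

text \<open>The exponential factor changes the rate of the Gamma density to \<open>1 + t\<close>. It
  is carried because moments on the ball are obtained from Laplace transforms, which factor over
  independent coordinates.\<close>

lemma nn_integral_gamma_measure_power_exp:
  fixes s t :: real
  assumes s: "s > 0" and t: "t \<ge> 0"
  shows "(\<integral>\<^sup>+x. ennreal (x ^ k * exp (- (t * x))) \<partial>gamma_measure s) =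
    ennreal (Gamma (s + real k) / Gamma s / (1 + t) powr (s + real k))"
proof -
  have G: "Gamma s > 0" using s by (rule Gamma_real_pos)
  have "(\<integral>\<^sup>+x. ennreal (x ^ k * exp (- (t * x))) \<partial>gamma_measure s) =
      (\<integral>\<^sup>+x. ennreal (indicator {0..} x * x powr (s - 1) * exp (- x) / Gamma s) * ennreal (x ^ k * exp (- (t * x))) \<partial>lborel)"
    unfolding gamma_measure_def by (subst nn_integral_density) auto
  also have "\<dots> = (\<integral>\<^sup>+x. ennreal (1 / Gamma s) * ennreal (indicator {0..} x * x powr (s + real k - 1) * exp (- ((1 + t) * x))) \<partial>lborel)"
  proof (intro nn_integral_cong_AE eventually_mono[OF AE_lborel_singleton[of 0]])
    fix x :: real assume x: "x \<noteq> 0"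
    show "ennreal (indicator {0..} x * x powr (s - 1) * exp (- x) / Gamma s) * ennreal (x ^ k * exp (- (t * x))) =
      ennreal (1 / Gamma s) * ennreal (indicator {0..} x * x powr (s + real k - 1) * exp (- ((1 + t) * x)))"
    proof (cases "x > 0")
      case True
      have "x powr (s - 1) * x ^ k = x powr (s + real k - 1)"
        using True by (simp add: powr_realpow[symmetric] powr_add[symmetric] algebra_simps)
      moreover have "exp (- x) * exp (- (t * x)) = exp (- ((1 + t) * x))"
        by (simp add: mult_exp_exp algebra_simps)
      moreover have "x powr (s - 1) * exp (- x) / Gamma s * (x ^ k * exp (- (t * x))) =
          1 / Gamma s * ((x powr (s - 1) * x ^ k) * (exp (- x) * exp (- (t * x))))" by simp
      ultimately have "x powr (s - 1) * exp (- x) / Gamma s * (x ^ k * exp (- (t * x))) =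
          1 / Gamma s * (x powr (s + real k - 1) * exp (- ((1 + t) * x)))" by (simp only:)
      then show ?thesis using True G by (simp flip: ennreal_mult')
    qed (use x in simp)
  qed
  also have "\<dots> = ennreal (1 / Gamma s) * (\<integral>\<^sup>+x. ennreal (indicator {0..} x * x powr (s + real k - 1) * exp (- ((1 + t) * x))) \<partial>lborel)"
    by (subst nn_integral_cmult) auto
  also have "\<dots> = ennreal (1 / Gamma s) * ennreal (Gamma (s + real k) / (1 + t) powr (s + real k))"
    using s t by (subst nn_integral_gamma_kernel) auto
  also have "\<dots> = ennreal (Gamma (s + real k) / Gamma s / (1 + t) powr (s + real k))"
    using G by (simp flip: ennreal_mult')
  finally show ?thesis .
qed

lemma prob_space_gamma_measure:
  assumes "s > 0"
  shows "prob_space (gamma_measure s)"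
proof
  have "emeasure (gamma_measure s) (space (gamma_measure s)) = (\<integral>\<^sup>+x. ennreal (x ^ 0 * exp (- (0 * x))) \<partial>gamma_measure s)"
    by simp
  also have "\<dots> = 1"
    unfolding nn_integral_gamma_measure_power_exp[OF assms order_refl] using Gamma_real_pos[OF assms] by simp
  finally show "emeasure (gamma_measure s) (space (gamma_measure s)) = 1" .
qed

lemma AE_gamma_measure_pos:
  "AE x in gamma_measure s. x > 0"
  unfolding gamma_measure_def
  by (subst AE_density) (auto intro!: eventually_mono[OF AE_lborel_singleton[of 0]] split: split_indicator simp: indicator_def)

lemma prob_space_circle_measure: "prob_space circle_measure"
proof
  have "emeasure circle_measure (space circle_measure) =
      (\<integral>\<^sup>+x. ennreal (1 / (2 * pi)) * indicator {0..2*pi} x \<partial>lborel)"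
    unfolding circle_measure_def
    by (subst emeasure_density) (auto intro!: nn_integral_cong split: split_indicator)
  also have "\<dots> = ennreal (1 / (2 * pi)) * ennreal (2 * pi)"
    by (subst nn_integral_cmult_indicator) auto
  also have "\<dots> = 1" by (simp flip: ennreal_mult'')
  finally show "emeasure circle_measure (space circle_measure) = 1" .
qed

lemma integral_circle_measure_cis:
  fixes k :: int
  assumes "k \<noteq> 0"
  shows "(\<integral>x. cis (of_int k * x) \<partial>circle_measure) = 0"
proof -
  define F where "F x = cis (of_int k * x) / (\<i> * of_int k)" for x :: real
  have [measurable]: "(\<lambda>x. cis (real_of_int k * x)) \<in> borel_measurable borel"
    by (intro borel_measurable_continuous_onI continuous_intros)
  have D: "(F has_vector_derivative cis (of_int k * x)) (at x within {0..2*pi})" for x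
  proof -
    have "((\<lambda>x. exp (\<i> * of_int k * of_real x) / (\<i> * of_int k)) has_vector_derivative
        exp (\<i> * of_int k * of_real x)) (at x within {0..2*pi})"
      using assms by (auto intro!: derivative_eq_intros has_vector_derivative_real_field)
    then show ?thesis by (simp add: F_def[abs_def] cis_conv_exp mult_ac)
  qed
  have "has_bochner_integral lborel (\<lambda>x. indicator {0..2*pi} x *\<^sub>R cis (of_int k * x)) (F (2 * pi) - F 0)"
    by (rule has_bochner_integral_FTC_Icc[OF _ D]) (auto intro!: continuous_intros)
  moreover have "F (2 * pi) = F 0"
    unfolding F_def using cis_multiple_2pi[of "of_int k"] by (simp add: mult.commute)
  ultimately have "(\<integral>x. indicator {0..2*pi} x *\<^sub>R cis (of_int k * x) \<partial>lborel) = 0"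
    by (simp add: has_bochner_integral_integral_eq)
  moreover have "(\<integral>x. cis (of_int k * x) \<partial>circle_measure) =
      (\<integral>x. (indicator {0..2*pi} x / (2 * pi)) *\<^sub>R cis (of_int k * x) \<partial>lborel)"
    unfolding circle_measure_def by (subst integral_density) auto
  moreover have "\<dots> = (1 / (2 * pi)) *\<^sub>R (\<integral>x. indicator {0..2*pi} x *\<^sub>R cis (of_int k * x) \<partial>lborel)"
    by (subst integral_scaleR_right[symmetric]) (simp_all add: scaleR_scaleR)
  ultimately show ?thesis by simp
qed

text \<open>The Beta integral over the half line: the negative power of \<open>1 + t\<close> is
  itself a Gamma integral in \<open>v\<close>, and after the exchange of integrals both are Gamma
  integrals.\<close>

lemma nn_integral_beta_kernel:
  fixes a c :: real
  assumes a: "a > 0" and c: "c > 0"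
  shows "(\<integral>\<^sup>+t. ennreal (indicator {0..} t * t powr (a - 1) / (1 + t) powr (a + c)) \<partial>lborel) =
    ennreal (Gamma a * Gamma c / Gamma (a + c))"
proof -
  let ?g = "\<lambda>t v. indicator {0..} t * t powr (a - 1) * (indicator {0..} v * v powr (a + c - 1) * exp (- ((1 + t) * v)))"
  have G: "Gamma (a + c) > 0" "Gamma a > 0" "Gamma c > 0" using a c by (auto intro!: Gamma_real_pos)
  have "ennreal (Gamma (a + c)) * (\<integral>\<^sup>+t. ennreal (indicator {0..} t * t powr (a - 1) / (1 + t) powr (a + c)) \<partial>lborel)
      = (\<integral>\<^sup>+t. ennreal (indicator {0..} t * t powr (a - 1)) * ennreal (Gamma (a + c) / (1 + t) powr (a + c)) \<partial>lborel)"
    using G by (subst nn_integral_cmult[symmetric])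
      (auto intro!: nn_integral_cong simp flip: ennreal_mult' ennreal_mult'' split: split_indicator)
  also have "\<dots> = (\<integral>\<^sup>+t. \<integral>\<^sup>+v. ennreal (?g t v) \<partial>lborel \<partial>lborel)"
  proof (intro nn_integral_cong)
    fix t :: real
    show "ennreal (indicator {0..} t * t powr (a - 1)) * ennreal (Gamma (a + c) / (1 + t) powr (a + c)) =
        (\<integral>\<^sup>+v. ennreal (?g t v) \<partial>lborel)"
    proof (cases "t \<ge> 0")
      case True
      then have "ennreal (Gamma (a + c) / (1 + t) powr (a + c)) =
          (\<integral>\<^sup>+v. ennreal (indicator {0..} v * v powr (a + c - 1) * exp (- ((1 + t) * v))) \<partial>lborel)"
        using a c by (subst nn_integral_gamma_kernel) auto
      then show ?thesis by (subst ennreal_mult') (auto simp: nn_integral_cmult)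
    qed simp
  qed
  also have "\<dots> = (\<integral>\<^sup>+v. \<integral>\<^sup>+t. ennreal (?g t v) \<partial>lborel \<partial>lborel)"
    by (rule lborel_pair.Fubini') measurable
  also have "\<dots> = (\<integral>\<^sup>+v. ennreal (Gamma a) * ennreal (indicator {0..} v * v powr (c - 1) * exp (- (1 * v))) \<partial>lborel)"
  proof (intro nn_integral_cong_AE eventually_mono[OF AE_lborel_singleton[of 0]])
    fix v :: real assume v: "v \<noteq> 0"
    show "(\<integral>\<^sup>+t. ennreal (?g t v) \<partial>lborel) = ennreal (Gamma a) * ennreal (indicator {0..} v * v powr (c - 1) * exp (- (1 * v)))"
    proof (cases "v > 0")
      case True
      have "(\<integral>\<^sup>+t. ennreal (?g t v) \<partial>lborel) =
          (\<integral>\<^sup>+t. ennreal (v powr (a + c - 1) * exp (- v)) * ennreal (indicator {0..} t * t powr (a - 1) * exp (- (v * t))) \<partial>lborel)"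
      proof (intro nn_integral_cong)
        fix t :: real
        have "exp (- ((1 + t) * v)) = exp (- v) * exp (- (v * t))" by (simp add: mult_exp_exp algebra_simps)
        then show "ennreal (?g t v) = ennreal (v powr (a + c - 1) * exp (- v)) * ennreal (indicator {0..} t * t powr (a - 1) * exp (- (v * t)))"
          using True by (simp add: mult_ac flip: ennreal_mult')
      qed
      also have "\<dots> = ennreal (v powr (a + c - 1) * exp (- v)) * ennreal (Gamma a / v powr a)"
        using a True by (subst nn_integral_cmult) (auto simp: nn_integral_gamma_kernel)
      also have "\<dots> = ennreal (v powr (a + c - 1) * exp (- v) * (Gamma a / v powr a))"
        by (simp flip: ennreal_mult')
      also have "v powr (a + c - 1) * exp (- v) * (Gamma a / v powr a) = Gamma a * (v powr (c - 1) * exp (- v))"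
      proof -
        have "v powr (a + c - 1) / v powr a = v powr (c - 1)" by (simp add: powr_diff[symmetric] algebra_simps)
        moreover have "v powr (a + c - 1) * exp (- v) * (Gamma a / v powr a) =
            Gamma a * ((v powr (a + c - 1) / v powr a) * exp (- v))" by simp
        ultimately show ?thesis by (simp only:)
      qed
      finally show ?thesis using True G by (simp flip: ennreal_mult')
    qed (use v in simp)
  qed
  also have "\<dots> = ennreal (Gamma a) * ennreal (Gamma c / 1 powr c)"
    using c by (subst nn_integral_cmult) (auto simp: nn_integral_gamma_kernel[OF c zero_less_one, simplified])
  finally have eq: "ennreal (Gamma (a + c)) * (\<integral>\<^sup>+t. ennreal (indicator {0..} t * t powr (a - 1) / (1 + t) powr (a + c)) \<partial>lborel)
      = ennreal (Gamma a * Gamma c)"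
    using G by (simp flip: ennreal_mult')
  have "ennreal (Gamma a * Gamma c / Gamma (a + c)) = ennreal (1 / Gamma (a + c)) * ennreal (Gamma a * Gamma c)"
    using G by (simp flip: ennreal_mult')
  also have "\<dots> = (ennreal (1 / Gamma (a + c)) * ennreal (Gamma (a + c))) * (\<integral>\<^sup>+t. ennreal (indicator {0..} t * t powr (a - 1) / (1 + t) powr (a + c)) \<partial>lborel)"
    unfolding eq[symmetric] by (simp only: mult.assoc)
  also have "ennreal (1 / Gamma (a + c)) * ennreal (Gamma (a + c)) = 1"
    using G by (simp flip: ennreal_mult'')
  finally show ?thesis by simp
qed

section \<open>The law on the ball and its support\<close>

definition radii_measure :: "real \<Rightarrow> (('d::finite \<Rightarrow> real) \<times> real) measure" where
  "radii_measure s = Pi\<^sub>M UNIV (\<lambda>_. gamma_measure 1) \<Otimes>\<^sub>M gamma_measure s"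

definition angles_measure :: "('d::finite \<Rightarrow> real) measure" where
  "angles_measure = Pi\<^sub>M UNIV (\<lambda>_. circle_measure)"

definition radii_sum :: "('d::finite \<Rightarrow> real) \<times> real \<Rightarrow> real" where
  "radii_sum p = (\<Sum>i\<in>UNIV. fst p i) + snd p"

text \<open>For independent exponential variables \<open>e\<^sub>i\<close> and a Gamma variable \<open>g\<close> of shape \<open>s\<close>, the
  normalised vector has the law with density proportional to \<open>(1 - \<parallel>z\<parallel>\<^sup>2)\<close> to the power
  \<open>s - 1\<close> on the ball.\<close>

definition ball_point :: "(('d::finite \<Rightarrow> real) \<times> real) \<times> ('d \<Rightarrow> real) \<Rightarrow> complex^'d" where
  "ball_point \<omega> = (\<chi> i. of_real (sqrt (fst (fst \<omega>) i / radii_sum (fst \<omega>))) * cis (snd \<omega> i))"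

definition ball_measure :: "real \<Rightarrow> (complex^'d) measure" where
  "ball_measure s = distr (radii_measure s \<Otimes>\<^sub>M angles_measure) borel ball_point"

lemma prob_space_angles_measure: "prob_space angles_measure"
  unfolding angles_measure_def by (intro prob_space_PiM prob_space_circle_measure)

lemma prob_space_radii_measure: "s > 0 \<Longrightarrow> prob_space (radii_measure s)"
  unfolding radii_measure_def
  by (intro prob_space_pair prob_space_PiM prob_space_gamma_measure) auto

lemma measurable_radii [measurable]:
  "(\<lambda>p. fst p i) \<in> borel_measurable (radii_measure s)"
  "snd \<in> borel_measurable (radii_measure s)"
  "radii_sum \<in> borel_measurable (radii_measure s)"
  unfolding radii_measure_def radii_sum_def[abs_def] by measurable

lemma measurable_angle [measurable]: "(\<lambda>\<theta>. cis (of_int k * \<theta> i)) \<in> borel_measurable angles_measure"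
proof -
  have [measurable]: "(\<lambda>x. cis (of_int k * x)) \<in> borel_measurable borel"
    by (intro borel_measurable_continuous_onI continuous_intros)
  show ?thesis unfolding angles_measure_def by measurable
qed

lemma borel_measurable_vec:
  fixes f :: "'a \<Rightarrow> complex^'d"
  assumes "\<And>i. (\<lambda>x. f x $ i) \<in> borel_measurable M"
  shows "f \<in> borel_measurable M"
proof (subst borel_measurable_euclidean_space, intro ballI)
  fix b :: "complex^'d" assume "b \<in> Basis"
  then obtain i c where "b = axis i c" by (auto simp: Basis_vec_def)
  then have "(\<lambda>x. f x \<bullet> b) = (\<lambda>x. f x $ i \<bullet> c)" by (simp add: inner_axis)
  then show "(\<lambda>x. f x \<bullet> b) \<in> borel_measurable M" using assms by simp
qed

lemma measurable_ball_point [measurable]: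
  "ball_point \<in> radii_measure s \<Otimes>\<^sub>M angles_measure \<rightarrow>\<^sub>M borel"
proof (rule borel_measurable_vec)
  fix i
  have [measurable]: "(\<lambda>\<theta>. cis (\<theta> i)) \<in> borel_measurable angles_measure"
    using measurable_angle[of 1 i] by simp
  show "(\<lambda>x. ball_point x $ i) \<in> borel_measurable (radii_measure s \<Otimes>\<^sub>M angles_measure)"
    unfolding ball_point_def vec_lambda_beta by measurable
qed

lemma prob_space_ball_measure: "s > 0 \<Longrightarrow> prob_space (ball_measure s)"
  unfolding ball_measure_def
  by (intro prob_space.prob_space_distr prob_space_pair prob_space_radii_measure
      prob_space_angles_measure measurable_ball_point)

lemma sets_ball_measure [measurable_cong, simp]: "sets (ball_measure s) = sets borel"
  by (simp add: ball_measure_def)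

lemma space_ball_measure [simp]: "space (ball_measure s) = UNIV"
  by (simp add: ball_measure_def)

lemma AE_radii_pos:
  assumes s: "s > 0"
  shows "AE p in (radii_measure s :: (('d::finite \<Rightarrow> real) \<times> real) measure). (\<forall>i. fst p i > 0) \<and> snd p > 0"
proof -
  interpret A: prob_space "Pi\<^sub>M (UNIV :: 'd set) (\<lambda>_. gamma_measure 1)"
    by (intro prob_space_PiM prob_space_gamma_measure) simp
  interpret B: prob_space "gamma_measure s" by (rule prob_space_gamma_measure[OF s])
  interpret pair_sigma_finite "Pi\<^sub>M (UNIV :: 'd set) (\<lambda>_. gamma_measure 1)" "gamma_measure s" ..
  have "AE e in Pi\<^sub>M (UNIV :: 'd set) (\<lambda>_. gamma_measure 1). \<forall>i\<in>UNIV. e i > 0"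
    by (rule AE_finite_allI) (auto intro!: AE_PiM_component prob_space_gamma_measure AE_gamma_measure_pos)
  then have "AE e in Pi\<^sub>M (UNIV :: 'd set) (\<lambda>_. gamma_measure 1). AE g in gamma_measure s.
      (\<forall>i. fst (e, g) i > 0) \<and> snd (e, g) > 0"
    using AE_gamma_measure_pos[of s] by (auto elim!: eventually_mono)
  then show ?thesis
    unfolding radii_measure_def by (intro AE_pair_measure) measurable
qed

lemma radii_sum_pos:
  assumes "\<And>i. fst p i > 0" "snd p > 0"
  shows "radii_sum p > 0"
  unfolding radii_sum_def
  by (rule add_nonneg_pos[OF sum_nonneg assms(2)]) (simp add: assms(1) less_imp_le)

lemma norm_ball_point:
  assumes "\<And>i. fst p i > 0" "snd p > 0"
  shows "(norm (ball_point (p, \<theta>)))\<^sup>2 = (\<Sum>i\<in>UNIV. fst p i) / radii_sum p"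
    and "norm (ball_point (p, \<theta>)) < 1"
proof -
  have pos: "radii_sum p > 0" "(\<Sum>i\<in>UNIV. fst p i) \<ge> 0"
    using radii_sum_pos[OF assms] by (auto intro!: sum_nonneg simp: less_imp_le assms(1))
  have "(norm (ball_point (p, \<theta>)))\<^sup>2 = (\<Sum>i\<in>UNIV. (norm (ball_point (p, \<theta>) $ i))\<^sup>2)"
    by (simp add: norm_vec_def L2_set_def sum_nonneg)
  also have "\<dots> = (\<Sum>i\<in>UNIV. fst p i / radii_sum p)"
    using assms(1) pos by (intro sum.cong refl) (simp add: ball_point_def norm_mult less_imp_le)
  finally show 1: "(norm (ball_point (p, \<theta>)))\<^sup>2 = (\<Sum>i\<in>UNIV. fst p i) / radii_sum p"
    by (simp add: sum_divide_distrib)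
  have "(\<Sum>i\<in>UNIV. fst p i) / radii_sum p < 1"
    using pos assms(2) by (simp add: radii_sum_def)
  then have "(norm (ball_point (p, \<theta>)))\<^sup>2 < 1\<^sup>2" using 1 by simp
  then show "norm (ball_point (p, \<theta>)) < 1" by (rule power2_less_imp_less) simp
qed

lemma AE_radii_angles_pos:
  assumes s: "s > 0"
  shows "AE \<omega> in radii_measure s \<Otimes>\<^sub>M angles_measure. (\<forall>i. fst (fst \<omega>) i > 0) \<and> snd (fst \<omega>) > 0"
proof -
  interpret A: prob_space "radii_measure s" by (rule prob_space_radii_measure[OF s])
  interpret B: prob_space angles_measure by (rule prob_space_angles_measure)
  interpret pair_sigma_finite "radii_measure s" angles_measure ..
  have "AE p in radii_measure s. AE \<theta> in angles_measure.
      (\<forall>i. fst (fst (p, \<theta>)) i > 0) \<and> snd (fst (p, \<theta>)) > 0"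
    using AE_radii_pos[OF s] by (auto elim!: eventually_mono)
  then show ?thesis by (intro AE_pair_measure) measurable
qed

lemma AE_ball_measure:
  assumes s: "s > 0"
  shows "AE z in ball_measure s. norm z < 1"
  unfolding ball_measure_def
proof (subst AE_distr_iff)
  show "AE \<omega> in radii_measure s \<Otimes>\<^sub>M angles_measure. norm (ball_point \<omega>) < 1"
    using AE_radii_angles_pos[OF s]
  proof eventually_elim
    case (elim \<omega>)
    then show ?case using norm_ball_point(2)[of "fst \<omega>" "snd \<omega>"] by simp
  qed
qed (use measurable_ball_point in auto)

section \<open>Moments and orthogonality of monomials\<close>

lemma nn_integral_radii_exp:
  fixes \<alpha> :: "'d::finite \<Rightarrow> nat"
  assumes s: "s > 0" and t: "t \<ge> 0"
  shows "(\<integral>\<^sup>+p. (\<Prod>i\<in>UNIV. ennreal (fst p i ^ \<alpha> i * exp (- (t * fst p i)))) * ennreal (exp (- (t * snd p))) \<partial>radii_measure s)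
    = ennreal ((\<Prod>i\<in>UNIV. fact (\<alpha> i)) / (1 + t) powr (real (total_degree \<alpha>) + (real CARD('d) + s)))"
proof -
  interpret E: product_prob_space "\<lambda>_::'d. gamma_measure 1" UNIV
    by (intro product_prob_spaceI prob_space_gamma_measure) simp
  interpret B: prob_space "gamma_measure s" by (rule prob_space_gamma_measure[OF s])
  have "(\<integral>\<^sup>+p. (\<Prod>i\<in>UNIV. ennreal (fst p i ^ \<alpha> i * exp (- (t * fst p i)))) * ennreal (exp (- (t * snd p))) \<partial>radii_measure s)
    = (\<integral>\<^sup>+e. \<integral>\<^sup>+g. (\<Prod>i\<in>UNIV. ennreal (e i ^ \<alpha> i * exp (- (t * e i)))) * ennreal (exp (- (t * g))) \<partial>gamma_measure s \<partial>Pi\<^sub>M UNIV (\<lambda>_. gamma_measure 1))"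
    unfolding radii_measure_def by (subst B.nn_integral_fst[symmetric]) simp_all
  also have "\<dots> = (\<integral>\<^sup>+e. (\<Prod>i\<in>UNIV. ennreal (e i ^ \<alpha> i * exp (- (t * e i)))) * ennreal (1 / (1 + t) powr s) \<partial>Pi\<^sub>M UNIV (\<lambda>_. gamma_measure 1))"
    using nn_integral_gamma_measure_power_exp[OF s t, of 0] Gamma_real_pos[OF s]
    by (intro nn_integral_cong) (subst nn_integral_cmult, auto)
  also have "\<dots> = (\<integral>\<^sup>+e. (\<Prod>i\<in>UNIV. ennreal (e i ^ \<alpha> i * exp (- (t * e i)))) \<partial>Pi\<^sub>M UNIV (\<lambda>_. gamma_measure 1)) * ennreal (1 / (1 + t) powr s)"
    by (rule nn_integral_multc) measurable
  also have "(\<integral>\<^sup>+e. (\<Prod>i\<in>UNIV. ennreal (e i ^ \<alpha> i * exp (- (t * e i)))) \<partial>Pi\<^sub>M UNIV (\<lambda>_. gamma_measure 1)) =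
      (\<Prod>i\<in>UNIV. \<integral>\<^sup>+x. ennreal (x ^ \<alpha> i * exp (- (t * x))) \<partial>gamma_measure 1)"
    by (rule E.product_nn_integral_prod[of UNIV "\<lambda>i x. ennreal (x ^ \<alpha> i * exp (- (t * x)))"]) simp_all
  also have "\<dots> = (\<Prod>i\<in>UNIV. ennreal (fact (\<alpha> i) / (1 + t) powr (1 + real (\<alpha> i))))"
    by (intro prod.cong refl) (simp add: nn_integral_gamma_measure_power_exp[OF zero_less_one t] Gamma_fact[symmetric] add.commute)
  also have "\<dots> = ennreal (\<Prod>i\<in>UNIV. fact (\<alpha> i) / (1 + t) powr (1 + real (\<alpha> i)))"
    by (rule prod_ennreal) simp
  also have "\<dots> * ennreal (1 / (1 + t) powr s) =
      ennreal ((\<Prod>i\<in>UNIV. fact (\<alpha> i) / (1 + t) powr (1 + real (\<alpha> i))) * (1 / (1 + t) powr s))"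
    by (rule ennreal_mult'[symmetric]) (simp add: prod_nonneg)
  also have "(\<Prod>i\<in>UNIV. fact (\<alpha> i) / (1 + t) powr (1 + real (\<alpha> i))) =
      (\<Prod>i\<in>UNIV. fact (\<alpha> i)) / (1 + t) powr (\<Sum>i\<in>UNIV. 1 + real (\<alpha> i))"
    using t by (simp add: prod_dividef powr_sum)
  also have "\<dots> * (1 / (1 + t) powr s) = (\<Prod>i\<in>UNIV. fact (\<alpha> i)) / (1 + t) powr (real (total_degree \<alpha>) + (real CARD('d) + s))"
    by (simp add: sum.distrib total_degree_def powr_add[symmetric] add_ac)
  finally show ?thesis .
qed

text \<open>The denominator is removed by writing the power \<open>- n\<close> of
  \<open>radii_sum p\<close> as a Gamma integral over \<open>t\<close>. The exponential then splits
  over the independent coordinates, and a Beta integral in \<open>t\<close> is left. Degree zero is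
  separate because the Gamma integral needs a positive exponent.\<close>

lemma nn_integral_radii_moment:
  fixes \<alpha> :: "'d::finite \<Rightarrow> nat"
  assumes s: "s > 0"
  shows "(\<integral>\<^sup>+p. ennreal ((\<Prod>i\<in>UNIV. fst p i ^ \<alpha> i) / radii_sum p ^ total_degree \<alpha>) \<partial>radii_measure s)
    = ennreal ((\<Prod>i\<in>UNIV. fact (\<alpha> i)) / pochhammer (real CARD('d) + s) (total_degree \<alpha>))"
proof (cases "total_degree \<alpha> = 0")
  case True
  interpret A: prob_space "radii_measure s :: (('d \<Rightarrow> real) \<times> real) measure" by (rule prob_space_radii_measure[OF s])
  have "\<alpha> i = 0" for i using True by (simp add: total_degree_def)
  then show ?thesis using True A.emeasure_space_1 by simp
next
  case False
  define n where "n = real (total_degree \<alpha>)"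
  define \<gamma> where "\<gamma> = real CARD('d) + s"
  have n: "n > 0" using False by (simp add: n_def)
  have \<gamma>: "\<gamma> > 0" using s by (simp add: \<gamma>_def add_nonneg_pos)
  have G: "Gamma n > 0" "Gamma \<gamma> > 0" "Gamma (n + \<gamma>) > 0" using n \<gamma> by (auto intro!: Gamma_real_pos)
  define f where "f = (\<Prod>i\<in>UNIV. fact (\<alpha> i) :: real)"
  have f: "f \<ge> 0" by (simp add: f_def prod_nonneg)
  interpret A: prob_space "radii_measure s :: (('d \<Rightarrow> real) \<times> real) measure" by (rule prob_space_radii_measure[OF s])
  interpret AL: pair_sigma_finite "radii_measure s :: (('d \<Rightarrow> real) \<times> real) measure" lborel ..
  let ?h = "\<lambda>p t. ennreal (indicator {0..} t * t powr (n - 1)) *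
    ((\<Prod>i\<in>UNIV. ennreal (fst p i ^ \<alpha> i * exp (- (t * fst p i)))) * ennreal (exp (- (t * snd p))))"
  have "ennreal (Gamma n) * (\<integral>\<^sup>+p. ennreal ((\<Prod>i\<in>UNIV. fst p i ^ \<alpha> i) / radii_sum p ^ total_degree \<alpha>) \<partial>radii_measure s)
      = (\<integral>\<^sup>+p. ennreal (Gamma n) * ennreal ((\<Prod>i\<in>UNIV. fst p i ^ \<alpha> i) / radii_sum p ^ total_degree \<alpha>) \<partial>(radii_measure s :: (('d \<Rightarrow> real) \<times> real) measure))"
    by (rule nn_integral_cmult[symmetric]) measurable
  also have "\<dots> = (\<integral>\<^sup>+p. \<integral>\<^sup>+t. ?h p t \<partial>lborel \<partial>(radii_measure s :: (('d \<Rightarrow> real) \<times> real) measure))"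
  proof (rule nn_integral_cong_AE, use AE_radii_pos[OF s] in eventually_elim)
    fix p :: "('d \<Rightarrow> real) \<times> real"
    assume p: "(\<forall>i. 0 < fst p i) \<and> 0 < snd p"
    have \<rho>: "radii_sum p > 0"
      using p by (intro radii_sum_pos) auto
    have h: "?h p t = ennreal (\<Prod>i\<in>UNIV. fst p i ^ \<alpha> i) * ennreal (indicator {0..} t * t powr (n - 1) * exp (- (radii_sum p * t)))" for t
    proof -
      have "(\<Prod>i\<in>UNIV. exp (- (t * fst p i))) * exp (- (t * snd p)) = exp (- (radii_sum p * t))"
        by (simp add: exp_sum[symmetric] mult_exp_exp radii_sum_def sum_negf sum_distrib_left algebra_simps)
      then have "(\<Prod>i\<in>UNIV. fst p i ^ \<alpha> i * exp (- (t * fst p i))) * exp (- (t * snd p)) =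
          (\<Prod>i\<in>UNIV. fst p i ^ \<alpha> i) * exp (- (radii_sum p * t))"
        by (simp add: prod.distrib mult.assoc)
      moreover have "(\<Prod>i\<in>UNIV. ennreal (fst p i ^ \<alpha> i * exp (- (t * fst p i)))) =
          ennreal (\<Prod>i\<in>UNIV. fst p i ^ \<alpha> i * exp (- (t * fst p i)))"
        using p by (intro prod_ennreal) (simp add: less_imp_le)
      ultimately have "(\<Prod>i\<in>UNIV. ennreal (fst p i ^ \<alpha> i * exp (- (t * fst p i)))) * ennreal (exp (- (t * snd p)))
          = ennreal ((\<Prod>i\<in>UNIV. fst p i ^ \<alpha> i) * exp (- (radii_sum p * t)))"
        by (simp flip: ennreal_mult'')
      moreover have "(\<Prod>i\<in>UNIV. fst p i ^ \<alpha> i) \<ge> 0" using p by (simp add: prod_nonneg less_imp_le)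
      ultimately show ?thesis by (simp add: mult_ac flip: ennreal_mult' ennreal_mult'')
    qed
    have "(\<integral>\<^sup>+t. ?h p t \<partial>lborel) = ennreal (\<Prod>i\<in>UNIV. fst p i ^ \<alpha> i) * ennreal (Gamma n / radii_sum p powr n)"
      unfolding h using n \<rho> by (subst nn_integral_cmult) (auto simp: nn_integral_gamma_kernel)
    also have "\<dots> = ennreal (Gamma n) * ennreal ((\<Prod>i\<in>UNIV. fst p i ^ \<alpha> i) / radii_sum p ^ total_degree \<alpha>)"
      using \<rho> G p by (simp add: n_def powr_realpow prod_nonneg less_imp_le mult.commute flip: ennreal_mult' ennreal_mult'')
    finally show "ennreal (Gamma n) * ennreal ((\<Prod>i\<in>UNIV. fst p i ^ \<alpha> i) / radii_sum p ^ total_degree \<alpha>) = (\<integral>\<^sup>+t. ?h p t \<partial>lborel)" ..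
  qed
  also have "\<dots> = (\<integral>\<^sup>+t. \<integral>\<^sup>+p. ?h p t \<partial>(radii_measure s :: (('d \<Rightarrow> real) \<times> real) measure) \<partial>lborel)"
    by (rule AL.Fubini'[symmetric]) measurable
  also have "\<dots> = (\<integral>\<^sup>+t. ennreal f * ennreal (indicator {0..} t * t powr (n - 1) / (1 + t) powr (n + \<gamma>)) \<partial>lborel)"
  proof (intro nn_integral_cong)
    fix t :: real
    show "(\<integral>\<^sup>+p. ?h p t \<partial>(radii_measure s :: (('d \<Rightarrow> real) \<times> real) measure)) =
        ennreal f * ennreal (indicator {0..} t * t powr (n - 1) / (1 + t) powr (n + \<gamma>))"
    proof (cases "t \<ge> 0")
      case True
      then have "(\<integral>\<^sup>+p. ?h p t \<partial>(radii_measure s :: (('d \<Rightarrow> real) \<times> real) measure)) =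
          ennreal (t powr (n - 1)) * ennreal (f / (1 + t) powr (n + \<gamma>))"
        by (subst nn_integral_cmult) (auto simp: nn_integral_radii_exp[OF s] n_def \<gamma>_def f_def)
      then show ?thesis using True f by (simp add: mult.commute flip: ennreal_mult' ennreal_mult'')
    qed simp
  qed
  also have "\<dots> = ennreal f * ennreal (Gamma n * Gamma \<gamma> / Gamma (n + \<gamma>))"
    by (subst nn_integral_cmult) (auto simp: nn_integral_beta_kernel[OF n \<gamma>])
  finally have eq: "ennreal (Gamma n) * (\<integral>\<^sup>+p. ennreal ((\<Prod>i\<in>UNIV. fst p i ^ \<alpha> i) / radii_sum p ^ total_degree \<alpha>) \<partial>radii_measure s)
      = ennreal (f * (Gamma n * Gamma \<gamma> / Gamma (n + \<gamma>)))"
    using f by (simp flip: ennreal_mult')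
  have "pochhammer \<gamma> (total_degree \<alpha>) = Gamma (n + \<gamma>) / Gamma \<gamma>"
    using \<gamma> by (subst pochhammer_Gamma) (auto simp: n_def add.commute nonpos_Ints_def)
  then have "ennreal (f / pochhammer \<gamma> (total_degree \<alpha>)) = ennreal (1 / Gamma n) * ennreal (f * (Gamma n * Gamma \<gamma> / Gamma (n + \<gamma>)))"
    using G by (simp flip: ennreal_mult')
  also have "\<dots> = (ennreal (1 / Gamma n) * ennreal (Gamma n)) *
      (\<integral>\<^sup>+p. ennreal ((\<Prod>i\<in>UNIV. fst p i ^ \<alpha> i) / radii_sum p ^ total_degree \<alpha>) \<partial>radii_measure s)"
    unfolding eq[symmetric] by (simp only: mult.assoc)
  also have "ennreal (1 / Gamma n) * ennreal (Gamma n) = 1"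
    using G by (simp flip: ennreal_mult'')
  finally show ?thesis by (simp add: f_def \<gamma>_def)
qed

lemma norm_monomial_ball_point:
  assumes "\<And>i. fst p i > 0" "snd p > 0"
  shows "(cmod (monomial \<alpha> (ball_point (p, \<theta>))))\<^sup>2 = (\<Prod>i\<in>UNIV. fst p i ^ \<alpha> i) / radii_sum p ^ total_degree \<alpha>"
proof -
  have pos: "radii_sum p > 0"
    by (rule radii_sum_pos[OF assms])
  have "(cmod (monomial \<alpha> (ball_point (p, \<theta>))))\<^sup>2 = (\<Prod>i\<in>UNIV. ((cmod (ball_point (p, \<theta>) $ i))\<^sup>2) ^ \<alpha> i)"
    by (simp add: monomial_def prod_norm[symmetric] norm_power prod_power_distrib mult.commute flip: power_mult)
  also have "\<dots> = (\<Prod>i\<in>UNIV. (fst p i / radii_sum p) ^ \<alpha> i)"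
    using assms(1) pos by (intro prod.cong refl) (simp add: ball_point_def norm_mult less_imp_le)
  also have "\<dots> = (\<Prod>i\<in>UNIV. fst p i ^ \<alpha> i) / (\<Prod>i\<in>UNIV. radii_sum p ^ \<alpha> i)"
    by (simp add: power_divide prod_dividef)
  also have "(\<Prod>i\<in>UNIV. radii_sum p ^ \<alpha> i) = radii_sum p ^ total_degree \<alpha>"
    by (simp add: total_degree_def power_sum)
  finally show ?thesis .
qed

lemma continuous_on_monomial [continuous_intros]: "continuous_on A (monomial \<alpha>)"
  unfolding monomial_def[abs_def] by (intro continuous_intros)

lemma borel_measurable_monomial [measurable]: "monomial \<alpha> \<in> borel_measurable borel"
  by (intro borel_measurable_continuous_onI continuous_intros)

text \<open>The modulus does not depend on the angles, so the integral reduces to a moment of the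
  radii.\<close>

lemma integral_norm_monomial_sq:
  fixes \<alpha> :: "'d::finite \<Rightarrow> nat"
  assumes s: "s > 0"
  shows "(\<integral>z. (cmod (monomial \<alpha> z))\<^sup>2 \<partial>ball_measure s) =
    (\<Prod>i\<in>UNIV. fact (\<alpha> i)) / pochhammer (real CARD('d) + s) (total_degree \<alpha>)"
proof (rule integral_eq_nn_integral[THEN trans])
  interpret A: prob_space "radii_measure s :: (('d \<Rightarrow> real) \<times> real) measure" by (rule prob_space_radii_measure[OF s])
  interpret B: prob_space "angles_measure :: ('d \<Rightarrow> real) measure" by (rule prob_space_angles_measure)
  have nn: "(\<Prod>i\<in>UNIV. fact (\<alpha> i)) / pochhammer (real CARD('d) + s) (total_degree \<alpha>) \<ge> 0"
    using s by (intro divide_nonneg_nonneg prod_nonneg pochhammer_nonneg) (auto intro: add_nonneg_pos)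
  have "(\<integral>\<^sup>+z. ennreal ((cmod (monomial \<alpha> z))\<^sup>2) \<partial>ball_measure s) =
      (\<integral>\<^sup>+\<omega>. ennreal ((cmod (monomial \<alpha> (ball_point \<omega>)))\<^sup>2) \<partial>(radii_measure s \<Otimes>\<^sub>M angles_measure))"
    unfolding ball_measure_def by (subst nn_integral_distr) (auto intro: measurable_ball_point)
  also have "\<dots> = (\<integral>\<^sup>+\<omega>. ennreal ((\<Prod>i\<in>UNIV. fst (fst \<omega>) i ^ \<alpha> i) / radii_sum (fst \<omega>) ^ total_degree \<alpha>) \<partial>(radii_measure s \<Otimes>\<^sub>M (angles_measure :: ('d \<Rightarrow> real) measure)))"
  proof (rule nn_integral_cong_AE, use AE_radii_angles_pos[OF s] in eventually_elim)
    case (elim \<omega>)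
    then show ?case using norm_monomial_ball_point[of "fst \<omega>" \<alpha> "snd \<omega>"] by simp
  qed
  also have "\<dots> = (\<integral>\<^sup>+p. \<integral>\<^sup>+\<theta>. ennreal ((\<Prod>i\<in>UNIV. fst p i ^ \<alpha> i) / radii_sum p ^ total_degree \<alpha>) \<partial>(angles_measure :: ('d \<Rightarrow> real) measure) \<partial>radii_measure s)"
    by (subst B.nn_integral_fst[symmetric]) simp_all
  also have "\<dots> = (\<integral>\<^sup>+p. ennreal ((\<Prod>i\<in>UNIV. fst p i ^ \<alpha> i) / radii_sum p ^ total_degree \<alpha>) \<partial>radii_measure s)"
    by (simp add: B.emeasure_space_1)
  also have "\<dots> = ennreal ((\<Prod>i\<in>UNIV. fact (\<alpha> i)) / pochhammer (real CARD('d) + s) (total_degree \<alpha>))"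
    by (rule nn_integral_radii_moment[OF s])
  finally show "enn2real (\<integral>\<^sup>+z. ennreal ((cmod (monomial \<alpha> z))\<^sup>2) \<partial>ball_measure s) =
      (\<Prod>i\<in>UNIV. fact (\<alpha> i)) / pochhammer (real CARD('d) + s) (total_degree \<alpha>)"
    using nn by (metis enn2real_ennreal)
qed auto

text \<open>Some coordinate carries different exponents, and the average over its angle vanishes.
  The power of the norm depends on the radii alone; it is carried along so that monomials stay
  orthogonal under the radial weights used later.\<close>

lemma integral_monomial_orthogonal:
  fixes \<alpha> \<beta> :: "'d::finite \<Rightarrow> nat"
  assumes s: "s > 0" and ne: "\<alpha> \<noteq> \<beta>"
  shows "(\<integral>z. monomial \<alpha> z * cnj (monomial \<beta> z) * of_real ((norm z) ^ k) \<partial>ball_measure s) = 0"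
proof -
  interpret A: prob_space "radii_measure s :: (('d \<Rightarrow> real) \<times> real) measure" by (rule prob_space_radii_measure[OF s])
  interpret B: prob_space "angles_measure :: ('d \<Rightarrow> real) measure" by (rule prob_space_angles_measure)
  interpret AB: pair_sigma_finite "radii_measure s :: (('d \<Rightarrow> real) \<times> real) measure" "angles_measure :: ('d \<Rightarrow> real) measure" ..
  define R :: "('d \<Rightarrow> real) \<times> real \<Rightarrow> complex" where "R p = of_real ((\<Prod>i\<in>UNIV. sqrt (fst p i / radii_sum p) ^ (\<alpha> i + \<beta> i)) *
    sqrt ((\<Sum>i\<in>UNIV. fst p i) / radii_sum p) ^ k)" for p
  define T where "T \<theta> = (\<Prod>i\<in>UNIV. cis (of_int (int (\<alpha> i) - int (\<beta> i)) * \<theta> i))" for \<theta> :: "'d \<Rightarrow> real"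
  have [measurable]: "T \<in> borel_measurable angles_measure" "R \<in> borel_measurable (radii_measure s)"
    unfolding T_def[abs_def] R_def[abs_def] by measurable
  have [measurable]: "(\<lambda>z. cnj (monomial \<beta> z)) \<in> borel_measurable borel"
      "(\<lambda>z :: complex^'d. complex_of_real (norm z ^ k)) \<in> borel_measurable borel"
    by (intro borel_measurable_continuous_onI continuous_intros)+
  have T0: "(\<integral>\<theta>. T \<theta> \<partial>angles_measure) = 0"
  proof -
    have int: "integrable circle_measure (\<lambda>x. cis (of_int l * x))" for l :: int
    proof -
      interpret PC: prob_space circle_measure by (rule prob_space_circle_measure)
      have [measurable]: "(\<lambda>x. cis (of_int l * x)) \<in> borel_measurable borel"
        by (intro borel_measurable_continuous_onI continuous_intros)
      show ?thesis by (intro PC.integrable_const_bound[where B = 1]) simp_all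
    qed
    interpret C: product_prob_space "\<lambda>_::'d. circle_measure" UNIV
      by (intro product_prob_spaceI prob_space_circle_measure)
    obtain i where i: "\<alpha> i \<noteq> \<beta> i" using ne by auto
    have "(\<integral>\<theta>. T \<theta> \<partial>angles_measure) = (\<Prod>i\<in>UNIV. \<integral>x. cis (of_int (int (\<alpha> i) - int (\<beta> i)) * x) \<partial>circle_measure)"
      unfolding T_def angles_measure_def
      by (rule C.product_integral_prod[of UNIV "\<lambda>i x. cis (of_int (int (\<alpha> i) - int (\<beta> i)) * x)"]) (simp_all only: finite int)
    also have "\<dots> = 0"
      using integral_circle_measure_cis[of "int (\<alpha> i) - int (\<beta> i)"] i by (intro prod_zero) (auto intro!: bexI[of _ i])
    finally show ?thesis .
  qed
  have "(\<integral>z. monomial \<alpha> z * cnj (monomial \<beta> z) * of_real ((norm z) ^ k) \<partial>ball_measure s) =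
      (\<integral>\<omega>. monomial \<alpha> (ball_point \<omega>) * cnj (monomial \<beta> (ball_point \<omega>)) * of_real ((norm (ball_point \<omega>)) ^ k)
        \<partial>(radii_measure s \<Otimes>\<^sub>M angles_measure))"
    unfolding ball_measure_def by (rule integral_distr) measurable
  also have "\<dots> = (\<integral>\<omega>. R (fst \<omega>) * T (snd \<omega>) \<partial>(radii_measure s \<Otimes>\<^sub>M angles_measure))"
  proof (rule integral_cong_AE)
    show "AE \<omega> in radii_measure s \<Otimes>\<^sub>M angles_measure.
       monomial \<alpha> (ball_point \<omega>) * cnj (monomial \<beta> (ball_point \<omega>)) * of_real ((norm (ball_point \<omega>)) ^ k) = R (fst \<omega>) * T (snd \<omega>)"
      using AE_radii_angles_pos[OF s]
    proof eventually_elim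
      case (elim \<omega>)
      obtain p \<theta> where \<omega>: "\<omega> = (p, \<theta>)" by (rule prod.exhaust[of \<omega>])
      have p: "fst p i > 0" "snd p > 0" for i using elim \<omega> by auto
      have "(norm (ball_point \<omega>))\<^sup>2 = (\<Sum>i\<in>UNIV. fst p i) / radii_sum p"
        using norm_ball_point(1)[OF p] \<omega> by simp
      then have n: "norm (ball_point \<omega>) = sqrt ((\<Sum>i\<in>UNIV. fst p i) / radii_sum p)"
        by (metis norm_ge_zero real_sqrt_abs abs_of_nonneg)
      \<comment> \<open>Moduli contribute the exponent \<open>a + b\<close> and phases the integer
        frequency \<open>a - b\<close>; this is the splitting into \<open>R\<close> and
        \<open>T\<close>.\<close>
      have c: "z ^ a * cnj z ^ b = of_real (r ^ (a + b)) * cis (of_int (int a - int b) * x)"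
        if "z = of_real r * cis x" for z r x a b
      proof -
        have "cis x ^ a = cis (real a * x)" "cis (- x) ^ b = cis (- (real b * x))"
          using Complex.DeMoivre[of x a] Complex.DeMoivre[of "-x" b] by (simp_all only: mult_minus_right)
        then have "z ^ a * cnj z ^ b = of_real (r ^ (a + b)) * (cis (real a * x) * cis (- (real b * x)))"
          using that by (simp add: power_mult_distrib cis_cnj power_add)
        also have "cis (real a * x) * cis (- (real b * x)) = cis (of_int (int a - int b) * x)"
          by (simp add: cis_mult algebra_simps)
        finally show ?thesis .
      qed
      have "monomial \<alpha> (ball_point \<omega>) * cnj (monomial \<beta> (ball_point \<omega>)) =
          (\<Prod>i\<in>UNIV. (ball_point \<omega> $ i) ^ \<alpha> i * cnj (ball_point \<omega> $ i) ^ \<beta> i)"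
        by (simp add: monomial_def prod.distrib)
      also have "\<dots> = (\<Prod>i\<in>UNIV. of_real (sqrt (fst p i / radii_sum p) ^ (\<alpha> i + \<beta> i)) * cis (of_int (int (\<alpha> i) - int (\<beta> i)) * \<theta> i))"
        by (intro prod.cong refl c) (simp add: \<omega> ball_point_def)
      finally show ?case using n by (simp add: R_def T_def \<omega> prod.distrib)
    qed
  qed measurable
  also have "\<dots> = 0"
  \<comment> \<open>The Bochner integral of a non-integrable function is zero by convention, which
    settles the other case.\<close>
  proof (cases "integrable (radii_measure s \<Otimes>\<^sub>M angles_measure) (\<lambda>\<omega>. R (fst \<omega>) * T (snd \<omega>))")
    case True
    then have "(\<integral>\<omega>. R (fst \<omega>) * T (snd \<omega>) \<partial>(radii_measure s \<Otimes>\<^sub>M angles_measure)) =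
        (\<integral>p. \<integral>\<theta>. R p * T \<theta> \<partial>angles_measure \<partial>radii_measure s)"
      using AB.integral_fst'[OF True] by simp
    then show ?thesis by (simp add: T0)
  qed (rule not_integrable_integral_eq)
  finally show ?thesis .
qed

section \<open>Analytic polynomials\<close>

lemma analytic_polynomials_iff:
  "p \<in> analytic_polynomials \<longleftrightarrow> (\<exists>A c. finite A \<and> p = (\<lambda>z. \<Sum>\<alpha>\<in>A. c \<alpha> * monomial \<alpha> z))"
  unfolding analytic_polynomials_def monomial_def by blast

lemma monomial_in_analytic_polynomials: "monomial \<alpha> \<in> analytic_polynomials"
  unfolding analytic_polynomials_iff
  by (rule exI[of _ "{\<alpha>}"], rule exI[of _ "\<lambda>_. 1"]) (simp add: fun_eq_iff)

lemma analytic_polynomials_add: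
  assumes "p \<in> analytic_polynomials" "q \<in> analytic_polynomials"
  shows "(\<lambda>z. p z + q z) \<in> analytic_polynomials"
proof -
  obtain A c where A: "finite A" "p = (\<lambda>z. \<Sum>\<alpha>\<in>A. c \<alpha> * monomial \<alpha> z)"
    using assms(1) unfolding analytic_polynomials_iff by blast
  obtain B d where B: "finite B" "q = (\<lambda>z. \<Sum>\<alpha>\<in>B. d \<alpha> * monomial \<alpha> z)"
    using assms(2) unfolding analytic_polynomials_iff by blast
  define e where "e \<alpha> = (if \<alpha> \<in> A then c \<alpha> else 0) + (if \<alpha> \<in> B then d \<alpha> else 0)" for \<alpha>
  have "p z + q z = (\<Sum>\<alpha>\<in>A \<union> B. e \<alpha> * monomial \<alpha> z)" for z
  proof -
    have "p z = (\<Sum>\<alpha>\<in>A \<union> B. (if \<alpha> \<in> A then c \<alpha> else 0) * monomial \<alpha> z)"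
      unfolding A(2) using A(1) B(1) by (intro sum.mono_neutral_cong_left) auto
    moreover have "q z = (\<Sum>\<alpha>\<in>A \<union> B. (if \<alpha> \<in> B then d \<alpha> else 0) * monomial \<alpha> z)"
      unfolding B(2) using A(1) B(1) by (intro sum.mono_neutral_cong_left) auto
    ultimately show ?thesis unfolding e_def distrib_right sum.distrib by simp
  qed
  then show ?thesis unfolding analytic_polynomials_iff using A(1) B(1) by blast
qed

lemma analytic_polynomials_scale:
  assumes "p \<in> analytic_polynomials"
  shows "(\<lambda>z. c * p z) \<in> analytic_polynomials"
proof -
  obtain A d where A: "finite A" "p = (\<lambda>z. \<Sum>\<alpha>\<in>A. d \<alpha> * monomial \<alpha> z)"
    using assms unfolding analytic_polynomials_iff by blast
  then have "(\<lambda>z. c * p z) = (\<lambda>z. \<Sum>\<alpha>\<in>A. (c * d \<alpha>) * monomial \<alpha> z)"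
    by (simp add: sum_distrib_left mult.assoc)
  with A(1) show ?thesis unfolding analytic_polynomials_iff by (intro exI[of _ A] exI[of _ "\<lambda>\<alpha>. c * d \<alpha>"]) simp
qed

lemma monomial_zero: "monomial (\<lambda>_. 0) z = 1"
  by (simp add: monomial_def)

lemma monomial_mult: "monomial \<alpha> z * monomial \<beta> z = monomial (\<lambda>i. \<alpha> i + \<beta> i) z"
  by (simp add: monomial_def power_add prod.distrib)

lemma analytic_polynomials_const: "(\<lambda>z. c) \<in> analytic_polynomials"
  using analytic_polynomials_scale[OF monomial_in_analytic_polynomials[of "\<lambda>_. 0"], of c]
  by (simp add: monomial_zero)

lemma analytic_polynomials_sum:
  "(\<And>i. i \<in> I \<Longrightarrow> p i \<in> analytic_polynomials) \<Longrightarrow> (\<lambda>z. \<Sum>i\<in>I. p i z) \<in> analytic_polynomials"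
  by (induction I rule: infinite_finite_induct) (auto intro: analytic_polynomials_const analytic_polynomials_add)

lemma analytic_polynomials_mult:
  assumes "p \<in> analytic_polynomials" "q \<in> analytic_polynomials"
  shows "(\<lambda>z. p z * q z) \<in> analytic_polynomials"
proof -
  obtain A c where A: "p = (\<lambda>z. \<Sum>\<alpha>\<in>A. c \<alpha> * monomial \<alpha> z)"
    using assms(1) unfolding analytic_polynomials_iff by blast
  obtain B d where B: "q = (\<lambda>z. \<Sum>\<alpha>\<in>B. d \<alpha> * monomial \<alpha> z)"
    using assms(2) unfolding analytic_polynomials_iff by blast
  have "(\<lambda>z. p z * q z) = (\<lambda>z. \<Sum>\<alpha>\<in>A. \<Sum>\<beta>\<in>B. (c \<alpha> * d \<beta>) * monomial (\<lambda>i. \<alpha> i + \<beta> i) z)"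
    unfolding A B sum_product monomial_mult[symmetric] by (simp add: mult_ac)
  then show ?thesis
    by (simp only:) (intro analytic_polynomials_sum analytic_polynomials_scale monomial_in_analytic_polynomials)
qed

lemma analytic_polynomials_prod:
  "(\<And>i. i \<in> I \<Longrightarrow> p i \<in> analytic_polynomials) \<Longrightarrow> (\<lambda>z. \<Prod>i\<in>I. p i z) \<in> analytic_polynomials"
  by (induction I rule: infinite_finite_induct) (auto intro: analytic_polynomials_const analytic_polynomials_mult)

lemma analytic_polynomials_coordinate: "(\<lambda>z. z $ i) \<in> analytic_polynomials"
proof -
  have "monomial (\<lambda>j. if j = i then 1 else 0) z = z $ i" for z
  proof -
    have "monomial (\<lambda>j. if j = i then 1 else 0) z = (\<Prod>j\<in>UNIV. if j = i then z $ i else 1)"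
      unfolding monomial_def by (intro prod.cong refl) auto
    then show ?thesis by (simp add: prod.delta)
  qed
  then show ?thesis using monomial_in_analytic_polynomials[of "\<lambda>j. if j = i then 1 else 0"]
    by (metis (no_types, lifting) ext)
qed

lemma continuous_on_analytic_polynomial:
  "p \<in> analytic_polynomials \<Longrightarrow> continuous_on A p"
  unfolding analytic_polynomials_def by (auto intro!: continuous_intros)

section \<open>Separately polynomial functions\<close>

definition lagrange_basis :: "nat \<Rightarrow> nat \<Rightarrow> complex \<Rightarrow> complex" where
  "lagrange_basis n j t = (\<Prod>k\<in>{..n} - {j}. (t - of_nat k) / (of_nat j - of_nat k))"

text \<open>Both sides are polynomials in \<open>t\<close> of degree at most \<open>n\<close> that
  agree at the \<open>n + 1\<close> nodes 0, ..., n.\<close>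

lemma lagrange_interpolation:
  assumes f: "\<And>t. f t = (\<Sum>k\<le>n. a k * t ^ k)"
  shows "f t = (\<Sum>j\<le>n. lagrange_basis n j t * f (of_nat j))"
proof -
  define P where "P = (\<Sum>k\<le>n. monom (a k) k)"
  define L where "L j = (\<Prod>k\<in>{..n} - {j}. smult (1 / (of_nat j - of_nat k)) [:- of_nat k, 1 :: complex:])" for j :: nat
  define Q where "Q = (\<Sum>j\<le>n. smult (f (of_nat j)) (L j))"
  have P: "poly P t = f t" for t by (simp add: P_def f poly_sum poly_monom)
  have L: "poly (L j) t = lagrange_basis n j t" for j t
    by (simp add: L_def lagrange_basis_def poly_prod diff_divide_distrib)
  have Q: "poly Q t = (\<Sum>j\<le>n. lagrange_basis n j t * f (of_nat j))" for t
    by (simp add: Q_def poly_sum L mult.commute)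
  have dL: "degree (L j) \<le> n" if "j \<le> n" for j
  proof -
    have "degree (L j) \<le> (\<Sum>k\<in>{..n} - {j}. degree (smult (1 / (of_nat j - of_nat k)) [:- of_nat k, 1:] :: complex poly))"
      unfolding L_def by (rule order_trans[OF degree_prod_sum_le]) (simp_all add: o_def)
    also have "\<dots> \<le> (\<Sum>k\<in>{..n} - {j}. 1)" by (intro sum_mono) (simp add: degree_smult_eq)
    also have "\<dots> = n" using that by simp
    finally show ?thesis .
  qed
  have "P = Q"
  proof (rule poly_eqI_degree[where A = "of_nat ` {..n}"])
    have card: "card (of_nat ` {..n} :: complex set) = Suc n"
      by (simp add: card_image inj_on_def)
    have "degree P \<le> n" unfolding P_def by (intro degree_sum_le) (auto intro: order_trans[OF degree_monom_le])
    then show "degree P < card (of_nat ` {..n} :: complex set)" using card by simp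
    have "degree Q \<le> n"
      unfolding Q_def by (intro degree_sum_le) (auto intro: order_trans[OF degree_smult_le] dL)
    then show "degree Q < card (of_nat ` {..n} :: complex set)" using card by simp
    fix x :: complex assume "x \<in> of_nat ` {..n}"
    then obtain i where i: "i \<le> n" "x = of_nat i" by auto
    have l: "lagrange_basis n j x = (if j = i then 1 else 0)" if "j \<le> n" for j
    proof (cases "j = i")
      case False
      then show ?thesis unfolding lagrange_basis_def using i by (auto intro!: prod_zero bexI[of _ i])
    qed (auto simp: lagrange_basis_def i intro!: prod.neutral)
    have "poly Q x = (\<Sum>j\<le>n. if j = i then f (of_nat j) else 0)"
      unfolding Q by (intro sum.cong refl) (auto simp: l)
    then show "poly P x = poly Q x" using i by (simp add: P)
  qed
  then show ?thesis using P[of t] Q[of t] by simp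
qed

definition upd_coord :: "complex^'d \<Rightarrow> 'd \<Rightarrow> complex \<Rightarrow> complex^'d" where
  "upd_coord z i t = (\<chi> j. if j = i then t else z $ j)"

text \<open>One degree bound \<open>n\<close> for all coordinate lines, so that the same
  \<open>n + 1\<close> interpolation nodes serve every line.\<close>

definition separately_polynomial :: "nat \<Rightarrow> (complex^'d \<Rightarrow> complex) \<Rightarrow> bool" where
  "separately_polynomial n G \<longleftrightarrow> (\<forall>z i. \<exists>a. \<forall>t. G (upd_coord z i t) = (\<Sum>k\<le>n. a k * t ^ k))"

text \<open>Induction on a set of coordinates that determines \<open>G\<close>. Interpolation in
  coordinate \<open>i\<close> expresses \<open>G\<close> through its restrictions to finitely many
  values of that coordinate, and these are determined by the remaining ones.\<close>

lemma separately_polynomial_imp_polynomial_aux: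
  fixes G :: "complex^'d \<Rightarrow> complex"
  assumes "finite S" "separately_polynomial n G"
    "\<And>z z' :: complex^'d. (\<And>i. i \<in> S \<Longrightarrow> z $ i = z' $ i) \<Longrightarrow> G z = G z'"
  shows "G \<in> analytic_polynomials"
  using assms
proof (induction S arbitrary: G)
  case empty
  have "G = (\<lambda>z. G 0)" by (intro ext empty.prems(2)) simp
  then show ?case using analytic_polynomials_const by metis
next
  case (insert i S)
  have IH: "(\<lambda>z. G (upd_coord z i c)) \<in> analytic_polynomials" for c
  proof (rule insert.IH)
    show "separately_polynomial n (\<lambda>z. G (upd_coord z i c))"
      unfolding separately_polynomial_def
    proof (intro allI)
      fix z i'
      show "\<exists>a. \<forall>t. G (upd_coord (upd_coord z i' t) i c) = (\<Sum>k\<le>n. a k * t ^ k)"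
      proof (cases "i' = i")
        case True
        have "upd_coord (upd_coord z i' t) i c = upd_coord z i c" for t
          by (simp add: upd_coord_def vec_eq_iff True)
        moreover have "(\<Sum>k\<le>n. (if k = 0 then x else 0) * t ^ k) = x" for x t :: complex
        proof -
          have "(\<Sum>k\<le>n. (if k = 0 then x else 0) * t ^ k) = (\<Sum>k\<le>n. if k = 0 then x else 0)"
            by (intro sum.cong refl) auto
          then show ?thesis by simp
        qed
        ultimately show ?thesis
          by (intro exI[of _ "\<lambda>k. if k = 0 then G (upd_coord z i c) else 0"]) simp
      next
        case False
        then have "upd_coord (upd_coord z i' t) i c = upd_coord (upd_coord z i c) i' t" for t
          by (auto simp: upd_coord_def vec_eq_iff)
        then show ?thesis using insert.prems(1) unfolding separately_polynomial_def by simp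
      qed
    qed
    show "G (upd_coord z i c) = G (upd_coord z' i c)" if "\<And>j. j \<in> S \<Longrightarrow> z $ j = z' $ j"
      for z z' :: "complex^'d"
      by (rule insert.prems(2)) (auto simp: upd_coord_def that)
  qed
  have "G z = (\<Sum>j\<le>n. lagrange_basis n j (z $ i) * G (upd_coord z i (of_nat j)))" for z
  proof -
    obtain a where a: "\<And>t. G (upd_coord z i t) = (\<Sum>k\<le>n. a k * t ^ k)"
      using insert.prems(1) unfolding separately_polynomial_def by blast
    have "upd_coord z i (z $ i) = z" by (simp add: upd_coord_def vec_eq_iff)
    then show ?thesis using lagrange_interpolation[where f = "\<lambda>t. G (upd_coord z i t)" and n = n and a = a and t = "z $ i"] a
      by simp
  qed
  moreover have basis: "(\<lambda>z. lagrange_basis n j (z $ i)) \<in> analytic_polynomials" for j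
  proof -
    have "(\<lambda>z. (z $ i - of_nat k) / (of_nat j - of_nat k)) \<in> analytic_polynomials" for k
      using analytic_polynomials_scale[OF analytic_polynomials_add[OF analytic_polynomials_coordinate[of i]
            analytic_polynomials_const[of "- of_nat k"]], of "1 / (of_nat j - of_nat k)"] by simp
    then show ?thesis unfolding lagrange_basis_def by (rule analytic_polynomials_prod)
  qed
  ultimately have "G = (\<lambda>z. \<Sum>j\<le>n. lagrange_basis n j (z $ i) * G (upd_coord z i (of_nat j)))" by blast
  moreover have "\<dots> \<in> analytic_polynomials"
    by (intro analytic_polynomials_sum analytic_polynomials_mult IH basis)
  ultimately show ?case by simp
qed

lemma separately_polynomial_imp_polynomial:
  fixes G :: "complex^'d \<Rightarrow> complex"
  shows "separately_polynomial n G \<Longrightarrow> G \<in> analytic_polynomials"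
proof (rule separately_polynomial_imp_polynomial_aux[OF finite_class.finite_UNIV])
  fix z z' :: "complex^'d" assume "\<And>i. i \<in> UNIV \<Longrightarrow> z $ i = z' $ i"
  then have "z = z'" by (simp add: vec_eq_iff)
  then show "G z = G z'" by simp
qed

section \<open>Uniform approximation of analytic functions by polynomials\<close>

text \<open>Complex linearity of the derivative turns the real derivative of the slice into
  multiplication by the number \<open>D v\<close>.\<close>

lemma holomorphic_on_slice:
  fixes F :: "complex^'d \<Rightarrow> complex"
  assumes F: "analytic_several_on F S" and sub: "\<And>t. t \<in> T \<Longrightarrow> z + t *s v \<in> S"
  shows "(\<lambda>t. F (z + t *s v)) holomorphic_on T"
proof -
  have lin: "bounded_linear (\<lambda>h. h *s v)"
    unfolding linear_conv_bounded_linear[symmetric]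
    by (intro linearI) (auto simp: vec_eq_iff algebra_simps)
  show ?thesis
    unfolding holomorphic_on_def field_differentiable_def
  proof
    fix t assume "t \<in> T"
    then obtain D where D: "(F has_derivative D) (at (z + t *s v))" "\<And>c v. D (c *s v) = c * D v"
      using F sub unfolding analytic_several_on_def by blast
    have "((\<lambda>t. z + t *s v) has_derivative (\<lambda>h. 0 + h *s v)) (at t within T)"
      by (intro has_derivative_add has_derivative_const bounded_linear_imp_has_derivative lin)
    then have "((\<lambda>t. F (z + t *s v)) has_derivative (\<lambda>h. D (0 + h *s v))) (at t within T)"
      by (rule has_derivative_compose) (fact D)
    moreover have "(\<lambda>h. D (0 + h *s v)) = (\<lambda>h. D v * h)" by (simp add: D(2) fun_eq_iff mult.commute)
    ultimately show "\<exists>f'. ((\<lambda>t. F (z + t *s v)) has_field_derivative f') (at t within T)"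
      unfolding has_field_derivative_def by metis
  qed
qed

lemma analytic_several_on_continuous_on:
  "analytic_several_on F S \<Longrightarrow> continuous_on S F"
  unfolding analytic_several_on_def
  by (metis continuous_at_imp_continuous_on has_derivative_continuous)

lemma norm_scalar_mult: "norm (c *s z) = cmod c * norm z"
  by (simp add: norm_vec_def norm_mult L2_set_right_distrib)

lemma norm_upd_coord_le: "norm (upd_coord z i t) \<le> norm z + cmod t"
proof -
  have "upd_coord z i t = upd_coord z i 0 + t *s axis i 1"
    by (auto simp: vec_eq_iff upd_coord_def axis_def)
  then have "norm (upd_coord z i t) \<le> norm (upd_coord z i 0) + norm (t *s axis i (1::complex))"
    by (metis norm_triangle_ineq)
  also have "norm (t *s axis i (1::complex)) = cmod t"
  proof -
    have "(cmod (axis i 1 $ j))\<^sup>2 = (if j = i then 1 else 0)" for j by (simp add: axis_def)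
    then have "norm (axis i (1::complex)) = 1" by (simp add: norm_vec_def L2_set_def)
    then show ?thesis by (simp add: norm_scalar_mult)
  qed
  also have "norm (upd_coord z i 0) \<le> norm z"
    by (rule norm_le_componentwise_cart) (auto simp: upd_coord_def)
  finally show ?thesis by simp
qed

text \<open>The homogeneous Taylor part of degree \<open>n\<close>, read off the slice through
  \<open>z\<close>. Only small \<open>t\<close> matter, so it makes sense for every
  \<open>z\<close>, also far outside the domain of \<open>F\<close>.\<close>

definition homogeneous_part :: "(complex^'d \<Rightarrow> complex) \<Rightarrow> nat \<Rightarrow> complex^'d \<Rightarrow> complex" where
  "homogeneous_part F n z = (deriv ^^ n) (\<lambda>t. F (t *s z)) 0 / fact n"

context
  fixes F :: "complex^'d \<Rightarrow> complex" and R \<rho> M :: real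
  assumes F: "analytic_several_on F (ball 0 R)"
    and \<rho>: "0 < \<rho>" "\<rho> < R" and M: "\<And>z. norm z \<le> \<rho> \<Longrightarrow> cmod (F z) \<le> M"
begin

lemma holomorphic_on_radial_slice:
  assumes "\<And>t. t \<in> T \<Longrightarrow> cmod t * norm z < R"
  shows "(\<lambda>t. F (t *s z)) holomorphic_on T"
  using holomorphic_on_slice[OF F, of T 0 z] assms by (simp add: norm_scalar_mult)

text \<open>Cauchy's inequality for the slice on the circle of radius
  \<open>\<rho> / norm z\<close>.\<close>

lemma homogeneous_part_bound: "cmod (homogeneous_part F n z) \<le> M * (norm z / \<rho>) ^ n"
proof (cases "z = 0")
  case True
  have "cmod (F 0) \<le> M" using M[of 0] \<rho> by simp
  then show ?thesis using True by (cases n) (simp_all add: homogeneous_part_def higher_deriv_const)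
next
  case False
  define r where "r = \<rho> / norm z"
  have r: "r > 0" using \<rho> False by (simp add: r_def)
  have lt: "cmod t * norm z \<le> \<rho>" if "cmod t \<le> r" for t
    using that False by (simp add: r_def field_simps)
  have hol: "(\<lambda>t. F (t *s z)) holomorphic_on cball 0 r"
    by (rule holomorphic_on_radial_slice) (use lt \<rho> in fastforce)
  have "cmod ((deriv ^^ n) (\<lambda>t. F (t *s z)) 0) \<le> fact n * M / r ^ n"
  proof (rule Cauchy_inequality[OF _ _ r])
    show "(\<lambda>t. F (t *s z)) holomorphic_on ball 0 r"
      by (rule holomorphic_on_subset[OF hol]) auto
    show "continuous_on (cball 0 r) (\<lambda>t. F (t *s z))" by (rule holomorphic_on_imp_continuous_on[OF hol])
    fix t :: complex assume "cmod (0 - t) = r"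
    then show "cmod (F (t *s z)) \<le> M" using lt[of t] by (intro M) (simp add: norm_scalar_mult)
  qed
  then show ?thesis
    by (simp add: homogeneous_part_def norm_divide r_def power_divide field_simps)
qed

lemma homogeneous_expansion:
  assumes "cmod t * norm z < R"
  shows "(\<lambda>n. homogeneous_part F n z * t ^ n) sums F (t *s z)"
proof (cases "z = 0")
  case True
  have "(\<lambda>n. homogeneous_part F n z * t ^ n) = (\<lambda>n. if n = 0 then F 0 else 0)"
    using True by (auto simp: homogeneous_part_def higher_deriv_const fun_eq_iff)
  then show ?thesis using sums_single[of 0 "\<lambda>_. F 0"] True by simp
next
  case False
  have "(\<lambda>t. F (t *s z)) holomorphic_on ball 0 (R / norm z)"
    by (rule holomorphic_on_radial_slice) (use False in \<open>simp add: field_simps\<close>)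
  then have "(\<lambda>n. (deriv ^^ n) (\<lambda>t. F (t *s z)) 0 / fact n * (t - 0) ^ n) sums F (t *s z)"
    by (rule holomorphic_power_series) (use assms False in \<open>simp add: field_simps\<close>)
  then show ?thesis by (simp add: homogeneous_part_def)
qed

text \<open>The tail is dominated by a geometric series of ratio \<open>x\<close>. The dilation
  \<open>t\<close> is kept because small \<open>t\<close> will isolate a single homogeneous
  part.\<close>

lemma homogeneous_expansion_error:
  assumes x: "x < 1" "cmod t * norm z \<le> \<rho> * x"
  shows "cmod (F (t *s z) - (\<Sum>k<n. homogeneous_part F k z * t ^ k)) \<le> M * x ^ n / (1 - x)"
proof -
  have M0: "M \<ge> 0" using M[of 0] \<rho> norm_ge_zero[of "F 0"] by (smt (verit) norm_zero)
  have x0: "x \<ge> 0" using x(2) \<rho> by (metis mult_nonneg_nonneg norm_ge_zero order_trans zero_le_mult_iff not_less)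
  have "\<rho> * x \<le> \<rho>" using x \<rho> by simp
  then have "cmod t * norm z < R" using x \<rho> by linarith
  then have s: "(\<lambda>k. homogeneous_part F k z * t ^ k) sums F (t *s z)" by (rule homogeneous_expansion)
  then have tail: "(\<lambda>k. homogeneous_part F (k + n) z * t ^ (k + n)) sums
      (F (t *s z) - (\<Sum>k<n. homogeneous_part F k z * t ^ k))"
    by (rule sums_split_initial_segment)
  have geo: "(\<lambda>k. M * x ^ n * x ^ k) sums (M * x ^ n * (1 / (1 - x)))"
    by (intro sums_mult geometric_sums) (use x x0 in simp)
  have "cmod (homogeneous_part F (k + n) z * t ^ (k + n)) \<le> M * x ^ n * x ^ k" for k
  proof -
    have "cmod (homogeneous_part F (k + n) z * t ^ (k + n)) \<le> M * (norm z / \<rho>) ^ (k + n) * cmod t ^ (k + n)"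
      unfolding norm_mult norm_power by (intro mult_right_mono homogeneous_part_bound) simp
    also have "\<dots> = M * (cmod t * norm z / \<rho>) ^ (k + n)" by (simp add: power_mult_distrib power_divide)
    also have "\<dots> \<le> M * x ^ (k + n)"
      using x(2) \<rho> M0 by (intro mult_left_mono power_mono) (auto simp: field_simps)
    finally show ?thesis by (simp add: power_add mult_ac)
  qed
  then have "cmod (\<Sum>k. homogeneous_part F (k + n) z * t ^ (k + n)) \<le> (\<Sum>k. M * x ^ n * x ^ k)"
    by (rule norm_suminf_le) (rule sums_summable[OF geo])
  then show ?thesis using sums_unique[OF tail] sums_unique[OF geo] by simp
qed

text \<open>The part of degree \<open>n\<close> is the limit, as the scalar \<open>lam\<close> tends
  to zero, of \<open>F\<close> at \<open>lam\<close> times the point minus the parts of lower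
  degree, divided by \<open>lam ^ n\<close>. By induction these quotients are holomorphic along
  coordinate lines, and they converge locally uniformly, so the part is entire there; its growth and
  Liouville's theorem make it a polynomial of degree at most \<open>n\<close>.\<close>

lemma separately_polynomial_homogeneous_part: "separately_polynomial n (homogeneous_part F n)"
proof (induction n rule: less_induct)
  case (less n)
  have M0: "M \<ge> 0" using M[of 0] \<rho> norm_ge_zero[of "F 0"] by (smt (verit) norm_zero)
  show ?case
    unfolding separately_polynomial_def
  proof (intro allI)
    fix z i
    define g where "g t = homogeneous_part F n (upd_coord z i t)" for t
    have entire: "g holomorphic_on ball 0 T" if T: "T > 0" for T
    proof (rule holomorphic_uniform_sequence)
      define B where "B = norm z + T"
      \<comment> \<open>Scaled so that points of norm at most \<open>B\<close> are sent into the
        ball of radius \<open>\<rho> / 2\<close>, by factors that tend to zero.\<close>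
      define lam :: "nat \<Rightarrow> complex" where "lam N = of_real (\<rho> / (2 * B) / real (Suc N))" for N
      have B: "B > 0" using T by (simp add: B_def add_nonneg_pos)
      have le: "norm (upd_coord z i t) \<le> B" if "t \<in> ball 0 T" for t
        using norm_upd_coord_le[of z i t] that by (simp add: B_def)
      have lam0: "lam N \<noteq> 0" for N using \<rho> B unfolding lam_def of_real_eq_0_iff by simp
      have norm_lam: "cmod (lam N) = \<rho> / (2 * B) / real (Suc N)" for N
        using \<rho> B by (simp only: lam_def norm_of_real) simp
      have small: "cmod (lam N) * norm (upd_coord z i t) \<le> \<rho> * (1 / 2 / real (Suc N))" if "t \<in> ball 0 T" for t N
      proof -
        have "cmod (lam N) * norm (upd_coord z i t) \<le> cmod (lam N) * B"
          using le[OF that] by (intro mult_left_mono) auto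
        also have "\<dots> = \<rho> * (1 / 2 / real (Suc N))" using B by (simp add: norm_lam del: of_nat_Suc)
        finally show ?thesis .
      qed
      define f where "f N t = (F (lam N *s upd_coord z i t) - (\<Sum>k<n. homogeneous_part F k (upd_coord z i t) * lam N ^ k)) / lam N ^ n" for N t
      show "f N holomorphic_on ball 0 T" for N
      proof -
        have "(\<lambda>t. F (lam N *s upd_coord z i 0 + t *s (lam N *s axis i 1))) holomorphic_on ball 0 T"
        proof (rule holomorphic_on_slice[OF F])
          fix t :: complex assume t: "t \<in> ball 0 T"
          have "lam N *s upd_coord z i 0 + t *s (lam N *s axis i 1) = lam N *s upd_coord z i t"
            by (auto simp: vec_eq_iff upd_coord_def axis_def)
          moreover have "\<rho> * (1 / 2 / real (Suc N)) \<le> \<rho>" using \<rho> by (simp add: field_simps)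
          then have "norm (lam N *s upd_coord z i t) < R"
            using small[OF t, of N] \<rho> unfolding norm_scalar_mult by linarith
          ultimately show "lam N *s upd_coord z i 0 + t *s (lam N *s axis i 1) \<in> ball 0 R" by simp
        qed
        moreover have "(\<lambda>t. F (lam N *s upd_coord z i 0 + t *s (lam N *s axis i 1))) = (\<lambda>t. F (lam N *s upd_coord z i t))"
          by (intro ext arg_cong[of _ _ F]) (auto simp: vec_eq_iff upd_coord_def axis_def)
        ultimately have 1: "(\<lambda>t. F (lam N *s upd_coord z i t)) holomorphic_on ball 0 T" by simp
        have 2: "(\<lambda>t. homogeneous_part F k (upd_coord z i t)) holomorphic_on ball 0 T" if k: "k < n" for k
        proof -
          obtain a where "\<And>t. homogeneous_part F k (upd_coord z i t) = (\<Sum>j\<le>k. a j * t ^ j)"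
            using less.IH[OF k] unfolding separately_polynomial_def by blast
          then show ?thesis by (auto intro!: holomorphic_intros)
        qed
        show ?thesis unfolding f_def using 1 2 lam0 by (auto intro!: holomorphic_intros)
      qed
      show "\<exists>d>0. cball x d \<subseteq> ball 0 T \<and> uniform_limit (cball x d) f g sequentially" if "x \<in> ball 0 T" for x
      proof -
        obtain d where d: "d > 0" "cball x d \<subseteq> ball 0 T"
          using \<open>x \<in> ball 0 T\<close> open_ball open_contains_cball by blast
        \<comment> \<open>One factor \<open>x\<close> survives the division by
          \<open>lam N ^ n\<close> in the estimate below and gives the rate
          \<open>1 / (N + 1)\<close>.\<close>
        define C where "C = 2 * M * (B / \<rho>) ^ n"
        have err: "cmod (f N t - g t) \<le> C * (1 / real (Suc N))" if t: "t \<in> ball 0 T" for N t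
        proof -
          define x where "x = 1 / 2 / real (Suc N)"
          have x: "x \<le> 1 / 2" "x > 0" by (simp_all add: x_def field_simps)
          have "f N t - g t = (F (lam N *s upd_coord z i t) - (\<Sum>k<Suc n. homogeneous_part F k (upd_coord z i t) * lam N ^ k)) / lam N ^ n"
            using lam0[of N] by (simp add: f_def g_def field_simps)
          also have "cmod \<dots> \<le> (M * x ^ Suc n / (1 - x)) / cmod (lam N) ^ n"
            unfolding norm_divide norm_power
          proof (rule divide_right_mono[OF homogeneous_expansion_error])
            show "cmod (lam N) * norm (upd_coord z i t) \<le> \<rho> * x" unfolding x_def by (rule small[OF t])
          qed (use x in auto)
          also have "(M * x ^ Suc n / (1 - x)) / cmod (lam N) ^ n = M * (x / cmod (lam N)) ^ n * (x / (1 - x))" by (simp add: power_divide mult_ac)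
          also have "x / cmod (lam N) = B / \<rho>" using B \<rho> by (simp add: norm_lam x_def divide_simps del: of_nat_Suc)
          also have "M * (B / \<rho>) ^ n * (x / (1 - x)) \<le> M * (B / \<rho>) ^ n * (2 * (2 * x))"
          proof (intro mult_left_mono)
            have "x / (1 - x) \<le> x / (1 / 2)" using x by (intro divide_left_mono) auto
            then show "x / (1 - x) \<le> 2 * (2 * x)" using x by simp
          qed (use M0 B \<rho> in simp)
          also have "\<dots> = C * (1 / real (Suc N))" by (simp add: C_def x_def divide_simps del: of_nat_Suc)
          finally show ?thesis .
        qed
        have "uniform_limit (cball x d) f g sequentially"
        proof (rule uniform_limitI)
          fix e :: real assume e: "e > 0"
          have "(\<lambda>N. C * (1 / real (Suc N))) \<longlonglongrightarrow> C * 0"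
            by (intro tendsto_mult_left LIMSEQ_Suc[OF lim_1_over_n])
          then have "\<forall>\<^sub>F N in sequentially. C * (1 / real (Suc N)) < e"
            using order_tendstoD(2)[of _ "C * 0" sequentially e] e by simp
          then show "\<forall>\<^sub>F N in sequentially. \<forall>t\<in>cball x d. dist (f N t) (g t) < e"
          proof eventually_elim
            case (elim N)
            then show ?case using err d(2) unfolding dist_norm by (meson le_less_trans subsetD)
          qed
        qed
        then show ?thesis using d by blast
      qed
    qed simp
    have "g holomorphic_on UNIV"
      unfolding holomorphic_on_def
    proof
      fix t :: complex
      have "g holomorphic_on ball 0 (cmod t + 1)" by (rule entire) (simp add: add_nonneg_pos)
      then have "g field_differentiable at t"
        by (rule holomorphic_on_imp_differentiable_at) simp_all
      then show "g field_differentiable at t within UNIV" by simp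
    qed
    \<comment> \<open>Growth is needed only for large arguments; once \<open>cmod t\<close> exceeds
      \<open>norm z\<close>, the moved point has norm at most \<open>2 * cmod t\<close>.\<close>
    moreover have "cmod (g t) \<le> (M * (2 / \<rho>) ^ n) * cmod t ^ n" if "norm z \<le> cmod t" for t
    proof -
      have "cmod (g t) \<le> M * (norm (upd_coord z i t) / \<rho>) ^ n" unfolding g_def by (rule homogeneous_part_bound)
      also have "\<dots> \<le> M * (2 * cmod t / \<rho>) ^ n"
        using norm_upd_coord_le[of z i t] that M0 \<rho>
        by (intro mult_left_mono power_mono divide_right_mono) auto
      also have "\<dots> = (M * (2 / \<rho>) ^ n) * cmod t ^ n" by (simp add: power_mult_distrib power_divide)
      finally show ?thesis .
    qed
    ultimately have "g t = (\<Sum>k\<le>n. (deriv ^^ k) g 0 / fact k * t ^ k)" for t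
      by (rule Liouville_polynomial)
    then show "\<exists>a. \<forall>t. homogeneous_part F n (upd_coord z i t) = (\<Sum>k\<le>n. a k * t ^ k)"
      unfolding g_def[symmetric] by (intro exI[of _ "\<lambda>k. (deriv ^^ k) g 0 / fact k"] allI)
  qed
qed

end

text \<open>Taylor partial sums: the radius \<open>\<rho>\<close> lies strictly between 1 and
  \<open>R\<close>, so the error on the closed unit ball is geometric of ratio
  \<open>1 / \<rho>\<close>.\<close>

lemma analytic_uniform_approximation:
  fixes F :: "complex^'d \<Rightarrow> complex"
  assumes F: "analytic_several_on F (ball 0 R)" and R: "R > 1" and e: "e > 0"
  obtains p where "p \<in> analytic_polynomials" "\<And>z. norm z \<le> 1 \<Longrightarrow> cmod (F z - p z) < e"
proof -
  define \<rho> where "\<rho> = (1 + R) / 2"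
  have \<rho>: "0 < \<rho>" "\<rho> < R" "1 < \<rho>" using R by (simp_all add: \<rho>_def)
  have "continuous_on (cball 0 \<rho>) F"
    using analytic_several_on_continuous_on[OF F] by (rule continuous_on_subset) (use \<rho> in auto)
  then have "bounded (F ` cball 0 \<rho>)" by (intro compact_imp_bounded compact_continuous_image) auto
  then obtain M where "\<forall>y\<in>F ` cball 0 \<rho>. cmod y \<le> M" by (auto simp: bounded_iff)
  then have M: "cmod (F z) \<le> M" if "norm z \<le> \<rho>" for z using that by auto
  define x where "x = 1 / \<rho>"
  have x: "0 < x" "x < 1" using \<rho> by (simp_all add: x_def)
  have "(\<lambda>n. M * x ^ n / (1 - x)) \<longlonglongrightarrow> M * 0 / (1 - x)"
    using x by (intro tendsto_intros LIMSEQ_realpow_zero) auto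
  then have "\<forall>\<^sub>F n in sequentially. M * x ^ n / (1 - x) < e"
    using order_tendstoD(2)[of _ "M * 0 / (1 - x)" sequentially e] e by simp
  then obtain n where n: "M * x ^ n / (1 - x) < e" by (auto simp: eventually_sequentially)
  define p where "p z = (\<Sum>k<n. homogeneous_part F k z)" for z
  have "p \<in> analytic_polynomials"
    unfolding p_def[abs_def]
    by (intro analytic_polynomials_sum separately_polynomial_imp_polynomial)
      (rule separately_polynomial_homogeneous_part[OF F \<rho>(1,2) M])
  moreover have "cmod (F z - p z) < e" if "norm z \<le> 1" for z
  proof -
    have "cmod (F (1 *s z) - (\<Sum>k<n. homogeneous_part F k z * 1 ^ k)) \<le> M * x ^ n / (1 - x)"
      by (rule homogeneous_expansion_error[OF F \<rho>(1,2) M]) (use that \<rho> x in \<open>auto simp: x_def\<close>)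
    then show ?thesis using n by (simp add: p_def)
  qed
  ultimately show ?thesis using that by blast
qed

section \<open>Weighted inner products on the ball\<close>

text \<open>A common home for \<open>b\<close>, its conjugate, polynomials and kernel functions, in
  which every integral against a probability measure on the ball exists. Values outside the ball are
  left free.\<close>

definition bounded_continuous :: "(complex^'d \<Rightarrow> complex) set" where
  "bounded_continuous = {f. continuous_on (ball 0 1) f \<and> bounded (f ` ball 0 1)}"

text \<open>The shape parameter \<open>\<gamma> - d\<close> makes \<open>\<gamma>\<close> the
  exponent of the Bergman kernel. The restriction to the ball, which carries all the mass, makes
  measurability a matter of values in the ball; those of \<open>b\<close> elsewhere are
  arbitrary.\<close>

definition ball_prob :: "real \<Rightarrow> (complex^'d) measure" where
  "ball_prob \<gamma> = restrict_space (ball_measure (\<gamma> - real CARD('d))) (ball 0 1)"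

definition weighted_ip ::
  "real \<Rightarrow> (complex^'d \<Rightarrow> real) \<Rightarrow> (complex^'d \<Rightarrow> complex) \<Rightarrow> (complex^'d \<Rightarrow> complex) \<Rightarrow> complex" where
  "weighted_ip \<gamma> W f g = (\<integral>z. f z * cnj (g z) * of_real (W z) \<partial>ball_prob \<gamma>)"

text \<open>The ball algebra, up to values outside the ball. It contains the kernel functions of
  points of the ball, but in general not \<open>b\<close>.\<close>

definition poly_approximable :: "(complex^'d \<Rightarrow> complex) set" where
  "poly_approximable = {f. \<forall>e>0. \<exists>p\<in>analytic_polynomials. \<forall>z\<in>ball 0 1. cmod (f z - p z) < e}"

section \<open>Bounded continuous functions and the ball algebra\<close>

lemma bounded_continuousI:
  assumes "continuous_on (ball 0 1) f" "\<And>z. z \<in> ball 0 1 \<Longrightarrow> cmod (f z) \<le> B"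
  shows "f \<in> bounded_continuous"
  using assms unfolding bounded_continuous_def bounded_iff by (auto intro!: exI[of _ B])

lemma bounded_continuousD:
  assumes "f \<in> bounded_continuous"
  obtains B where "B > 0" "\<And>z. z \<in> ball 0 1 \<Longrightarrow> cmod (f z) \<le> B"
proof -
  have "bounded (f ` ball 0 1)" using assms by (simp add: bounded_continuous_def)
  then obtain B where B: "B > 0" "\<forall>x\<in>f ` ball 0 1. cmod x \<le> B" unfolding bounded_pos by blast
  then show ?thesis using that[of B] by blast
qed

lemma bounded_continuous_continuous: "f \<in> bounded_continuous \<Longrightarrow> continuous_on (ball 0 1) f"
  by (simp add: bounded_continuous_def)

lemma bounded_continuous_const: "(\<lambda>z. c) \<in> bounded_continuous"
  by (rule bounded_continuousI[where B = "cmod c"]) (auto intro: continuous_intros)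

lemma bounded_continuous_add:
  assumes "f \<in> bounded_continuous" "g \<in> bounded_continuous"
  shows "(\<lambda>z. f z + g z) \<in> bounded_continuous"
proof -
  obtain B where B: "\<And>z. z \<in> ball 0 1 \<Longrightarrow> cmod (f z) \<le> B" using bounded_continuousD[OF assms(1)] by blast
  obtain C where C: "\<And>z. z \<in> ball 0 1 \<Longrightarrow> cmod (g z) \<le> C" using bounded_continuousD[OF assms(2)] by blast
  show ?thesis
  proof (rule bounded_continuousI[where B = "B + C"])
    fix z :: "complex^'a" assume "z \<in> ball 0 1"
    then show "cmod (f z + g z) \<le> B + C" by (intro norm_triangle_le add_mono B C)
  qed (intro continuous_intros bounded_continuous_continuous assms)
qed

lemma bounded_continuous_mult:
  assumes "f \<in> bounded_continuous" "g \<in> bounded_continuous"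
  shows "(\<lambda>z. f z * g z) \<in> bounded_continuous"
proof -
  obtain B where B: "B > 0" "\<And>z. z \<in> ball 0 1 \<Longrightarrow> cmod (f z) \<le> B" using bounded_continuousD[OF assms(1)] by blast
  obtain C where C: "\<And>z. z \<in> ball 0 1 \<Longrightarrow> cmod (g z) \<le> C" using bounded_continuousD[OF assms(2)] by blast
  show ?thesis
  proof (rule bounded_continuousI[where B = "B * C"])
    fix z :: "complex^'a" assume "z \<in> ball 0 1"
    then show "cmod (f z * g z) \<le> B * C"
      unfolding norm_mult using B C by (intro mult_mono) (auto intro: less_imp_le)
  qed (intro continuous_intros bounded_continuous_continuous assms)
qed

lemma bounded_continuous_scale: "f \<in> bounded_continuous \<Longrightarrow> (\<lambda>z. c * f z) \<in> bounded_continuous"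
  by (intro bounded_continuous_mult bounded_continuous_const)

lemma bounded_continuous_diff:
  "f \<in> bounded_continuous \<Longrightarrow> g \<in> bounded_continuous \<Longrightarrow> (\<lambda>z. f z - g z) \<in> bounded_continuous"
  using bounded_continuous_add[OF _ bounded_continuous_scale[of g "-1"], of f] by simp

lemma bounded_continuous_cnj:
  assumes "f \<in> bounded_continuous"
  shows "(\<lambda>z. cnj (f z)) \<in> bounded_continuous"
proof -
  obtain B where B: "\<And>z. z \<in> ball 0 1 \<Longrightarrow> cmod (f z) \<le> B" using bounded_continuousD[OF assms(1)] by blast
  show ?thesis
  proof (rule bounded_continuousI[where B = B])
    fix z :: "complex^'a" assume "z \<in> ball 0 1"
    then show "cmod (cnj (f z)) \<le> B" unfolding complex_mod_cnj by (rule B)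
  qed (intro continuous_intros bounded_continuous_continuous assms)
qed

lemma bounded_continuous_norm_power: "(\<lambda>z. of_real (norm z ^ k)) \<in> bounded_continuous"
  by (rule bounded_continuousI[where B = 1]) (auto intro!: continuous_intros power_le_one simp: norm_power)

lemma bounded_continuous_polynomial:
  assumes "p \<in> analytic_polynomials"
  shows "p \<in> bounded_continuous"
proof -
  have "bounded (p ` cball 0 1)"
    by (intro compact_imp_bounded compact_continuous_image continuous_on_analytic_polynomial assms) simp
  then have "bounded (p ` ball 0 1)" by (rule bounded_subset) auto
  then show ?thesis
    using continuous_on_analytic_polynomial[OF assms] by (simp add: bounded_continuous_def)
qed

lemma bounded_continuous_poly_approximable:
  assumes "f \<in> poly_approximable"
  shows "f \<in> bounded_continuous"
proof -
  have "\<forall>n. \<exists>p\<in>analytic_polynomials. \<forall>z\<in>ball 0 1. cmod (f z - p z) < 1 / real (Suc n)"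
    using assms unfolding poly_approximable_def by simp
  then obtain p where p: "\<And>n. p n \<in> analytic_polynomials" "\<And>n z. z \<in> ball 0 1 \<Longrightarrow> cmod (f z - p n z) < 1 / real (Suc n)"
    by metis
  have lim: "uniform_limit (ball 0 1) p f sequentially"
  proof (rule uniform_limitI)
    fix e :: real assume "e > 0"
    then obtain N where N: "1 / real (Suc N) < e" using nat_approx_posE by blast
    show "\<forall>\<^sub>F n in sequentially. \<forall>z\<in>ball 0 1. dist (p n z) (f z) < e"
      unfolding eventually_sequentially
    proof (intro exI allI impI ballI)
      fix n z assume n: "n \<ge> N" and z: "z \<in> ball (0 :: complex^'a) 1"
      have "dist (p n z) (f z) < 1 / real (Suc n)" using p(2)[OF z, of n] by (simp add: dist_norm norm_minus_commute)
      also have "\<dots> \<le> 1 / real (Suc N)" using n by (auto simp: field_simps)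
      finally show "dist (p n z) (f z) < e" using N by simp
    qed
  qed
  have "continuous_on (ball 0 1) f"
    by (rule uniform_limit_theorem[OF _ lim]) (auto intro: always_eventually continuous_on_analytic_polynomial p)
  moreover obtain B where B: "\<And>z. z \<in> ball 0 1 \<Longrightarrow> cmod (p 0 z) \<le> B"
    using bounded_continuousD[OF bounded_continuous_polynomial[OF p(1)]] by blast
  have "cmod (f z) \<le> B + 1" if "z \<in> ball 0 1" for z
    using p(2)[OF that, of 0] B[OF that] norm_triangle_sub[of "f z" "p 0 z"] by simp
  ultimately show ?thesis by (rule bounded_continuousI)
qed

lemma poly_approximable_polynomial: "p \<in> analytic_polynomials \<Longrightarrow> p \<in> poly_approximable"
  unfolding poly_approximable_def by (auto intro!: bexI[of _ p])

lemma poly_approximable_mult: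
  assumes f: "f \<in> poly_approximable" and g: "g \<in> poly_approximable"
  shows "(\<lambda>z. f z * g z) \<in> poly_approximable"
  unfolding poly_approximable_def
proof (intro CollectI allI impI)
  fix e :: real assume e: "e > 0"
  obtain B where B: "B > 0" "\<And>z. z \<in> ball 0 1 \<Longrightarrow> cmod (f z) \<le> B"
    using bounded_continuousD[OF bounded_continuous_poly_approximable[OF f]] by blast
  obtain q where q: "q \<in> analytic_polynomials" "\<And>z. z \<in> ball 0 1 \<Longrightarrow> cmod (g z - q z) < e / (2 * B)"
    using g e B unfolding poly_approximable_def by (auto dest: spec[of _ "e / (2 * B)"])
  obtain C where C: "C > 0" "\<And>z. z \<in> ball 0 1 \<Longrightarrow> cmod (q z) \<le> C"
    using bounded_continuousD[OF bounded_continuous_polynomial[OF q(1)]] by blast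
  \<comment> \<open>The polynomial for \<open>f\<close> is chosen last, since its tolerance depends
    on the bound \<open>C\<close> of \<open>q\<close>.\<close>
  obtain p where p: "p \<in> analytic_polynomials" "\<And>z. z \<in> ball 0 1 \<Longrightarrow> cmod (f z - p z) < e / (2 * C)"
    using f e C unfolding poly_approximable_def by (auto dest: spec[of _ "e / (2 * C)"])
  have "cmod (f z * g z - p z * q z) < e" if z: "z \<in> ball 0 1" for z
  proof -
    have "cmod (f z * g z - p z * q z) = cmod (f z * (g z - q z) + (f z - p z) * q z)"
      by (simp add: algebra_simps)
    also have "\<dots> \<le> cmod (f z) * cmod (g z - q z) + cmod (f z - p z) * cmod (q z)"
      by (metis norm_mult norm_triangle_ineq)
    also have "cmod (f z) * cmod (g z - q z) \<le> B * cmod (g z - q z)" by (intro mult_right_mono B z) simp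
    also have "\<dots> < B * (e / (2 * B))" by (intro mult_strict_left_mono q z B)
    also have "cmod (f z - p z) * cmod (q z) \<le> cmod (f z - p z) * C" by (intro mult_left_mono C z) simp
    also have "\<dots> \<le> e / (2 * C) * C" using p(2)[OF z] C by (intro mult_right_mono) auto
    finally show ?thesis using B C by simp
  qed
  then show "\<exists>p\<in>analytic_polynomials. \<forall>z\<in>ball 0 1. cmod (f z * g z - p z) < e"
    by (intro bexI[of _ "\<lambda>z. p z * q z"] analytic_polynomials_mult p q) auto
qed

lemma poly_approximable_add:
  assumes f: "f \<in> poly_approximable" and g: "g \<in> poly_approximable"
  shows "(\<lambda>z. f z + g z) \<in> poly_approximable"
  unfolding poly_approximable_def
proof (intro CollectI allI impI)
  fix e :: real assume e: "e > 0"
  obtain p where p: "p \<in> analytic_polynomials" "\<And>z. z \<in> ball 0 1 \<Longrightarrow> cmod (f z - p z) < e / 2"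
    using f e unfolding poly_approximable_def by (auto dest: spec[of _ "e / 2"])
  obtain q where q: "q \<in> analytic_polynomials" "\<And>z. z \<in> ball 0 1 \<Longrightarrow> cmod (g z - q z) < e / 2"
    using g e unfolding poly_approximable_def by (auto dest: spec[of _ "e / 2"])
  have "cmod (f z + g z - (p z + q z)) < e" if z: "z \<in> ball 0 1" for z
    using norm_triangle_ineq[of "f z - p z" "g z - q z"] p(2)[OF z] q(2)[OF z] by (simp add: algebra_simps)
  then show "\<exists>p\<in>analytic_polynomials. \<forall>z\<in>ball 0 1. cmod (f z + g z - p z) < e"
    by (intro bexI[of _ "\<lambda>z. p z + q z"] analytic_polynomials_add p q) auto
qed

lemma poly_approximable_const: "(\<lambda>z. c) \<in> poly_approximable"
  by (intro poly_approximable_polynomial analytic_polynomials_const)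

lemma poly_approximable_sum:
  "(\<And>i. i \<in> I \<Longrightarrow> F i \<in> poly_approximable) \<Longrightarrow> (\<lambda>z. \<Sum>i\<in>I. F i z) \<in> poly_approximable"
  by (induction I rule: infinite_finite_induct) (auto intro: poly_approximable_const poly_approximable_add)

section \<open>Kernels given by power series in the inner product\<close>

lemma norm_cinner_le: "cmod (cinner z w) \<le> norm z * norm w"
proof -
  have "cmod (cinner z w) \<le> (\<Sum>i\<in>UNIV. cmod (z $ i) * cmod (w $ i))"
    unfolding cinner_def by (rule order_trans[OF norm_sum]) (simp add: norm_mult)
  also have "\<dots> \<le> norm z * norm w"
    using L2_set_mult_ineq[of "\<lambda>i. cmod (z $ i)" "\<lambda>i. cmod (w $ i)" UNIV] by (simp add: norm_vec_def)
  finally show ?thesis .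
qed

lemma cinner_in_polynomials: "(\<lambda>z. cinner z w) \<in> analytic_polynomials"
  unfolding cinner_def
  by (intro analytic_polynomials_sum analytic_polynomials_mult analytic_polynomials_coordinate analytic_polynomials_const)

lemma cinner_power_in_polynomials: "(\<lambda>z. cinner z w ^ n) \<in> analytic_polynomials"
  by (induction n) (auto intro: analytic_polynomials_const analytic_polynomials_mult cinner_in_polynomials)

text \<open>The kernel point comes first, so that \<open>power_kernel c w\<close> is a function of
  \<open>z\<close>. Two sequences \<open>c\<close> occur: the coefficients of the Bergman kernel and
  those of the kernel for the weight 1 - |z|^2.\<close>

definition power_kernel :: "(nat \<Rightarrow> real) \<Rightarrow> complex^'d \<Rightarrow> complex^'d \<Rightarrow> complex" where
  "power_kernel c w z = (\<Sum>n. of_real (c n) * cinner z w ^ n)"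

lemma power_kernel_tail:
  fixes w :: "complex^'d"
  assumes sm: "summable (\<lambda>n. \<bar>c n\<bar> * norm w ^ n)" and e: "e > 0"
  obtains N where "\<And>n z. n \<ge> N \<Longrightarrow> z \<in> ball 0 1 \<Longrightarrow>
    cmod (power_kernel c w z - (\<Sum>k<n. of_real (c k) * cinner z w ^ k)) < e"
proof -
  have "uniform_limit (ball 0 1) (\<lambda>n z. \<Sum>k<n. of_real (c k) * cinner z w ^ k) (power_kernel c w) sequentially"
    unfolding power_kernel_def[abs_def]
  proof (rule Weierstrass_m_test[OF _ sm])
    fix n and z :: "complex^'d" assume "z \<in> ball 0 1"
    then have "norm z * norm w \<le> 1 * norm w" by (intro mult_right_mono) auto
    then have "cmod (cinner z w) \<le> norm w" using norm_cinner_le[of z w] by simp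
    then have "cmod (cinner z w) ^ n \<le> norm w ^ n" by (intro power_mono) auto
    then show "cmod (of_real (c n) * cinner z w ^ n) \<le> \<bar>c n\<bar> * norm w ^ n"
      by (simp add: norm_mult norm_power mult_left_mono)
  qed
  then have "\<forall>\<^sub>F n in sequentially. \<forall>z\<in>ball 0 1. dist (\<Sum>k<n. of_real (c k) * cinner z w ^ k) (power_kernel c w z) < e"
    using e by (simp add: uniform_limit_iff)
  then obtain N where N: "\<forall>n\<ge>N. \<forall>z\<in>ball 0 1. dist (\<Sum>k<n. of_real (c k) * cinner z w ^ k) (power_kernel c w z) < e"
    unfolding eventually_sequentially by blast
  show ?thesis
  proof (rule that[of N])
    fix n and z :: "complex^'d" assume "n \<ge> N" "z \<in> ball 0 1"
    with N have "dist (\<Sum>k<n. of_real (c k) * cinner z w ^ k) (power_kernel c w z) < e" by blast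
    then show "cmod (power_kernel c w z - (\<Sum>k<n. of_real (c k) * cinner z w ^ k)) < e"
      by (simp only: dist_norm norm_minus_commute)
  qed
qed

lemma power_kernel_partial_in_polynomials:
  "(\<lambda>z. \<Sum>k<n. of_real (c k) * cinner z w ^ k) \<in> analytic_polynomials"
  by (intro analytic_polynomials_sum analytic_polynomials_scale cinner_power_in_polynomials)

lemma power_kernel_approximable:
  assumes "summable (\<lambda>n. \<bar>c n\<bar> * norm w ^ n)"
  shows "power_kernel c w \<in> poly_approximable"
  unfolding poly_approximable_def
proof (intro CollectI allI impI)
  fix e :: real assume "e > 0"
  then obtain N where "\<And>n z. n \<ge> N \<Longrightarrow> z \<in> ball 0 1 \<Longrightarrow>
    cmod (power_kernel c w z - (\<Sum>k<n. of_real (c k) * cinner z w ^ k)) < e"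
    using power_kernel_tail[OF assms] by blast
  then show "\<exists>p\<in>analytic_polynomials. \<forall>z\<in>ball 0 1. cmod (power_kernel c w z - p z) < e"
    by (intro bexI[OF _ power_kernel_partial_in_polynomials[of c w N]]) auto
qed

text \<open>The dilate is analytic on the ball of radius \<open>1 / r\<close>, which exceeds 1, so
  Taylor approximation is uniform on the unit ball.\<close>

lemma analytic_dilation_approximable:
  fixes F :: "complex^'d \<Rightarrow> complex"
  assumes F: "analytic_several_on F (ball 0 1)" and r: "0 < r" "r < 1"
  shows "(\<lambda>z. F (r *\<^sub>R z)) \<in> poly_approximable"
proof -
  have "analytic_several_on (\<lambda>z. F (r *\<^sub>R z)) (ball 0 (1 / r))"
    unfolding analytic_several_on_def
  proof
    fix z :: "complex^'d" assume "z \<in> ball 0 (1 / r)"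
    then have "r *\<^sub>R z \<in> ball 0 1" using r by (simp add: field_simps)
    then obtain D where D: "(F has_derivative D) (at (r *\<^sub>R z))" "\<And>c v. D (c *s v) = c * D v"
      using F unfolding analytic_several_on_def by blast
    have "((\<lambda>z. r *\<^sub>R z) has_derivative (\<lambda>v. r *\<^sub>R v)) (at z)"
      by (intro bounded_linear_imp_has_derivative bounded_linear_scaleR_right)
    then have "((\<lambda>z. F (r *\<^sub>R z)) has_derivative (\<lambda>v. D (r *\<^sub>R v))) (at z)"
      by (rule has_derivative_compose) (fact D)
    moreover have "D (r *\<^sub>R (c *s v)) = c * D (r *\<^sub>R v)" for c v
    proof -
      have "r *\<^sub>R (c *s v) = c *s (r *\<^sub>R v)" by (simp add: vec_eq_iff)
      then show ?thesis by (simp only: D(2))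
    qed
    ultimately show "\<exists>D. ((\<lambda>z. F (r *\<^sub>R z)) has_derivative D) (at z) \<and> (\<forall>c v. D (c *s v) = c * D v)"
      by blast
  qed
  moreover have "1 / r > 1" using r by simp
  ultimately show ?thesis
    unfolding poly_approximable_def
  proof (intro CollectI allI impI)
    fix e :: real
    assume F': "analytic_several_on (\<lambda>z. F (r *\<^sub>R z)) (ball 0 (1 / r))" "1 < 1 / r" "e > 0"
    obtain p where "p \<in> analytic_polynomials" "\<And>z. norm z \<le> 1 \<Longrightarrow> cmod (F (r *\<^sub>R z) - p z) < e"
      using analytic_uniform_approximation[OF F'] by blast
    then show "\<exists>p\<in>analytic_polynomials. \<forall>z\<in>ball 0 1. cmod (F (r *\<^sub>R z) - p z) < e"
      by (intro bexI[of _ p] ballI) simp_all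
  qed
qed

section \<open>Integration against the measure on the ball\<close>

locale weighted_ball =
  fixes \<gamma> :: real and dim :: "'d::finite itself"
  assumes dim_less: "real CARD('d) < \<gamma>"
begin

abbreviation \<nu> :: "(complex^'d) measure" where "\<nu> \<equiv> ball_prob \<gamma>"

lemma excess_pos: "(\<gamma> - real CARD('d)) > 0" using dim_less by simp

lemma \<gamma>_pos: "\<gamma> > 0" using dim_less by (meson le_less_trans of_nat_0_le_iff)

lemma space_ball_prob: "space \<nu> = ball 0 1"
  by (simp add: ball_prob_def space_restrict_space)

lemma sets_ball_prob: "sets \<nu> = sets (restrict_space borel (ball 0 1))"
  unfolding ball_prob_def by (rule sets_restrict_space_cong) simp

lemma integral_ball_prob:
  fixes f :: "complex^'d \<Rightarrow> 'b::{banach, second_countable_topology}"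
  assumes "f \<in> borel_measurable borel"
  shows "(\<integral>z. f z \<partial>\<nu>) = (\<integral>z. f z \<partial>ball_measure (\<gamma> - real CARD('d)))"
proof -
  have "(\<integral>z. f z \<partial>\<nu>) = (\<integral>z. indicator (ball 0 1) z *\<^sub>R f z \<partial>ball_measure (\<gamma> - real CARD('d)))"
    unfolding ball_prob_def by (rule integral_restrict_space) simp
  also have "\<dots> = (\<integral>z. f z \<partial>ball_measure (\<gamma> - real CARD('d)))"
    using assms AE_ball_measure[OF excess_pos]
    by (intro integral_cong_AE) (auto elim!: eventually_mono simp: indicator_def)
  finally show ?thesis .
qed

lemma prob_space_ball_prob: "prob_space \<nu>"
proof
  interpret P: prob_space "ball_measure (\<gamma> - real CARD('d)) :: (complex^'d) measure"
    by (rule prob_space_ball_measure[OF excess_pos])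
  have "emeasure \<nu> (space \<nu>) = emeasure (ball_measure (\<gamma> - real CARD('d))) (ball (0 :: complex^'d) 1)"
    unfolding space_ball_prob unfolding ball_prob_def by (subst emeasure_restrict_space) auto
  also have "\<dots> = 1"
    using AE_ball_measure[OF excess_pos, where 'a = 'd]
    by (intro P.emeasure_eq_1_AE) auto
  finally show "emeasure \<nu> (space \<nu>) = 1" .
qed

sublocale P: prob_space \<nu> by (rule prob_space_ball_prob)

lemma measurable_bounded_continuous: "f \<in> bounded_continuous \<Longrightarrow> f \<in> borel_measurable \<nu>"
  using borel_measurable_continuous_on_restrict[OF bounded_continuous_continuous]
    measurable_cong_sets[OF sets_ball_prob refl] by blast

lemma integrable_bounded_continuous:
  assumes "f \<in> bounded_continuous"
  shows "integrable \<nu> f"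
proof -
  obtain B where B: "\<And>z. z \<in> ball 0 1 \<Longrightarrow> cmod (f z) \<le> B" using bounded_continuousD[OF assms] by blast
  show ?thesis
    by (rule P.integrable_const_bound[of _ B])
      (auto intro!: AE_I2 B measurable_bounded_continuous assms simp: space_ball_prob)
qed

abbreviation wip where "wip \<equiv> weighted_ip \<gamma> :: (complex^'d \<Rightarrow> real) \<Rightarrow> _"

text \<open>The upper bound 1 makes each weighted semi-norm at most the supremum norm.\<close>

definition admissible :: "(complex^'d \<Rightarrow> real) \<Rightarrow> bool" where
  "admissible W \<longleftrightarrow> (\<lambda>z. of_real (W z)) \<in> bounded_continuous \<and> (\<forall>z\<in>ball 0 1. 0 \<le> W z \<and> W z \<le> 1)"

lemma bounded_continuous_wip:
  assumes "admissible W" "f \<in> bounded_continuous" "g \<in> bounded_continuous"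
  shows "(\<lambda>z. f z * cnj (g z) * of_real (W z)) \<in> bounded_continuous"
  using assms by (intro bounded_continuous_mult bounded_continuous_cnj) (auto simp: admissible_def)

lemma semi_inner_product_wip:
  assumes W: "admissible W"
  shows "semi_inner_product bounded_continuous (wip W)"
proof (rule semi_inner_product.intro)
  show "(\<lambda>z. 0) \<in> bounded_continuous" by (rule bounded_continuous_const)
  fix f g h :: "complex^'d \<Rightarrow> complex" and c
  assume f: "f \<in> bounded_continuous"
  show "(\<lambda>z. c * f z) \<in> bounded_continuous" by (rule bounded_continuous_scale[OF f])
  show "0 \<le> Re (wip W f f)"
  proof -
    have "wip W f f = (\<integral>z. of_real ((cmod (f z))\<^sup>2 * W z) \<partial>\<nu>)"
      unfolding weighted_ip_def by (simp only: of_real_mult complex_norm_square)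
    then have "Re (wip W f f) = (\<integral>z. (cmod (f z))\<^sup>2 * W z \<partial>\<nu>)"
      by (simp only: integral_complex_of_real Re_complex_of_real)
    also have "\<dots> \<ge> 0" using W by (intro integral_nonneg_AE AE_I2) (auto simp: space_ball_prob admissible_def)
    finally show ?thesis .
  qed
  assume h: "h \<in> bounded_continuous"
  show "wip W (\<lambda>z. c * f z) h = c * wip W f h"
    unfolding weighted_ip_def by (simp add: mult.assoc)
  show "wip W h f = cnj (wip W f h)"
    unfolding weighted_ip_def by (subst Bochner_Integration.integral_cnj[symmetric]) (simp add: mult_ac)
  show "(\<lambda>z. f z + h z) \<in> bounded_continuous" by (rule bounded_continuous_add[OF f h])
next
  note int = integrable_bounded_continuous[OF bounded_continuous_wip[OF W]]
  fix f g h :: "complex^'d \<Rightarrow> complex"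
  assume "f \<in> bounded_continuous" "g \<in> bounded_continuous" "h \<in> bounded_continuous"
  then show "wip W (\<lambda>z. f z + g z) h = wip W f h + wip W g h"
    unfolding weighted_ip_def distrib_right by (intro Bochner_Integration.integral_add int)
qed

lemma Re_wip_self: "Re (wip W f f) = (\<integral>z. (cmod (f z))\<^sup>2 * W z \<partial>\<nu>)"
proof -
  have "wip W f f = (\<integral>z. of_real ((cmod (f z))\<^sup>2 * W z) \<partial>\<nu>)"
    unfolding weighted_ip_def by (simp only: of_real_mult complex_norm_square)
  then show ?thesis by (simp only: integral_complex_of_real Re_complex_of_real)
qed

lemma integrable_norm_sq_weight:
  assumes "admissible W" "f \<in> bounded_continuous"
  shows "integrable \<nu> (\<lambda>z. (cmod (f z))\<^sup>2 * W z)"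
proof -
  have "integrable \<nu> (\<lambda>z. complex_of_real ((cmod (f z))\<^sup>2 * W z))"
    using integrable_bounded_continuous[OF bounded_continuous_wip[OF assms assms(2)]]
    by (simp only: of_real_mult complex_norm_square)
  then show ?thesis by (simp only: complex_of_real_integrable_eq)
qed

lemma Re_wip_mono:
  assumes "admissible W" "f \<in> bounded_continuous" "admissible W'" "g \<in> bounded_continuous"
    and "\<And>z. z \<in> ball 0 1 \<Longrightarrow> (cmod (f z))\<^sup>2 * W z \<le> C * ((cmod (g z))\<^sup>2 * W' z)"
  shows "Re (wip W f f) \<le> C * Re (wip W' g g)"
proof -
  have "Re (wip W f f) \<le> (\<integral>z. C * ((cmod (g z))\<^sup>2 * W' z) \<partial>\<nu>)"
    unfolding Re_wip_self
    using assms by (intro integral_mono integrable_mult_right integrable_norm_sq_weight)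
      (auto simp: space_ball_prob)
  then show ?thesis by (simp add: Re_wip_self)
qed

lemma wip_norm_le:
  assumes W: "admissible W" and f: "f \<in> bounded_continuous"
    and B: "\<And>z. z \<in> ball 0 1 \<Longrightarrow> cmod (f z) \<le> B" "B \<ge> 0"
  shows "ip_norm (wip W) f \<le> B"
proof -
  have one: "admissible (\<lambda>z. 1)" by (auto simp: admissible_def intro: bounded_continuous_const)
  have "Re (wip W f f) \<le> B\<^sup>2 * Re (wip (\<lambda>z. 1) (\<lambda>z. 1) (\<lambda>z. 1))"
  proof (rule Re_wip_mono[OF W f one bounded_continuous_const])
    fix z :: "complex^'d" assume z: "z \<in> ball 0 1"
    have "(cmod (f z))\<^sup>2 * W z \<le> B\<^sup>2 * 1"
      using W B(1)[OF z] z by (intro mult_mono power_mono) (auto simp: admissible_def)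
    then show "(cmod (f z))\<^sup>2 * W z \<le> B\<^sup>2 * ((cmod 1)\<^sup>2 * 1)" by simp
  qed
  also have "\<dots> = B\<^sup>2" using P.prob_space by (simp add: Re_wip_self)
  finally show ?thesis
    unfolding ip_norm_def using B(2) by (simp add: real_le_lsqrt)
qed

lemma norm_wip_le:
  assumes "admissible W" "f \<in> bounded_continuous" "g \<in> bounded_continuous"
    and "\<And>z. z \<in> ball 0 1 \<Longrightarrow> cmod (g z) \<le> B" "B \<ge> 0"
  shows "cmod (wip W f g) \<le> ip_norm (wip W) f * B"
proof -
  interpret semi_inner_product bounded_continuous "wip W" by (rule semi_inner_product_wip[OF assms(1)])
  have "cmod (wip W f g) \<le> ip_norm (wip W) f * ip_norm (wip W) g"
    by (rule Cauchy_Schwarz_ip[OF assms(2,3)])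
  also have "\<dots> \<le> ip_norm (wip W) f * B"
    using wip_norm_le[OF assms(1,3,4,5)] ip_norm_nonneg[OF assms(2)] by (intro mult_left_mono) auto
  finally show ?thesis .
qed

text \<open>Continuity in the supremum norm carries the vanishing from monomials through polynomials
  to their uniform limits. It replaces termwise integration of Taylor series: identities for kernel
  combinations are checked on monomials only.\<close>

lemma functional_vanishes:
  fixes \<Lambda> :: "(complex^'d \<Rightarrow> complex) \<Rightarrow> complex"
  assumes add: "\<And>f g. f \<in> bounded_continuous \<Longrightarrow> g \<in> bounded_continuous \<Longrightarrow> \<Lambda> (\<lambda>z. f z + g z) = \<Lambda> f + \<Lambda> g"
    and scale: "\<And>c f. f \<in> bounded_continuous \<Longrightarrow> \<Lambda> (\<lambda>z. c * f z) = c * \<Lambda> f"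
    and bound: "\<And>f B. f \<in> bounded_continuous \<Longrightarrow> (\<And>z. z \<in> ball 0 1 \<Longrightarrow> cmod (f z) \<le> B) \<Longrightarrow> B \<ge> 0 \<Longrightarrow> cmod (\<Lambda> f) \<le> C * B"
    and mono: "\<And>\<alpha>. \<Lambda> (monomial \<alpha>) = 0"
    and f: "f \<in> poly_approximable"
  shows "\<Lambda> f = 0"
proof -
  have bc: "monomial \<alpha> \<in> bounded_continuous" for \<alpha> :: "'d \<Rightarrow> nat"
    by (intro bounded_continuous_polynomial monomial_in_analytic_polynomials)
  have "\<Lambda> (\<lambda>z. 0 * monomial (\<lambda>_. 0) z) = 0 * \<Lambda> (monomial (\<lambda>_. 0))" by (rule scale[OF bc])
  then have zero: "\<Lambda> (\<lambda>z. 0) = 0" by simp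
  have poly: "\<Lambda> p = 0" if p: "p \<in> analytic_polynomials" for p
  proof -
    obtain A c where A: "finite A" "p = (\<lambda>z. \<Sum>\<alpha>\<in>A. c \<alpha> * monomial \<alpha> z)"
      using p unfolding analytic_polynomials_iff by blast
    have "(\<lambda>z. \<Sum>\<alpha>\<in>A. c \<alpha> * monomial \<alpha> z) \<in> bounded_continuous \<and> \<Lambda> (\<lambda>z. \<Sum>\<alpha>\<in>A. c \<alpha> * monomial \<alpha> z) = 0"
      using A(1)
    proof induction
      case (insert \<alpha> A)
      have s: "(\<lambda>z. c \<alpha> * monomial \<alpha> z) \<in> bounded_continuous" by (rule bounded_continuous_scale[OF bc])
      have i: "(\<lambda>z. \<Sum>\<alpha>\<in>A. c \<alpha> * monomial \<alpha> z) \<in> bounded_continuous" using insert.IH by blast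
      have eq: "(\<lambda>z. \<Sum>\<alpha>\<in>insert \<alpha> A. c \<alpha> * monomial \<alpha> z) =
          (\<lambda>z. c \<alpha> * monomial \<alpha> z + (\<Sum>\<alpha>\<in>A. c \<alpha> * monomial \<alpha> z))"
        using insert.hyps by simp
      show ?case
        unfolding eq add[OF s i] scale[OF bc] mono using insert.IH bounded_continuous_add[OF s i] by simp
    qed (simp add: zero bounded_continuous_const)
    then show ?thesis using A(2) by blast
  qed
  have fb: "f \<in> bounded_continuous" by (rule bounded_continuous_poly_approximable[OF f])
  have "cmod (\<Lambda> f) \<le> C * e" if e: "e > 0" for e
  proof -
    obtain p where p: "p \<in> analytic_polynomials" "\<And>z. z \<in> ball 0 1 \<Longrightarrow> cmod (f z - p z) < e"
      using f e unfolding poly_approximable_def by auto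
    note pb = bounded_continuous_polynomial[OF p(1)]
    have d: "(\<lambda>z. f z - p z) \<in> bounded_continuous" by (rule bounded_continuous_diff[OF fb pb])
    have "\<Lambda> f = \<Lambda> (\<lambda>z. (f z - p z) + p z)" by simp
    also have "\<dots> = \<Lambda> (\<lambda>z. f z - p z)" unfolding add[OF d pb] poly[OF p(1)] by simp
    also have "cmod \<dots> \<le> C * e" by (rule bound[OF d]) (use p(2) e in \<open>auto intro: less_imp_le\<close>)
    finally show ?thesis .
  qed
  then have "cmod (\<Lambda> f) \<le> C * (1 / real (Suc n))" for n by (meson of_nat_0_less_iff zero_less_Suc zero_less_divide_1_iff)
  moreover have "(\<lambda>n. C * (1 / real (Suc n))) \<longlonglongrightarrow> C * 0"
    by (intro tendsto_mult_left LIMSEQ_Suc[OF lim_1_over_n])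
  ultimately have "cmod (\<Lambda> f) \<le> C * 0" by (intro LIMSEQ_le_const) auto
  then show ?thesis by simp
qed

end

text \<open>The Taylor coefficients of \<open>1 / (1 - x) powr \<gamma>\<close>.\<close>

definition kernel_coeff :: "real \<Rightarrow> nat \<Rightarrow> real" where
  "kernel_coeff \<gamma> n = pochhammer \<gamma> n / fact n"

lemma kernel_coeff_pos: "\<gamma> > 0 \<Longrightarrow> kernel_coeff \<gamma> n > 0"
  by (simp add: kernel_coeff_def pochhammer_pos)

lemma kernel_coeff_sums:
  assumes "cmod x < 1"
  shows "(\<lambda>n. of_real (kernel_coeff \<gamma> n) * x ^ n) sums (1 / (1 - x) powr of_real \<gamma>)"
proof -
  have "(\<lambda>n. ((- of_real \<gamma>) gchoose n) * (- x) ^ n) sums (1 + (- x)) powr (- of_real \<gamma>)"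
    by (rule gen_binomial_complex) (use assms in simp)
  moreover have "((- of_real \<gamma>) gchoose n) * (- x) ^ n = of_real (kernel_coeff \<gamma> n) * x ^ n" for n
  proof -
    have "((- of_real \<gamma>) gchoose n) * (- x) ^ n =
        ((-1) ^ n * (-1) ^ n) * (pochhammer (of_real \<gamma>) n / fact n * x ^ n)"
      by (simp add: gbinomial_pochhammer power_minus[of x])
    also have "(-1) ^ n * (-1) ^ n = (1 :: complex)" by (simp flip: power_mult_distrib)
    finally show ?thesis by (simp add: kernel_coeff_def pochhammer_of_real)
  qed
  ultimately show ?thesis by (simp add: powr_minus_divide)
qed

text \<open>The coefficients are positive, so convergence of the complex series at the real point
  \<open>r\<close> is already absolute.\<close>

lemma summable_kernel_coeff:
  assumes "\<gamma> > 0" "0 \<le> r" "r < 1"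
  shows "summable (\<lambda>n. \<bar>kernel_coeff \<gamma> n\<bar> * r ^ n)"
proof -
  have "summable (\<lambda>n. of_real (kernel_coeff \<gamma> n) * (of_real r) ^ n :: complex)"
    using kernel_coeff_sums[of "of_real r" \<gamma>] assms by (auto simp: sums_iff)
  then have "summable (\<lambda>n. complex_of_real (kernel_coeff \<gamma> n * r ^ n))" by simp
  then have "summable (\<lambda>n. kernel_coeff \<gamma> n * r ^ n)" by (simp only: summable_complex_of_real)
  then show ?thesis using kernel_coeff_pos[OF assms(1)] by (simp add: less_imp_le)
qed

lemma power_kernel_kernel_coeff:
  assumes "z \<in> ball 0 1" "w \<in> ball 0 1"
  shows "power_kernel (kernel_coeff \<gamma>) w z = 1 / (1 - cinner z w) powr of_real \<gamma>"
proof -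
  have "cmod (cinner z w) \<le> norm z * norm w" by (rule norm_cinner_le)
  also have "\<dots> < 1"
    using assms by (metis mem_ball_0 mult_strict_mono' norm_ge_zero mult_1)
  finally show ?thesis
    using kernel_coeff_sums[of "cinner z w" \<gamma>] by (simp add: power_kernel_def sums_iff)
qed

section \<open>Multi-indices and elementary bounds for monomials\<close>

lemma total_degree_upd: "total_degree (\<alpha>(i := Suc (\<alpha> i))) = Suc (total_degree \<alpha>)"
proof -
  have "total_degree (\<alpha>(i := Suc (\<alpha> i))) = (\<Sum>j\<in>UNIV. \<alpha> j + (if j = i then 1 else 0))"
    unfolding total_degree_def by (intro sum.cong refl) auto
  then show ?thesis by (simp add: sum.distrib total_degree_def)
qed

lemma monomial_upd: "monomial (\<alpha>(i := Suc (\<alpha> i))) z = z $ i * monomial \<alpha> z"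
proof -
  have "monomial (\<alpha>(i := Suc (\<alpha> i))) z = (\<Prod>j\<in>UNIV. (z $ j) ^ \<alpha> j * (if j = i then z $ i else 1))"
    unfolding monomial_def by (intro prod.cong refl) auto
  then show ?thesis by (simp add: prod.distrib monomial_def)
qed

lemma norm_monomial_le:
  assumes "norm z \<le> 1"
  shows "cmod (monomial \<alpha> z) \<le> 1"
proof -
  have "cmod (z $ i) \<le> 1" for i using Finite_Cartesian_Product.norm_nth_le[of z i] assms by simp
  then show ?thesis by (simp add: monomial_def prod_norm[symmetric] norm_power power_le_one prod_le_1)
qed

lemma norm_sq_vec: "(norm z)\<^sup>2 = (\<Sum>i\<in>UNIV. (cmod (z $ i))\<^sup>2)" for z :: "complex^'d"
  by (simp add: norm_vec_def L2_set_def sum_nonneg)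

section \<open>Monomials under radial weights\<close>

context weighted_ball
begin

abbreviation one_weight :: "complex^'d \<Rightarrow> real" where "one_weight \<equiv> \<lambda>z. 1"

text \<open>For \<open>k = 2\<close> this is the weight that the Schwarz-Pick bound provides; the
  exponents \<open>2 * j\<close> lead from it towards the constant weight 1.\<close>

abbreviation defect :: "nat \<Rightarrow> complex^'d \<Rightarrow> real" where "defect k \<equiv> \<lambda>z. 1 - norm z ^ k"

lemma admissible_one: "admissible one_weight"
  by (auto simp: admissible_def intro: bounded_continuous_const)

lemma admissible_norm_power: "admissible (\<lambda>z. norm z ^ k)"
  using bounded_continuous_norm_power by (auto simp: admissible_def intro!: power_le_one)

lemma admissible_defect: "admissible (defect k)"
proof -
  have "(\<lambda>z :: complex^'d. 1 - complex_of_real (norm z ^ k)) \<in> bounded_continuous"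
    by (intro bounded_continuous_diff bounded_continuous_const bounded_continuous_norm_power)
  then show ?thesis by (auto simp: admissible_def intro!: power_le_one)
qed

lemma wip_defect:
  assumes "f \<in> bounded_continuous" "g \<in> bounded_continuous"
  shows "wip (defect k) f g = wip one_weight f g - wip (\<lambda>z. norm z ^ k) f g"
proof -
  have "wip (defect k) f g = (\<integral>z. f z * cnj (g z) * of_real 1 - f z * cnj (g z) * of_real (norm z ^ k) \<partial>\<nu>)"
    unfolding weighted_ip_def by (intro Bochner_Integration.integral_cong refl) (simp add: right_diff_distrib)
  also have "\<dots> = wip one_weight f g - wip (\<lambda>z. norm z ^ k) f g"
    unfolding weighted_ip_def
    by (intro Bochner_Integration.integral_diff integrable_bounded_continuous bounded_continuous_wip assms
        admissible_one admissible_norm_power)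
  finally show ?thesis .
qed

lemma bounded_continuous_monomial: "monomial \<alpha> \<in> bounded_continuous"
  by (intro bounded_continuous_polynomial monomial_in_analytic_polynomials)

text \<open>The squared norm of a monomial in the Bergman space of exponent
  \<open>\<gamma>\<close>.\<close>

definition moment :: "('d \<Rightarrow> nat) \<Rightarrow> real" where
  "moment \<alpha> = (\<Prod>i\<in>UNIV. fact (\<alpha> i)) / pochhammer \<gamma> (total_degree \<alpha>)"

lemma moment_pos: "moment \<alpha> > 0"
  using \<gamma>_pos by (auto simp: moment_def pochhammer_pos intro!: divide_pos_pos prod_pos)

lemma wip_monomial_orthogonal:
  assumes "\<alpha> \<noteq> \<beta>"
  shows "wip (\<lambda>z. norm z ^ k) (monomial \<alpha>) (monomial \<beta>) = 0"
proof -
  have m: "(\<lambda>z :: complex^'d. monomial \<alpha> z * cnj (monomial \<beta> z) * of_real (norm z ^ k)) \<in> borel_measurable borel"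
    by (intro borel_measurable_continuous_onI continuous_intros)
  show ?thesis
    unfolding weighted_ip_def integral_ball_prob[OF m]
    by (rule integral_monomial_orthogonal[OF excess_pos assms])
qed

lemma wip_one_monomial: "wip one_weight (monomial \<alpha>) (monomial \<beta>) = (if \<alpha> = \<beta> then of_real (moment \<alpha>) else 0)"
proof (cases "\<alpha> = \<beta>")
  case True
  have m: "(\<lambda>z :: complex^'d. (cmod (monomial \<alpha> z))\<^sup>2) \<in> borel_measurable borel"
    by (intro borel_measurable_continuous_onI continuous_intros)
  have "wip one_weight (monomial \<alpha>) (monomial \<alpha>) = (\<integral>z. of_real ((cmod (monomial \<alpha> z))\<^sup>2) \<partial>\<nu>)"
    unfolding weighted_ip_def by (simp only: complex_norm_square of_real_1 mult_1_right)
  also have "\<dots> = of_real (\<integral>z. (cmod (monomial \<alpha> z))\<^sup>2 \<partial>\<nu>)" by (rule integral_complex_of_real)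
  also have "(\<integral>z. (cmod (monomial \<alpha> z))\<^sup>2 \<partial>\<nu>) = moment \<alpha>"
    unfolding integral_ball_prob[OF m] integral_norm_monomial_sq[OF excess_pos] by (simp add: moment_def)
  finally show ?thesis using True by simp
next
  case False
  then show ?thesis using wip_monomial_orthogonal[of \<alpha> \<beta> 0] by simp
qed

lemma moment_upd: "moment (\<alpha>(i := Suc (\<alpha> i))) = moment \<alpha> * real (Suc (\<alpha> i)) / (\<gamma> + real (total_degree \<alpha>))"
proof -
  have "(\<Prod>j\<in>UNIV. fact ((\<alpha>(i := Suc (\<alpha> i))) j) :: real) = (\<Prod>j\<in>UNIV. fact (\<alpha> j) * (if j = i then real (Suc (\<alpha> i)) else 1))"
    by (intro prod.cong refl) auto
  then have "(\<Prod>j\<in>UNIV. fact ((\<alpha>(i := Suc (\<alpha> i))) j) :: real) = (\<Prod>j\<in>UNIV. fact (\<alpha> j)) * real (Suc (\<alpha> i))"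
    by (simp add: prod.distrib)
  then show ?thesis unfolding moment_def total_degree_upd by (simp add: pochhammer_Suc)
qed

text \<open>Expanding |z|^2 over the coordinates turns the integrand into the sum of the squared
  moduli of the monomials with one exponent raised, to which \<open>moment_upd\<close>
  applies.\<close>

lemma wip_norm_sq_monomial:
  "wip (\<lambda>z. norm z ^ 2) (monomial \<alpha>) (monomial \<alpha>) =
    of_real (moment \<alpha> * (real CARD('d) + real (total_degree \<alpha>)) / (\<gamma> + real (total_degree \<alpha>)))"
proof -
  have "wip (\<lambda>z. norm z ^ 2) (monomial \<alpha>) (monomial \<alpha>) =
      (\<integral>z. (\<Sum>i\<in>UNIV. monomial (\<alpha>(i := Suc (\<alpha> i))) z * cnj (monomial (\<alpha>(i := Suc (\<alpha> i))) z) * of_real 1) \<partial>\<nu>)"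
    unfolding weighted_ip_def
  proof (intro Bochner_Integration.integral_cong refl)
    fix z :: "complex^'d"
    have "complex_of_real (norm z ^ 2) = (\<Sum>i\<in>UNIV. z $ i * cnj (z $ i))"
      by (simp only: norm_sq_vec of_real_sum complex_norm_square)
    then show "monomial \<alpha> z * cnj (monomial \<alpha> z) * of_real (norm z ^ 2) =
      (\<Sum>i\<in>UNIV. monomial (\<alpha>(i := Suc (\<alpha> i))) z * cnj (monomial (\<alpha>(i := Suc (\<alpha> i))) z) * of_real 1)"
      by (simp add: monomial_upd sum_distrib_left mult_ac)
  qed
  also have "\<dots> = (\<Sum>i\<in>UNIV. wip one_weight (monomial (\<alpha>(i := Suc (\<alpha> i)))) (monomial (\<alpha>(i := Suc (\<alpha> i)))))"
    unfolding weighted_ip_def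
    by (intro Bochner_Integration.integral_sum integrable_bounded_continuous bounded_continuous_wip
        bounded_continuous_monomial admissible_one)
  also have "\<dots> = (\<Sum>i\<in>UNIV. of_real (moment \<alpha> * real (Suc (\<alpha> i)) / (\<gamma> + real (total_degree \<alpha>))))"
    by (simp only: wip_one_monomial if_True moment_upd simp_thms)
  also have "\<dots> = of_real (moment \<alpha> * (\<Sum>i\<in>UNIV. real (Suc (\<alpha> i))) / (\<gamma> + real (total_degree \<alpha>)))"
    by (simp only: of_real_sum[symmetric] sum_distrib_left sum_divide_distrib)
  also have "(\<Sum>i\<in>UNIV. real (Suc (\<alpha> i))) = real CARD('d) + real (total_degree \<alpha>)"
    by (simp add: sum.distrib total_degree_def)
  finally show ?thesis .
qed

text \<open>The factor by which the weight 1 - |z|^2 shrinks the squared norm of a monomial of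
  degree \<open>n\<close>. It depends on the degree alone, and its positivity is where
  \<open>\<gamma>\<close> must exceed the dimension.\<close>

definition defect_ratio :: "nat \<Rightarrow> real" where
  "defect_ratio n = (\<gamma> - real CARD('d)) / (\<gamma> + real n)"

lemma defect_ratio_pos: "defect_ratio n > 0"
  using excess_pos \<gamma>_pos by (simp add: defect_ratio_def add_pos_nonneg)

lemma wip_defect_monomial_orthogonal:
  "\<alpha> \<noteq> \<beta> \<Longrightarrow> wip (defect k) (monomial \<alpha>) (monomial \<beta>) = 0"
  by (simp add: wip_defect bounded_continuous_monomial wip_monomial_orthogonal wip_one_monomial)

lemma wip_defect_2_monomial:
  "wip (defect 2) (monomial \<alpha>) (monomial \<alpha>) = of_real (defect_ratio (total_degree \<alpha>) * moment \<alpha>)"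
proof -
  have "wip (defect 2) (monomial \<alpha>) (monomial \<alpha>) =
      of_real (moment \<alpha> - moment \<alpha> * (real CARD('d) + real (total_degree \<alpha>)) / (\<gamma> + real (total_degree \<alpha>)))"
    using wip_norm_sq_monomial[of \<alpha>]
    by (simp only: wip_defect bounded_continuous_monomial wip_one_monomial if_True of_real_diff simp_thms)
  moreover have "\<gamma> + real (total_degree \<alpha>) > 0" using \<gamma>_pos by (simp add: add_pos_nonneg)
  then have "moment \<alpha> - moment \<alpha> * (real CARD('d) + real (total_degree \<alpha>)) / (\<gamma> + real (total_degree \<alpha>)) =
      defect_ratio (total_degree \<alpha>) * moment \<alpha>"
    by (simp add: defect_ratio_def field_simps)
  ultimately show ?thesis by simp
qed

text \<open>Under a weight that keeps monomials orthogonal, pairing with one of them extracts a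
  Taylor coefficient of \<open>f\<close> times the diagonal entry. Two such weights therefore give
  proportional functionals.\<close>

lemma wip_monomial_proportional:
  assumes W: "admissible W" "admissible W'"
    and orth: "\<And>\<beta>. \<beta> \<noteq> \<alpha> \<Longrightarrow> wip W (monomial \<beta>) (monomial \<alpha>) = 0"
      "\<And>\<beta>. \<beta> \<noteq> \<alpha> \<Longrightarrow> wip W' (monomial \<beta>) (monomial \<alpha>) = 0"
    and diag: "wip W (monomial \<alpha>) (monomial \<alpha>) = of_real c * wip W' (monomial \<alpha>) (monomial \<alpha>)"
    and f: "f \<in> poly_approximable"
  shows "wip W f (monomial \<alpha>) = of_real c * wip W' f (monomial \<alpha>)"
proof -
  interpret A: semi_inner_product bounded_continuous "wip W" by (rule semi_inner_product_wip[OF W(1)])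
  interpret B: semi_inner_product bounded_continuous "wip W'" by (rule semi_inner_product_wip[OF W(2)])
  note m = bounded_continuous_monomial[of \<alpha>]
  have "wip W f (monomial \<alpha>) - of_real c * wip W' f (monomial \<alpha>) = 0"
  proof (rule functional_vanishes[where \<Lambda> = "\<lambda>f. wip W f (monomial \<alpha>) - of_real c * wip W' f (monomial \<alpha>)"
        and C = "1 + \<bar>c\<bar>", OF _ _ _ _ f])
    fix f g :: "complex^'d \<Rightarrow> complex" assume "f \<in> bounded_continuous" "g \<in> bounded_continuous"
    then show "wip W (\<lambda>z. f z + g z) (monomial \<alpha>) - of_real c * wip W' (\<lambda>z. f z + g z) (monomial \<alpha>) =
      wip W f (monomial \<alpha>) - of_real c * wip W' f (monomial \<alpha>) +
      (wip W g (monomial \<alpha>) - of_real c * wip W' g (monomial \<alpha>))"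
      by (simp add: A.ip_add B.ip_add m algebra_simps)
  next
    fix a and f :: "complex^'d \<Rightarrow> complex" assume "f \<in> bounded_continuous"
    then show "wip W (\<lambda>z. a * f z) (monomial \<alpha>) - of_real c * wip W' (\<lambda>z. a * f z) (monomial \<alpha>) =
      a * (wip W f (monomial \<alpha>) - of_real c * wip W' f (monomial \<alpha>))"
      by (simp add: A.ip_scale B.ip_scale m algebra_simps)
  next
    fix f :: "complex^'d \<Rightarrow> complex" and B
    assume f: "f \<in> bounded_continuous" and B: "\<And>z. z \<in> ball 0 1 \<Longrightarrow> cmod (f z) \<le> B" "B \<ge> 0"
    have m1: "cmod (monomial \<alpha> z) \<le> 1" if "z \<in> ball 0 1" for z :: "complex^'d"
      using that by (intro norm_monomial_le) simp
    have 1: "cmod (wip W f (monomial \<alpha>)) \<le> B"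
      using norm_wip_le[OF W(1) f m m1] wip_norm_le[OF W(1) f B] by simp
    have "cmod (wip W' f (monomial \<alpha>)) \<le> B"
      using norm_wip_le[OF W(2) f m m1] wip_norm_le[OF W(2) f B] by simp
    then have 2: "cmod (of_real c * wip W' f (monomial \<alpha>)) \<le> \<bar>c\<bar> * B"
      by (simp add: norm_mult mult_left_mono)
    show "cmod (wip W f (monomial \<alpha>) - of_real c * wip W' f (monomial \<alpha>)) \<le> (1 + \<bar>c\<bar>) * B"
      using norm_triangle_ineq4[of "wip W f (monomial \<alpha>)" "of_real c * wip W' f (monomial \<alpha>)"] 1 2
      by (simp add: algebra_simps)
  next
    fix \<beta>
    show "wip W (monomial \<beta>) (monomial \<alpha>) - of_real c * wip W' (monomial \<beta>) (monomial \<alpha>) = 0"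
      using orth diag by (cases "\<beta> = \<alpha>") auto
  qed
  then show ?thesis by simp
qed

lemma wip_defect_2_eq:
  assumes "f \<in> poly_approximable"
  shows "wip (defect 2) f (monomial \<alpha>) = of_real (defect_ratio (total_degree \<alpha>)) * wip one_weight f (monomial \<alpha>)"
  by (rule wip_monomial_proportional[OF admissible_defect admissible_one _ _ _ assms])
    (simp_all add: wip_defect_monomial_orthogonal wip_one_monomial wip_defect_2_monomial)

text \<open>Both pairings are the same Taylor coefficient times the weighted squared norm of the
  monomial, and the weight with exponent 2 is the smaller one. This allows the weight to be
  exchanged before an estimate.\<close>

lemma norm_wip_defect_2_le:
  assumes "f \<in> poly_approximable" and "j \<ge> 1"
  shows "cmod (wip (defect 2) f (monomial \<alpha>)) \<le> cmod (wip (defect (2 * j)) f (monomial \<alpha>))"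
proof -
  interpret A: semi_inner_product bounded_continuous "wip (defect 2)" by (rule semi_inner_product_wip[OF admissible_defect])
  interpret B: semi_inner_product bounded_continuous "wip (defect (2 * j))" by (rule semi_inner_product_wip[OF admissible_defect])
  note m = bounded_continuous_monomial[of \<alpha>]
  define a where "a = Re (wip (defect 2) (monomial \<alpha>) (monomial \<alpha>))"
  define b where "b = Re (wip (defect (2 * j)) (monomial \<alpha>) (monomial \<alpha>))"
  have a: "wip (defect 2) (monomial \<alpha>) (monomial \<alpha>) = of_real a" "a > 0"
    using A.ip_self[OF m] wip_defect_2_monomial[of \<alpha>] defect_ratio_pos moment_pos by (simp_all add: a_def)
  have b: "wip (defect (2 * j)) (monomial \<alpha>) (monomial \<alpha>) = of_real b"
    using B.ip_self[OF m] by (simp add: b_def)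
  have "a \<le> 1 * b"
    unfolding a_def b_def
  proof (rule Re_wip_mono[OF admissible_defect m admissible_defect m])
    fix z :: "complex^'d" assume z: "z \<in> ball 0 1"
    have "norm z ^ (2 * j) \<le> norm z ^ 2" using z assms(2) by (intro power_decreasing) auto
    then show "(cmod (monomial \<alpha> z))\<^sup>2 * (1 - norm z ^ 2) \<le> 1 * ((cmod (monomial \<alpha> z))\<^sup>2 * (1 - norm z ^ (2 * j)))"
      by (simp add: mult_left_mono)
  qed
  then have ab: "a \<le> b" by simp
  have "wip (defect 2) f (monomial \<alpha>) = of_real (a / b) * wip (defect (2 * j)) f (monomial \<alpha>)"
  proof (rule wip_monomial_proportional[OF admissible_defect admissible_defect _ _ _ assms(1)])
    show "wip (defect 2) (monomial \<alpha>) (monomial \<alpha>) = of_real (a / b) * wip (defect (2 * j)) (monomial \<alpha>) (monomial \<alpha>)"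
      unfolding a(1) b using a(2) ab by simp
  qed (simp_all add: wip_defect_monomial_orthogonal)
  then have "cmod (wip (defect 2) f (monomial \<alpha>)) = \<bar>a / b\<bar> * cmod (wip (defect (2 * j)) f (monomial \<alpha>))"
    by (simp only: norm_mult norm_of_real)
  also have "\<dots> \<le> 1 * cmod (wip (defect (2 * j)) f (monomial \<alpha>))"
    using a(2) ab by (intro mult_right_mono) auto
  finally show ?thesis by simp
qed

section \<open>Reproducing kernels for the two weights\<close>

lemma bounded_continuous_cinner_power: "(\<lambda>z. cinner z w ^ n) \<in> bounded_continuous"
  by (intro bounded_continuous_polynomial cinner_power_in_polynomials)

text \<open>A multinomial expansion by induction: one factor \<open>cinner z w\<close> is peeled off
  and raises one exponent of \<open>\<beta>\<close>, which is why a general \<open>\<beta>\<close>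
  is carried. The factors \<open>\<alpha> i - \<beta> i\<close> add up to \<open>n + 1\<close> and
  turn \<open>fact n\<close> into \<open>fact (Suc n)\<close>.\<close>

lemma wip_monomial_cinner_power_aux:
  "wip one_weight (monomial \<alpha>) (\<lambda>z. monomial \<beta> z * cinner z w ^ n) =
    (if (\<forall>i. \<beta> i \<le> \<alpha> i) \<and> total_degree \<alpha> = total_degree \<beta> + n
     then of_real (moment \<alpha> * fact n / (\<Prod>i\<in>UNIV. fact (\<alpha> i - \<beta> i))) * monomial (\<lambda>i. \<alpha> i - \<beta> i) w else 0)"
proof (induction n arbitrary: \<beta>)
  case 0
  have "(\<forall>i. \<beta> i \<le> \<alpha> i) \<and> total_degree \<alpha> = total_degree \<beta> + 0 \<longleftrightarrow> \<alpha> = \<beta>"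
  proof
    assume h: "(\<forall>i. \<beta> i \<le> \<alpha> i) \<and> total_degree \<alpha> = total_degree \<beta> + 0"
    have "(\<Sum>i\<in>UNIV. \<alpha> i - \<beta> i) = 0"
      using h by (simp add: sum_subtractf_nat total_degree_def)
    then have "\<alpha> i - \<beta> i = 0" for i by simp
    then show "\<alpha> = \<beta>" using h by (intro ext le_antisym) auto
  qed auto
  then show ?case by (auto simp: wip_one_monomial monomial_zero)
next
  case (Suc n)
  interpret A: semi_inner_product bounded_continuous "wip one_weight" by (rule semi_inner_product_wip[OF admissible_one])
  note m = bounded_continuous_monomial
  let ?u = "\<lambda>i. \<beta>(i := Suc (\<beta> i))"
  have bc: "(\<lambda>z. monomial \<beta>' z * cinner z w ^ n) \<in> bounded_continuous" for \<beta>' :: "'d \<Rightarrow> nat"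
    by (intro bounded_continuous_mult m bounded_continuous_cinner_power)
  have "(\<lambda>z. monomial \<beta> z * cinner z w ^ Suc n) =
      (\<lambda>z. \<Sum>i\<in>UNIV. cnj (w $ i) * (monomial (?u i) z * cinner z w ^ n))"
    by (simp add: fun_eq_iff monomial_upd cinner_def[of _ w] sum_distrib_left sum_distrib_right mult_ac)
  then have "wip one_weight (monomial \<alpha>) (\<lambda>z. monomial \<beta> z * cinner z w ^ Suc n) =
      cnj (wip one_weight (\<lambda>z. \<Sum>i\<in>UNIV. cnj (w $ i) * (monomial (?u i) z * cinner z w ^ n)) (monomial \<alpha>))"
    using A.ip_cnj[OF A.sum_mem[of UNIV "\<lambda>i z. cnj (w $ i) * (monomial (?u i) z * cinner z w ^ n)"] m[of \<alpha>]] bc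
    by (simp add: bounded_continuous_scale)
  also have "\<dots> = (\<Sum>i\<in>UNIV. w $ i * wip one_weight (monomial \<alpha>) (\<lambda>z. monomial (?u i) z * cinner z w ^ n))"
    using A.ip_cnj[OF bc m[of \<alpha>]]
    by (simp add: A.ip_sum A.ip_scale bc m bounded_continuous_scale)
  also have "\<dots> = (\<Sum>i\<in>UNIV. if (\<forall>j. \<beta> j \<le> \<alpha> j) \<and> total_degree \<alpha> = total_degree \<beta> + Suc n
      then of_real (real (\<alpha> i - \<beta> i)) * (of_real (moment \<alpha> * fact n / (\<Prod>i\<in>UNIV. fact (\<alpha> i - \<beta> i))) * monomial (\<lambda>i. \<alpha> i - \<beta> i) w) else 0)"
  proof (intro sum.cong refl)
    fix i
    show "w $ i * wip one_weight (monomial \<alpha>) (\<lambda>z. monomial (?u i) z * cinner z w ^ n) =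
      (if (\<forall>j. \<beta> j \<le> \<alpha> j) \<and> total_degree \<alpha> = total_degree \<beta> + Suc n
      then of_real (real (\<alpha> i - \<beta> i)) * (of_real (moment \<alpha> * fact n / (\<Prod>i\<in>UNIV. fact (\<alpha> i - \<beta> i))) * monomial (\<lambda>i. \<alpha> i - \<beta> i) w) else 0)"
    proof (cases "(\<forall>j. \<beta> j \<le> \<alpha> j) \<and> total_degree \<alpha> = total_degree \<beta> + Suc n \<and> \<beta> i < \<alpha> i")
      case True
      then have le: "\<forall>j. ?u i j \<le> \<alpha> j" by auto
      define \<delta> where "\<delta> = (\<lambda>j. \<alpha> j - ?u i j)"
      have upd: "(\<lambda>j. \<alpha> j - \<beta> j) = \<delta>(i := Suc (\<delta> i))" using True by (auto simp: \<delta>_def fun_eq_iff)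
      have "(\<Prod>j\<in>UNIV. fact ((\<delta>(i := Suc (\<delta> i))) j) :: real) = (\<Prod>j\<in>UNIV. fact (\<delta> j) * (if j = i then real (Suc (\<delta> i)) else 1))"
        by (intro prod.cong refl) auto
      then have pf: "(\<Prod>j\<in>UNIV. fact (\<alpha> j - \<beta> j) :: real) = (\<Prod>j\<in>UNIV. fact (\<delta> j)) * real (Suc (\<delta> i))"
        using upd by (simp add: prod.distrib fun_eq_iff)
      have d: "\<alpha> i - \<beta> i = Suc (\<delta> i)" using upd by (simp add: fun_eq_iff)
      have fp: "(\<Prod>j\<in>UNIV. fact (\<delta> j) :: real) > 0" by (intro prod_pos) simp
      have "w $ i * wip one_weight (monomial \<alpha>) (\<lambda>z. monomial (?u i) z * cinner z w ^ n) =
          w $ i * (of_real (moment \<alpha> * fact n / (\<Prod>j\<in>UNIV. fact (\<delta> j))) * monomial \<delta> w)"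
        unfolding Suc.IH using True le by (simp add: total_degree_upd \<delta>_def)
      also have "\<dots> = of_real (moment \<alpha> * fact n / (\<Prod>j\<in>UNIV. fact (\<delta> j))) * monomial (\<lambda>j. \<alpha> j - \<beta> j) w"
        unfolding upd monomial_upd by simp
      also have "moment \<alpha> * fact n / (\<Prod>j\<in>UNIV. fact (\<delta> j)) =
          real (\<alpha> i - \<beta> i) * (moment \<alpha> * fact n / (\<Prod>i\<in>UNIV. fact (\<alpha> i - \<beta> i)))"
        unfolding pf d using fp by simp
      finally show ?thesis
        unfolding if_P[OF conjI[OF conjunct1[OF True] conjunct1[OF conjunct2[OF True]]]]
        by (simp only: of_real_mult mult.assoc)
    next
      case False
      show ?thesis
      proof (cases "(\<forall>j. \<beta> j \<le> \<alpha> j) \<and> total_degree \<alpha> = total_degree \<beta> + Suc n")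
        case True
        then have eq: "\<alpha> i = \<beta> i" using False by (simp add: le_antisym not_less)
        then have "\<not> ?u i i \<le> \<alpha> i" by simp
        then have "\<not> ((\<forall>j. ?u i j \<le> \<alpha> j) \<and> total_degree \<alpha> = total_degree (?u i) + n)" by blast
        then show ?thesis unfolding Suc.IH if_P[OF True] using eq by (simp only: if_False) simp
      next
        case F: False
        have "\<not> ((\<forall>j. ?u i j \<le> \<alpha> j) \<and> total_degree \<alpha> = total_degree (?u i) + n)"
        proof
          assume h: "(\<forall>j. ?u i j \<le> \<alpha> j) \<and> total_degree \<alpha> = total_degree (?u i) + n"
          then have "\<beta> j \<le> \<alpha> j" for j by (cases "j = i") (auto dest: spec[of _ j])
          then show False using F h by (simp add: total_degree_upd)
        qed
        then show ?thesis unfolding Suc.IH if_not_P[OF F] by (simp only: if_False) simp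
      qed
    qed
  qed
  also have "\<dots> = (if (\<forall>j. \<beta> j \<le> \<alpha> j) \<and> total_degree \<alpha> = total_degree \<beta> + Suc n
     then of_real (moment \<alpha> * fact (Suc n) / (\<Prod>i\<in>UNIV. fact (\<alpha> i - \<beta> i))) * monomial (\<lambda>i. \<alpha> i - \<beta> i) w else 0)"
  proof (cases "(\<forall>j. \<beta> j \<le> \<alpha> j) \<and> total_degree \<alpha> = total_degree \<beta> + Suc n")
    case True
    have "(\<Sum>i\<in>UNIV. \<alpha> i - \<beta> i) = Suc n"
      using True by (simp add: sum_subtractf_nat total_degree_def)
    then have s: "(\<Sum>i\<in>UNIV. complex_of_real (real (\<alpha> i - \<beta> i))) = of_real (real (Suc n))"
      by (metis of_nat_sum of_real_sum)
    have "moment \<alpha> * fact (Suc n) / (\<Prod>i\<in>UNIV. fact (\<alpha> i - \<beta> i)) =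
        real (Suc n) * (moment \<alpha> * fact n / (\<Prod>i\<in>UNIV. fact (\<alpha> i - \<beta> i)))" by simp
    then show ?thesis
      unfolding if_P[OF True] using s by (simp only: sum_distrib_right[symmetric] of_real_mult mult.assoc)
  next
    case False
    then show ?thesis by (simp only: if_False sum.neutral_const)
  qed
  finally show ?case .
qed

lemma wip_one_monomial_cinner_power:
  "wip one_weight (monomial \<alpha>) (\<lambda>z. cinner z w ^ n) * of_real (kernel_coeff \<gamma> n) =
    (if n = total_degree \<alpha> then monomial \<alpha> w else 0)"
proof -
  have fp: "(\<Prod>i\<in>UNIV. fact (\<alpha> i) :: real) > 0" by (intro prod_pos) simp
  have pp: "pochhammer \<gamma> (total_degree \<alpha>) > 0" using \<gamma>_pos by (rule pochhammer_pos)
  have "moment \<alpha> * fact (total_degree \<alpha>) / (\<Prod>i\<in>UNIV. fact (\<alpha> i)) * kernel_coeff \<gamma> (total_degree \<alpha>) = 1"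
    using fp pp by (simp add: moment_def kernel_coeff_def)
  then have "complex_of_real (moment \<alpha> * fact (total_degree \<alpha>) / (\<Prod>i\<in>UNIV. fact (\<alpha> i))) * of_real (kernel_coeff \<gamma> (total_degree \<alpha>)) = 1"
    by (simp only: of_real_mult[symmetric] of_real_1)
  moreover have "total_degree (\<lambda>_::'d. 0) = 0" by (simp add: total_degree_def)
  then have "wip one_weight (monomial \<alpha>) (\<lambda>z. cinner z w ^ n) =
      (if n = total_degree \<alpha> then of_real (moment \<alpha> * fact n / (\<Prod>i\<in>UNIV. fact (\<alpha> i))) * monomial \<alpha> w else 0)"
    using wip_monomial_cinner_power_aux[of \<alpha> "\<lambda>_. 0" w n] by (auto simp: monomial_zero)
  ultimately show ?thesis
    by (cases "n = total_degree \<alpha>")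
      (simp_all only: if_True if_False simp_thms mult.commute mult.left_commute mult_1_left mult_1_right mult_zero_left)
qed

text \<open>Coefficients of the reproducing kernel for the weight 1 - |z|^2: the division
  compensates for the shrunken norms. Up to a constant factor they are the coefficients for the
  exponent \<open>\<gamma> + 1\<close>.\<close>

definition defect_coeff :: "nat \<Rightarrow> real" where
  "defect_coeff n = kernel_coeff \<gamma> n / defect_ratio n"

lemma wip_defect_2_monomial_cinner_power:
  "wip (defect 2) (monomial \<alpha>) (\<lambda>z. cinner z w ^ n) * of_real (defect_coeff n) =
    (if n = total_degree \<alpha> then monomial \<alpha> w else 0)"
proof -
  interpret A: semi_inner_product bounded_continuous "wip one_weight" by (rule semi_inner_product_wip[OF admissible_one])
  interpret B: semi_inner_product bounded_continuous "wip (defect 2)" by (rule semi_inner_product_wip[OF admissible_defect])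
  have "wip (defect 2) (\<lambda>z. cinner z w ^ n) (monomial \<alpha>) =
      of_real (defect_ratio (total_degree \<alpha>)) * wip one_weight (\<lambda>z. cinner z w ^ n) (monomial \<alpha>)"
    by (intro wip_defect_2_eq poly_approximable_polynomial cinner_power_in_polynomials)
  then have "wip (defect 2) (monomial \<alpha>) (\<lambda>z. cinner z w ^ n) =
      of_real (defect_ratio (total_degree \<alpha>)) * wip one_weight (monomial \<alpha>) (\<lambda>z. cinner z w ^ n)"
    using A.ip_cnj[OF bounded_continuous_cinner_power bounded_continuous_monomial]
      B.ip_cnj[OF bounded_continuous_cinner_power bounded_continuous_monomial] by simp
  then show ?thesis
    using wip_one_monomial_cinner_power[of \<alpha> w n] defect_ratio_pos[of "total_degree \<alpha>"]
      kernel_coeff_pos[OF \<gamma>_pos, of n]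
    by (auto simp: defect_coeff_def split: if_splits)
qed

lemma summable_defect_coeff:
  assumes "0 \<le> r" "r < 1"
  shows "summable (\<lambda>n. \<bar>defect_coeff n\<bar> * r ^ n)"
proof -
  have "defect_coeff n = (\<gamma> / (\<gamma> - real CARD('d))) * kernel_coeff (\<gamma> + 1) n" for n
  proof -
    have "pochhammer \<gamma> n * (\<gamma> + real n) = \<gamma> * pochhammer (\<gamma> + 1) n"
      by (metis pochhammer_Suc pochhammer_rec)
    then show ?thesis by (simp add: defect_coeff_def defect_ratio_def kernel_coeff_def)
  qed
  then show ?thesis
    using summable_mult[OF summable_kernel_coeff[OF _ assms, of "\<gamma> + 1"], of "\<bar>\<gamma> / (\<gamma> - real CARD('d))\<bar>"] \<gamma>_pos
    by (simp add: abs_mult mult.assoc)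
qed

text \<open>Evaluation at \<open>w\<close> and pairing with the kernel are both continuous in the
  supremum norm, so monomials suffice; for a monomial a single term of the kernel series
  contributes.\<close>

lemma reproducing_approximable:
  assumes W: "admissible W" and w: "w \<in> ball 0 1"
    and sm: "summable (\<lambda>n. \<bar>c n\<bar> * norm w ^ n)"
    and mono: "\<And>\<alpha> n. wip W (monomial \<alpha>) (\<lambda>z. cinner z w ^ n) * of_real (c n) = (if n = total_degree \<alpha> then monomial \<alpha> w else 0)"
    and f: "f \<in> poly_approximable"
  shows "wip W f (power_kernel c w) = f w"
proof -
  interpret A: semi_inner_product bounded_continuous "wip W" by (rule semi_inner_product_wip[OF W])
  have K: "power_kernel c w \<in> bounded_continuous"
    by (intro bounded_continuous_poly_approximable power_kernel_approximable sm)
  obtain D where D: "D > 0" "\<And>z. z \<in> ball 0 1 \<Longrightarrow> cmod (power_kernel c w z) \<le> D"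
    using bounded_continuousD[OF K] by blast
  have "wip W f (power_kernel c w) - f w = 0"
  proof (rule functional_vanishes[where \<Lambda> = "\<lambda>f. wip W f (power_kernel c w) - f w" and C = "D + 1", OF _ _ _ _ f])
    fix f g :: "complex^'d \<Rightarrow> complex" assume "f \<in> bounded_continuous" "g \<in> bounded_continuous"
    then show "wip W (\<lambda>z. f z + g z) (power_kernel c w) - (f w + g w) =
      wip W f (power_kernel c w) - f w + (wip W g (power_kernel c w) - g w)"
      by (simp add: A.ip_add K)
  next
    fix a and f :: "complex^'d \<Rightarrow> complex" assume "f \<in> bounded_continuous"
    then show "wip W (\<lambda>z. a * f z) (power_kernel c w) - a * f w = a * (wip W f (power_kernel c w) - f w)"
      by (simp add: A.ip_scale K algebra_simps)
  next
    fix f :: "complex^'d \<Rightarrow> complex" and B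
    assume f: "f \<in> bounded_continuous" and B: "\<And>z. z \<in> ball 0 1 \<Longrightarrow> cmod (f z) \<le> B" "B \<ge> 0"
    have "cmod (wip W f (power_kernel c w)) \<le> ip_norm (wip W) f * D"
      by (rule norm_wip_le[OF W f K D(2)]) (use D in auto)
    also have "\<dots> \<le> B * D" using wip_norm_le[OF W f B] D by (intro mult_right_mono) auto
    finally show "cmod (wip W f (power_kernel c w) - f w) \<le> (D + 1) * B"
      using norm_triangle_ineq4[of "wip W f (power_kernel c w)" "f w"] B(1)[OF w] by (simp add: algebra_simps)
  next
    fix \<alpha>
    note m = bounded_continuous_monomial[of \<alpha>]
    have m1: "cmod (monomial \<alpha> z) \<le> 1" if "z \<in> ball 0 1" for z :: "complex^'d"
      using that by (intro norm_monomial_le) simp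
    have "cmod (wip W (monomial \<alpha>) (power_kernel c w) - monomial \<alpha> w) \<le> 0 + e" if e: "e > 0" for e
    proof -
      obtain N where N: "\<And>n z. n \<ge> N \<Longrightarrow> z \<in> ball 0 1 \<Longrightarrow>
          cmod (power_kernel c w z - (\<Sum>k<n. of_real (c k) * cinner z w ^ k)) < e"
        using power_kernel_tail[OF sm e] by blast
      \<comment> \<open>Large enough for uniform accuracy and beyond the degree of
        \<open>\<alpha>\<close>, so that the contributing term belongs to the partial sum.\<close>
      define n where "n = max N (Suc (total_degree \<alpha>))"
      define S where "S z = (\<Sum>k<n. of_real (c k) * cinner z w ^ k)" for z
      have S: "S \<in> bounded_continuous"
        unfolding S_def[abs_def] by (intro bounded_continuous_polynomial power_kernel_partial_in_polynomials)
      have "wip W S (monomial \<alpha>) = (\<Sum>k<n. of_real (c k) * wip W (\<lambda>z. cinner z w ^ k) (monomial \<alpha>))"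
        unfolding S_def[abs_def]
        by (subst A.ip_sum) (auto simp: A.ip_scale m bounded_continuous_cinner_power bounded_continuous_scale)
      then have "wip W (monomial \<alpha>) S = (\<Sum>k<n. of_real (c k) * wip W (monomial \<alpha>) (\<lambda>z. cinner z w ^ k))"
        using A.ip_cnj[OF S m] A.ip_cnj[OF bounded_continuous_cinner_power m] by simp
      also have "\<dots> = (\<Sum>k<n. if k = total_degree \<alpha> then monomial \<alpha> w else 0)"
        using mono by (intro sum.cong refl) (simp add: mult.commute)
      also have "\<dots> = monomial \<alpha> w" by (simp add: n_def)
      finally have "wip W (monomial \<alpha>) (power_kernel c w) - monomial \<alpha> w = wip W (monomial \<alpha>) (\<lambda>z. power_kernel c w z - S z)"
        by (simp add: A.ip_diff_right K S m)
      also have "cmod \<dots> \<le> ip_norm (wip W) (monomial \<alpha>) * e"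
        using N[of n] e
        by (intro norm_wip_le[OF W m A.diff_mem[OF K S]]) (auto simp: n_def S_def intro: less_imp_le)
      also have "\<dots> \<le> 1 * e" using wip_norm_le[OF W m m1] e by (intro mult_right_mono) auto
      finally show ?thesis by simp
    qed
    then show "wip W (monomial \<alpha>) (power_kernel c w) - monomial \<alpha> w = 0"
      by (metis add_0 field_le_epsilon norm_le_zero_iff)
  qed
  then show ?thesis by simp
qed

abbreviation bergman_kernel :: "complex^'d \<Rightarrow> complex^'d \<Rightarrow> complex" where
  "bergman_kernel \<equiv> power_kernel (kernel_coeff \<gamma>)"

lemma bergman_kernel_approximable: "w \<in> ball 0 1 \<Longrightarrow> bergman_kernel w \<in> poly_approximable"
  by (intro power_kernel_approximable summable_kernel_coeff \<gamma>_pos) auto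

lemma defect_kernel_approximable: "w \<in> ball 0 1 \<Longrightarrow> power_kernel defect_coeff w \<in> poly_approximable"
  by (intro power_kernel_approximable summable_defect_coeff) auto

lemma bergman_reproducing:
  assumes "w \<in> ball 0 1" "f \<in> poly_approximable"
  shows "wip one_weight f (bergman_kernel w) = f w"
  using assms
  by (intro reproducing_approximable admissible_one summable_kernel_coeff \<gamma>_pos wip_one_monomial_cinner_power) auto

lemma defect_reproducing:
  assumes "w \<in> ball 0 1" "f \<in> poly_approximable"
  shows "wip (defect 2) f (power_kernel defect_coeff w) = f w"
  using assms
  by (intro reproducing_approximable admissible_defect summable_defect_coeff wip_defect_2_monomial_cinner_power) auto

text \<open>A bounded analytic function need not be a uniform limit of polynomials, but its dilates are.\<close>

lemma bergman_reproducing_mult: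
  assumes b: "analytic_several_on b (ball 0 1)" "b \<in> bounded_continuous"
    and f: "f \<in> poly_approximable" and w: "w \<in> ball 0 1"
  shows "wip one_weight (\<lambda>z. b z * f z) (bergman_kernel w) = b w * f w"
proof -
  \<comment> \<open>The shifted index keeps the radii strictly between 0 and 1 already for
    \<open>n = 0\<close>.\<close>
  define r where "r n = 1 - 1 / real (Suc (Suc n))" for n
  have r: "0 < r n" "r n < 1" for n by (simp_all add: r_def)
  have rlim: "r \<longlonglongrightarrow> 1"
    unfolding r_def[abs_def] using LIMSEQ_Suc[OF LIMSEQ_Suc[OF lim_1_over_n]] tendsto_diff[OF tendsto_const] by fastforce
  have rz: "r n *\<^sub>R z \<in> ball 0 1" if "z \<in> ball 0 1" for n and z :: "complex^'d"
  proof -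
    have "r n * norm z \<le> 1 * norm z" using r[of n] by (intro mult_right_mono) auto
    then show ?thesis using that r[of n] by simp
  qed
  have conv: "(\<lambda>n. b (r n *\<^sub>R z)) \<longlonglongrightarrow> b z" if z: "z \<in> ball 0 1" for z
  proof -
    have "isCont b z"
      using continuous_on_interior[OF bounded_continuous_continuous[OF b(2)]] z by (simp add: interior_open)
    moreover have "(\<lambda>n. r n *\<^sub>R z) \<longlonglongrightarrow> 1 *\<^sub>R z" by (intro tendsto_intros rlim)
    ultimately show ?thesis using isCont_tendsto_compose by fastforce
  qed
  have br: "(\<lambda>z. b (r n *\<^sub>R z)) \<in> poly_approximable" for n
    by (rule analytic_dilation_approximable[OF b(1) r])
  note fb = bounded_continuous_poly_approximable[OF f]
  note kb = bounded_continuous_poly_approximable[OF bergman_kernel_approximable[OF w]]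
  obtain B where B: "B > 0" "\<And>z. z \<in> ball 0 1 \<Longrightarrow> cmod (b z) \<le> B" using bounded_continuousD[OF b(2)] by blast
  have eq: "wip one_weight (\<lambda>z. b (r n *\<^sub>R z) * f z) (bergman_kernel w) = b (r n *\<^sub>R w) * f w" for n
    by (intro bergman_reproducing w poly_approximable_mult br f)
  have "(\<lambda>n. wip one_weight (\<lambda>z. b (r n *\<^sub>R z) * f z) (bergman_kernel w)) \<longlonglongrightarrow>
      wip one_weight (\<lambda>z. b z * f z) (bergman_kernel w)"
    unfolding weighted_ip_def
  \<comment> \<open>The bound \<open>B\<close> of \<open>b\<close> on the ball dominates all dilates
    at once.\<close>
  proof (rule integral_dominated_convergence)
    show "(\<lambda>z. b z * f z * cnj (bergman_kernel w z) * of_real 1) \<in> borel_measurable \<nu>"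
      by (intro measurable_bounded_continuous bounded_continuous_wip[OF admissible_one] bounded_continuous_mult b fb kb)
    show "(\<lambda>z. b (r n *\<^sub>R z) * f z * cnj (bergman_kernel w z) * of_real 1) \<in> borel_measurable \<nu>" for n
      by (intro measurable_bounded_continuous bounded_continuous_wip[OF admissible_one] bounded_continuous_mult
          bounded_continuous_poly_approximable[OF br] fb kb)
    show "integrable \<nu> (\<lambda>z. cmod (of_real B * f z * cnj (bergman_kernel w z)))"
      by (intro integrable_norm integrable_bounded_continuous bounded_continuous_mult bounded_continuous_cnj
          bounded_continuous_const fb kb)
    show "AE z in \<nu>. (\<lambda>n. b (r n *\<^sub>R z) * f z * cnj (bergman_kernel w z) * of_real 1) \<longlonglongrightarrow>
        b z * f z * cnj (bergman_kernel w z) * of_real 1"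
      using conv by (intro AE_I2 tendsto_intros) (auto simp: space_ball_prob)
    show "AE z in \<nu>. cmod (b (r n *\<^sub>R z) * f z * cnj (bergman_kernel w z) * of_real 1) \<le>
        cmod (of_real B * f z * cnj (bergman_kernel w z))" for n
    proof (rule AE_I2)
      fix z assume "z \<in> space \<nu>"
      then have "cmod (b (r n *\<^sub>R z)) \<le> B" using rz B(2) by (simp add: space_ball_prob)
      then show "cmod (b (r n *\<^sub>R z) * f z * cnj (bergman_kernel w z) * of_real 1) \<le>
        cmod (of_real B * f z * cnj (bergman_kernel w z))"
        using B(1) by (simp add: norm_mult mult_right_mono)
    qed
  qed
  moreover have "(\<lambda>n. b (r n *\<^sub>R w) * f w) \<longlonglongrightarrow> b w * f w" by (intro tendsto_intros conv w)
  ultimately show ?thesis unfolding eq by (rule LIMSEQ_unique)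
qed

end

section \<open>The Schwarz-Pick bound\<close>

lemma Moebius_norm_identity:
  fixes a w :: complex
  shows "(cmod (1 - cnj a * w))\<^sup>2 - (cmod (w - a))\<^sup>2 = (1 - (cmod a)\<^sup>2) * (1 - (cmod w)\<^sup>2)"
  unfolding cmod_power2 by (simp add: power2_eq_square algebra_simps)

text \<open>The Schwarz lemma for the Moebius transform of \<open>\<phi>\<close> that sends
  \<open>\<phi> 0\<close> to zero, rewritten by \<open>Moebius_norm_identity\<close>. The constant
  is a lower bound for the squared modulus of the denominator.\<close>

lemma Schwarz_Pick_disc:
  fixes \<phi> :: "complex \<Rightarrow> complex"
  assumes hol: "\<phi> holomorphic_on ball 0 1" and le: "\<And>t. cmod t < 1 \<Longrightarrow> cmod (\<phi> t) \<le> 1"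
    and 0: "cmod (\<phi> 0) < 1" and t: "cmod t < 1"
  shows "(1 - cmod (\<phi> 0))\<^sup>2 * (1 - (cmod t)\<^sup>2) \<le> 1 - (cmod (\<phi> t))\<^sup>2"
proof -
  define a where "a = \<phi> 0"
  have a: "cmod a < 1" using 0 by (simp add: a_def)
  have den_ge: "1 - cmod a \<le> cmod (1 - cnj a * \<phi> t)" if "cmod t < 1" for t
  proof -
    have "cmod (cnj a * \<phi> t) \<le> cmod a * 1"
      unfolding norm_mult complex_mod_cnj using le[OF that] by (intro mult_left_mono) auto
    then show ?thesis using norm_triangle_ineq2[of 1 "cnj a * \<phi> t"] by simp
  qed
  have den: "1 - cnj a * \<phi> t \<noteq> 0" if "cmod t < 1" for t using den_ge[OF that] a by auto
  define \<psi> where "\<psi> t = (\<phi> t - a) / (1 - cnj a * \<phi> t)" for t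
  have \<psi>hol: "\<psi> holomorphic_on ball 0 1"
    unfolding \<psi>_def[abs_def] using den by (intro holomorphic_intros hol) auto
  have a2: "(cmod a)\<^sup>2 < 1" using a by (simp add: abs_square_less_1)
  have \<psi>le: "cmod (\<psi> t) \<le> 1" if "cmod t < 1" for t
  proof -
    have "(cmod (\<phi> t))\<^sup>2 \<le> 1" using le[OF that] by (simp add: abs_square_le_1)
    then have "(cmod (\<phi> t - a))\<^sup>2 \<le> (cmod (1 - cnj a * \<phi> t))\<^sup>2"
      using Moebius_norm_identity[of a "\<phi> t"] a2 mult_nonneg_nonneg[of "1 - (cmod a)\<^sup>2" "1 - (cmod (\<phi> t))\<^sup>2"]
      by linarith
    then have "cmod (\<phi> t - a) \<le> cmod (1 - cnj a * \<phi> t)" by (rule power2_le_imp_le) simp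
    then show ?thesis using den[OF that] by (simp add: \<psi>_def norm_divide divide_le_eq_1)
  qed
  \<comment> \<open>The Schwarz lemma asks for modulus strictly below 1, while \<open>\<psi>\<close>
    is only known to be at most 1; the factor \<open>s\<close> is removed by a limit.\<close>
  have scaled: "s * cmod (\<psi> t) \<le> cmod t" if s: "0 < s" "s < 1" for s
  proof -
    have "cmod (of_real s * \<psi> t) \<le> cmod t"
    proof (rule Schwarz_Lemma(1)[OF _ _ _ t])
      show "(\<lambda>t. of_real s * \<psi> t) holomorphic_on ball 0 1" by (intro holomorphic_intros \<psi>hol)
      show "of_real s * \<psi> 0 = 0" by (simp add: \<psi>_def a_def)
      show "cmod (of_real s * \<psi> z) < 1" if "cmod z < 1" for z
      proof -
        have "s * cmod (\<psi> z) \<le> s * 1" using \<psi>le[OF that] s by (intro mult_left_mono) auto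
        moreover have "cmod (of_real s * \<psi> z) = s * cmod (\<psi> z)" using s by (simp add: norm_mult)
        ultimately show ?thesis using s by linarith
      qed
    qed
    then show ?thesis using s by (simp add: norm_mult)
  qed
  have "(\<lambda>n. (1 - 1 / real (Suc (Suc n))) * cmod (\<psi> t)) \<longlonglongrightarrow> (1 - 0) * cmod (\<psi> t)"
    by (intro tendsto_intros LIMSEQ_Suc[OF LIMSEQ_Suc[OF lim_1_over_n]])
  then have "(1 - 0) * cmod (\<psi> t) \<le> cmod t"
    by (rule LIMSEQ_le_const2) (intro exI[of _ 0] allI impI scaled, auto)
  then have "cmod (\<phi> t - a) \<le> cmod t * cmod (1 - cnj a * \<phi> t)"
    using den[OF t] by (simp add: \<psi>_def norm_divide divide_le_eq)
  then have "(cmod (\<phi> t - a))\<^sup>2 \<le> (cmod t)\<^sup>2 * (cmod (1 - cnj a * \<phi> t))\<^sup>2"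
    by (metis norm_ge_zero power_mono power_mult_distrib)
  then have "(cmod (1 - cnj a * \<phi> t))\<^sup>2 * (1 - (cmod t)\<^sup>2) \<le> (1 - (cmod a)\<^sup>2) * (1 - (cmod (\<phi> t))\<^sup>2)"
    using Moebius_norm_identity[of a "\<phi> t"] by (simp add: algebra_simps)
  also have "\<dots> \<le> 1 * (1 - (cmod (\<phi> t))\<^sup>2)"
    using le[OF t] by (intro mult_right_mono) (auto simp: abs_square_le_1)
  finally have 1: "(cmod (1 - cnj a * \<phi> t))\<^sup>2 * (1 - (cmod t)\<^sup>2) \<le> 1 - (cmod (\<phi> t))\<^sup>2" by simp
  have "(1 - cmod a)\<^sup>2 * (1 - (cmod t)\<^sup>2) \<le> (cmod (1 - cnj a * \<phi> t))\<^sup>2 * (1 - (cmod t)\<^sup>2)"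
    using t a den_ge[OF t] by (intro mult_right_mono power_mono) (auto simp: abs_square_le_1)
  then show ?thesis using 1 by (simp add: a_def)
qed

section \<open>Zero extensions of polynomials as a linear space\<close>

lemma zero_ext_add: "zero_ext X (\<lambda>z. f z + g z) = (\<lambda>z. zero_ext X f z + zero_ext X g z)"
  and zero_ext_scale: "zero_ext X (\<lambda>z. c * f z) = (\<lambda>z. c * zero_ext X f z)"
  by (auto simp: zero_ext_def fun_eq_iff)

lemma zero_ext_polynomials_zero: "(\<lambda>z. 0) \<in> zero_ext X ` analytic_polynomials"
  by (rule image_eqI[OF _ analytic_polynomials_const[of 0]]) (simp add: zero_ext_def)

lemma zero_ext_polynomials_add:
  assumes "f \<in> zero_ext X ` analytic_polynomials" "g \<in> zero_ext X ` analytic_polynomials"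
  shows "(\<lambda>z. f z + g z) \<in> zero_ext X ` analytic_polynomials"
proof -
  obtain p q where "p \<in> analytic_polynomials" "q \<in> analytic_polynomials" "f = zero_ext X p" "g = zero_ext X q"
    using assms by blast
  then show ?thesis
    using imageI[OF analytic_polynomials_add[of p q], of "zero_ext X"] by (simp add: zero_ext_add)
qed

lemma zero_ext_polynomials_scale:
  assumes "f \<in> zero_ext X ` analytic_polynomials"
  shows "(\<lambda>z. c * f z) \<in> zero_ext X ` analytic_polynomials"
proof -
  obtain p where "p \<in> analytic_polynomials" "f = zero_ext X p" using assms by blast
  then show ?thesis
    using imageI[OF analytic_polynomials_scale[of p c], of "zero_ext X"] by (simp add: zero_ext_scale)
qed

section \<open>Density for exponent one\<close>

locale schur_ball = weighted_ball \<gamma> dim for \<gamma> :: real and dim :: "'d::finite itself" +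
  fixes b :: "complex^'d \<Rightarrow> complex"
  assumes b_analytic: "analytic_several_on b (ball 0 1)"
    and b_le: "z \<in> ball 0 1 \<Longrightarrow> cmod (b z) \<le> 1"
    and b_0: "cmod (b 0) < 1"
begin

abbreviation X :: "(complex^'d) set" where "X \<equiv> ball 0 1"

abbreviation L :: "complex^'d \<Rightarrow> complex^'d \<Rightarrow> complex" where "L \<equiv> Hb_kernel \<gamma> b (Suc 0)"

lemma b_bounded_continuous: "b \<in> bounded_continuous"
  by (rule bounded_continuousI[OF analytic_several_on_continuous_on[OF b_analytic] b_le])

definition b_weight :: "complex^'d \<Rightarrow> real" where "b_weight z = 1 - (cmod (b z))\<^sup>2"

lemma admissible_b_weight: "admissible b_weight"
proof -
  have "(\<lambda>z. complex_of_real (b_weight z)) = (\<lambda>z. 1 - b z * cnj (b z))"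
    by (simp only: b_weight_def of_real_diff of_real_1 complex_norm_square)
  moreover have "(\<lambda>z. 1 - b z * cnj (b z)) \<in> bounded_continuous"
    by (intro bounded_continuous_diff bounded_continuous_const bounded_continuous_mult
        bounded_continuous_cnj b_bounded_continuous)
  ultimately show ?thesis
    using b_le by (auto simp: admissible_def b_weight_def abs_square_le_1)
qed

text \<open>The Schwarz-Pick bound on the complex line through the origin and
  \<open>z\<close>.\<close>

lemma b_weight_lower:
  assumes z: "z \<in> X"
  shows "(1 - cmod (b 0))\<^sup>2 * (1 - (norm z)\<^sup>2) \<le> b_weight z"
proof (cases "z = 0")
  \<comment> \<open>The origin determines no direction, so a constant function stands in for the
    slice.\<close>
  case True
  have "(1 - cmod (b 0))\<^sup>2 * (1 - (cmod 0)\<^sup>2) \<le> 1 - (cmod (b 0))\<^sup>2"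
    by (rule Schwarz_Pick_disc[where \<phi> = "\<lambda>t. b 0" and t = 0]) (use b_0 in auto)
  then show ?thesis using True by (simp add: b_weight_def)
next
  case False
  define v where "v = (of_real (1 / norm z) :: complex) *s z"
  have v: "norm v = 1" using False by (simp add: v_def norm_scalar_mult norm_divide)
  define t where "t = complex_of_real (norm z)"
  have tv: "t *s v = z" using False by (simp add: v_def t_def vec_eq_iff)
  have "(1 - cmod (b (0 *s v)))\<^sup>2 * (1 - (cmod t)\<^sup>2) \<le> 1 - (cmod (b (t *s v)))\<^sup>2"
  proof (rule Schwarz_Pick_disc[where \<phi> = "\<lambda>t. b (t *s v)"])
    show "(\<lambda>t. b (t *s v)) holomorphic_on ball 0 1"
      using holomorphic_on_slice[OF b_analytic, of "ball 0 1" 0 v] v by (simp add: norm_scalar_mult)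
    show "cmod (b (s *s v)) \<le> 1" if "cmod s < 1" for s
      using that v by (intro b_le) (simp add: norm_scalar_mult)
  qed (use b_0 z in \<open>simp_all add: t_def\<close>)
  then show ?thesis unfolding tv by (simp add: t_def b_weight_def)
qed

definition bergman_comb :: "(complex^'d \<Rightarrow> complex) \<Rightarrow> complex^'d \<Rightarrow> complex" where
  "bergman_comb u z = (\<Sum>x | u x \<noteq> 0. u x * bergman_kernel x z)"

text \<open>The adjoint of multiplication by \<open>b\<close> sends the kernel function at
  \<open>x\<close> to \<open>cnj (b x)\<close> times itself; this is its action on
  coefficients.\<close>

definition twist :: "(complex^'d \<Rightarrow> complex) \<Rightarrow> complex^'d \<Rightarrow> complex" where
  "twist u x = u x * cnj (b x)"

text \<open>With \<open>h = bergman_comb u\<close> and \<open>P\<close> the Bergman projection, \<open>bergman_comb (twist u)\<close> is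
  \<open>P (cnj b \<cdot> h)\<close>, the image of \<open>h\<close> under the adjoint of multiplication by \<open>b\<close>.\<close>

definition co_analytic_part :: "(complex^'d \<Rightarrow> complex) \<Rightarrow> complex^'d \<Rightarrow> complex" where
  "co_analytic_part u z = cnj (b z) * bergman_comb u z - bergman_comb (twist u) z"

lemma twist_fin_support: "u \<in> fin_support X \<Longrightarrow> twist u \<in> fin_support X"
  unfolding twist_def[abs_def] by (rule fin_support_mult(1))

lemma bergman_comb_superset:
  assumes "finite A" "{x. u x \<noteq> 0} \<subseteq> A"
  shows "bergman_comb u z = (\<Sum>x\<in>A. u x * bergman_kernel x z)"
  unfolding bergman_comb_def by (rule sum_support_superset[OF assms]) simp

lemma bergman_comb_twist:
  assumes "u \<in> fin_support X"
  shows "bergman_comb (twist u) z = (\<Sum>x | u x \<noteq> 0. u x * cnj (b x) * bergman_kernel x z)"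
proof -
  have "bergman_comb (twist u) z = (\<Sum>x | u x \<noteq> 0. twist u x * bergman_kernel x z)"
    by (rule bergman_comb_superset) (use assms fin_support_finite in \<open>auto simp: twist_def\<close>)
  then show ?thesis by (simp add: twist_def)
qed

lemma bergman_comb_diff:
  assumes "u \<in> fin_support X" "v \<in> fin_support X"
  shows "bergman_comb (\<lambda>x. u x - v x) z = bergman_comb u z - bergman_comb v z"
proof -
  define A where "A = {x. u x \<noteq> 0} \<union> {x. v x \<noteq> 0}"
  have A: "finite A" using assms fin_support_finite by (auto simp: A_def)
  have "bergman_comb (\<lambda>x. u x - v x) z = (\<Sum>x\<in>A. (u x - v x) * bergman_kernel x z)"
    by (rule bergman_comb_superset[OF A]) (auto simp: A_def)
  moreover have "bergman_comb u z = (\<Sum>x\<in>A. u x * bergman_kernel x z)"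
    by (rule bergman_comb_superset[OF A]) (auto simp: A_def)
  moreover have "bergman_comb v z = (\<Sum>x\<in>A. v x * bergman_kernel x z)"
    by (rule bergman_comb_superset[OF A]) (auto simp: A_def)
  ultimately show ?thesis by (simp add: left_diff_distrib sum_subtractf)
qed

lemma twist_diff: "twist (\<lambda>x. u x - v x) = (\<lambda>x. twist u x - twist v x)"
  by (simp add: twist_def fun_eq_iff left_diff_distrib)

lemma co_analytic_part_diff:
  assumes "u \<in> fin_support X" "v \<in> fin_support X"
  shows "co_analytic_part (\<lambda>x. u x - v x) z = co_analytic_part u z - co_analytic_part v z"
  by (simp add: co_analytic_part_def twist_diff bergman_comb_diff assms twist_fin_support algebra_simps)

lemma bergman_comb_approximable:
  assumes "u \<in> fin_support X"
  shows "bergman_comb u \<in> poly_approximable"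
  unfolding bergman_comb_def[abs_def]
  by (intro poly_approximable_sum poly_approximable_mult poly_approximable_const bergman_kernel_approximable)
    (use fin_support_mem[OF assms] in auto)

lemma bounded_continuous_bergman_comb: "u \<in> fin_support X \<Longrightarrow> bergman_comb u \<in> bounded_continuous"
  by (intro bounded_continuous_poly_approximable bergman_comb_approximable)

lemma bounded_continuous_co_analytic_part: "u \<in> fin_support X \<Longrightarrow> co_analytic_part u \<in> bounded_continuous"
  unfolding co_analytic_part_def[abs_def]
  by (intro bounded_continuous_diff bounded_continuous_mult bounded_continuous_cnj b_bounded_continuous
      bounded_continuous_bergman_comb twist_fin_support)

section \<open>Orthogonal splitting and the norm identity\<close>

sublocale A: semi_inner_product bounded_continuous "wip one_weight"
  by (rule semi_inner_product_wip[OF admissible_one])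

sublocale D: semi_inner_product bounded_continuous "wip (defect 2)"
  by (rule semi_inner_product_wip[OF admissible_defect])

text \<open>Only the reproducing property of \<open>F\<close> is asked for, so that the formula also
  covers \<open>b\<close> times a member of the ball algebra, which need not be uniformly
  approximable.\<close>

lemma wip_bergman_comb:
  assumes u: "u \<in> fin_support X" and F: "F \<in> bounded_continuous"
    and rep: "\<And>w. w \<in> X \<Longrightarrow> wip one_weight F (bergman_kernel w) = F w"
  shows "wip one_weight (bergman_comb u) F = (\<Sum>x | u x \<noteq> 0. u x * cnj (F x))"
proof -
  have k: "bergman_kernel x \<in> bounded_continuous" if "u x \<noteq> 0" for x
    by (intro bounded_continuous_poly_approximable bergman_kernel_approximable fin_support_mem[OF u that])
  have "wip one_weight (bergman_comb u) F = (\<Sum>x | u x \<noteq> 0. wip one_weight (\<lambda>z. u x * bergman_kernel x z) F)"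
    unfolding bergman_comb_def[abs_def] by (intro A.ip_sum bounded_continuous_scale k F) auto
  also have "\<dots> = (\<Sum>x | u x \<noteq> 0. u x * cnj (F x))"
  proof (intro sum.cong refl)
    fix x assume "x \<in> {x. u x \<noteq> 0}"
    then have x: "u x \<noteq> 0" "x \<in> X" using fin_support_mem[OF u] by auto
    have "wip one_weight (bergman_kernel x) F = cnj (F x)"
      using A.ip_cnj[OF F k[OF x(1)]] rep[OF x(2)] by simp
    then show "wip one_weight (\<lambda>z. u x * bergman_kernel x z) F = u x * cnj (F x)"
      by (simp add: A.ip_scale[OF k[OF x(1)] F])
  qed
  finally show ?thesis .
qed

lemma wip_bergman_comb_approximable:
  assumes "u \<in> fin_support X" "f \<in> poly_approximable"
  shows "wip one_weight (bergman_comb u) f = (\<Sum>x | u x \<noteq> 0. u x * cnj (f x))"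
  by (rule wip_bergman_comb[OF assms(1) bounded_continuous_poly_approximable[OF assms(2)]
        bergman_reproducing[OF _ assms(2)]])

text \<open>Moving \<open>cnj b\<close> across the inner product gives \<open>b f\<close>, whose
  pairing with the combination is a sum of its values on the support of \<open>u\<close>. The
  factors \<open>cnj (b x)\<close> go into the coefficients, which yields the pairing of the twisted
  combination with \<open>f\<close>.\<close>

lemma co_analytic_part_orthogonal:
  assumes u: "u \<in> fin_support X" and f: "f \<in> poly_approximable"
  shows "wip one_weight (co_analytic_part u) f = 0"
proof -
  note fb = bounded_continuous_poly_approximable[OF f]
  note hb = bounded_continuous_bergman_comb[OF u]
  have cb: "(\<lambda>z. cnj (b z) * bergman_comb u z) \<in> bounded_continuous"
    by (intro bounded_continuous_mult bounded_continuous_cnj b_bounded_continuous hb)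
  have bf: "(\<lambda>z. b z * f z) \<in> bounded_continuous"
    by (intro bounded_continuous_mult b_bounded_continuous fb)
  have "wip one_weight (\<lambda>z. cnj (b z) * bergman_comb u z) f = wip one_weight (bergman_comb u) (\<lambda>z. b z * f z)"
    unfolding weighted_ip_def by (intro Bochner_Integration.integral_cong refl) (simp add: mult_ac)
  also have "\<dots> = (\<Sum>x | u x \<noteq> 0. u x * cnj (b x * f x))"
    by (rule wip_bergman_comb[OF u bf bergman_reproducing_mult[OF b_analytic b_bounded_continuous f]])
  also have "\<dots> = (\<Sum>x | u x \<noteq> 0. twist u x * cnj (f x))"
    by (intro sum.cong refl) (simp add: twist_def)
  also have "\<dots> = (\<Sum>x | twist u x \<noteq> 0. twist u x * cnj (f x))"
    by (rule sum_support_superset[symmetric]) (use u fin_support_finite in \<open>auto simp: twist_def\<close>)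
  also have "\<dots> = wip one_weight (bergman_comb (twist u)) f"
    by (rule wip_bergman_comb_approximable[OF twist_fin_support[OF u] f, symmetric])
  finally show ?thesis
    unfolding co_analytic_part_def[abs_def]
    by (simp add: A.ip_diff[OF cb bounded_continuous_bergman_comb[OF twist_fin_support[OF u]] fb])
qed

lemma kernel_eq:
  assumes "z \<in> X" "w \<in> X"
  shows "L z w = (1 - b z * cnj (b w)) * bergman_kernel w z"
  by (simp add: Hb_kernel_def power_kernel_kernel_coeff[OF assms])

lemma kernel_comb_eq_bergman:
  assumes u: "u \<in> fin_support X" and z: "z \<in> X"
  shows "kernel_comb X L u z = bergman_comb u z - b z * bergman_comb (twist u) z"
proof -
  have "kernel_comb X L u z = (\<Sum>x | u x \<noteq> 0. u x * bergman_kernel x z - b z * (u x * cnj (b x) * bergman_kernel x z))"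
    unfolding kernel_comb_def zero_ext_def using z
  proof (simp, intro sum.cong refl)
    fix x assume "x \<in> {x. u x \<noteq> 0}"
    then have "x \<in> X" using fin_support_mem[OF u] by simp
    then show "u x * L z x = u x * bergman_kernel x z - b z * (u x * cnj (b x) * bergman_kernel x z)"
      unfolding kernel_eq[OF z \<open>x \<in> X\<close>] by (simp add: algebra_simps)
  qed
  then show ?thesis by (simp only: bergman_comb_twist[OF u] bergman_comb_def[of u] sum_subtractf sum_distrib_left)
qed

lemma kernel_form_eq:
  assumes u: "u \<in> fin_support X"
  shows "kernel_form L u u = wip one_weight (bergman_comb u) (bergman_comb u)
    - wip one_weight (bergman_comb (twist u)) (bergman_comb (twist u))"
proof -
  note tu = twist_fin_support[OF u]
  have "kernel_form L u u = (\<Sum>y | u y \<noteq> 0. cnj (u y) * bergman_comb u y) - (\<Sum>y | u y \<noteq> 0. cnj (twist u y) * bergman_comb (twist u) y)"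
    unfolding kernel_form_eval[OF u u] sum_subtractf[symmetric]
  proof (intro sum.cong refl)
    fix y assume "y \<in> {y. u y \<noteq> 0}"
    then have "y \<in> X" using fin_support_mem[OF u] by simp
    then show "cnj (u y) * kernel_comb X L u y = cnj (u y) * bergman_comb u y - cnj (twist u y) * bergman_comb (twist u) y"
      unfolding kernel_comb_eq_bergman[OF u \<open>y \<in> X\<close>] by (simp add: twist_def algebra_simps)
  qed
  moreover have "(\<Sum>y | u y \<noteq> 0. cnj (twist u y) * bergman_comb (twist u) y) =
      (\<Sum>y | twist u y \<noteq> 0. cnj (twist u y) * bergman_comb (twist u) y)"
    by (rule sum_support_superset[symmetric]) (use u fin_support_finite in \<open>auto simp: twist_def\<close>)
  moreover have "(\<Sum>y | v y \<noteq> 0. cnj (v y) * bergman_comb v y) = wip one_weight (bergman_comb v) (bergman_comb v)"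
    if v: "v \<in> fin_support X" for v
  proof -
    note vb = bounded_continuous_bergman_comb[OF v]
    have "wip one_weight (bergman_comb v) (bergman_comb v) = cnj (wip one_weight (bergman_comb v) (bergman_comb v))"
      by (rule A.ip_cnj[OF vb vb])
    then show ?thesis using wip_bergman_comb_approximable[OF v bergman_comb_approximable[OF v]] by simp
  qed
  ultimately show ?thesis using u tu by simp
qed

text \<open>The square |h|^2 splits into (1 - |b|^2) |h|^2 and |cnj b h|^2, and Pythagoras for
  \<open>cnj b h = t + g\<close> splits the norm of the latter. The contribution of \<open>t\<close>
  cancels against the one subtracted in \<open>kernel_form_eq\<close>.\<close>

lemma Re_kernel_form_eq:
  assumes u: "u \<in> fin_support X"
  shows "Re (kernel_form L u u) = Re (wip b_weight (bergman_comb u) (bergman_comb u))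
    + Re (wip one_weight (co_analytic_part u) (co_analytic_part u))"
proof -
  note hb = bounded_continuous_bergman_comb[OF u]
  note ta = bergman_comb_approximable[OF twist_fin_support[OF u]]
  note tb = bounded_continuous_poly_approximable[OF ta]
  note gb = bounded_continuous_co_analytic_part[OF u]
  define h where "h = bergman_comb u"
  define t where "t = bergman_comb (twist u)"
  define g where "g = co_analytic_part u"
  have "(\<lambda>z. cnj (b z) * h z) = (\<lambda>z. t z + g z)" by (simp add: h_def t_def g_def co_analytic_part_def)
  moreover have "wip one_weight g t = 0" unfolding g_def t_def by (rule co_analytic_part_orthogonal[OF u ta])
  moreover from this have "wip one_weight t g = 0"
    using A.ip_cnj[OF gb tb] by (simp add: g_def t_def)
  ultimately have "wip one_weight (\<lambda>z. cnj (b z) * h z) (\<lambda>z. cnj (b z) * h z) = wip one_weight t t + wip one_weight g g"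
    using gb tb by (simp add: g_def t_def A.ip_add A.ip_add_right bounded_continuous_add)
  moreover have "Re (wip one_weight h h) = Re (wip b_weight h h) + Re (wip one_weight (\<lambda>z. cnj (b z) * h z) (\<lambda>z. cnj (b z) * h z))"
  proof -
    have cb: "(\<lambda>z. cnj (b z) * h z) \<in> bounded_continuous"
      unfolding h_def by (intro bounded_continuous_mult bounded_continuous_cnj b_bounded_continuous hb)
    have "(\<integral>z. (cmod (h z))\<^sup>2 * 1 \<partial>\<nu>) = (\<integral>z. (cmod (h z))\<^sup>2 * b_weight z + (cmod (cnj (b z) * h z))\<^sup>2 * 1 \<partial>\<nu>)"
      by (intro Bochner_Integration.integral_cong refl) (simp add: b_weight_def norm_mult power_mult_distrib algebra_simps)
    also have "\<dots> = (\<integral>z. (cmod (h z))\<^sup>2 * b_weight z \<partial>\<nu>) + (\<integral>z. (cmod (cnj (b z) * h z))\<^sup>2 * 1 \<partial>\<nu>)"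
      using integrable_norm_sq_weight[OF admissible_b_weight hb] integrable_norm_sq_weight[OF admissible_one cb]
      unfolding h_def by (rule Bochner_Integration.integral_add)
    finally show ?thesis unfolding Re_wip_self .
  qed
  ultimately show ?thesis using kernel_form_eq[OF u] by (simp add: h_def t_def g_def)
qed

text \<open>Positivity is read off the norm identity, whose two terms are nonnegative; hermitian
  symmetry comes from the reproducing property of the Bergman kernels.\<close>

lemma pos_kernel_L: "pos_kernel X L"
proof (rule pos_kernelI)
  fix x y assume x: "x \<in> X" and y: "y \<in> X"
  note xa = bergman_kernel_approximable[OF x] and ya = bergman_kernel_approximable[OF y]
  have "bergman_kernel y x = wip one_weight (bergman_kernel y) (bergman_kernel x)"
    by (rule bergman_reproducing[OF x ya, symmetric])
  also have "\<dots> = cnj (wip one_weight (bergman_kernel x) (bergman_kernel y))"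
    by (intro A.ip_cnj bounded_continuous_poly_approximable xa ya)
  also have "\<dots> = cnj (bergman_kernel x y)" by (simp add: bergman_reproducing[OF y xa])
  finally show "L x y = cnj (L y x)" unfolding kernel_eq[OF x y] kernel_eq[OF y x] by (simp add: mult.commute)
next
  fix u assume u: "u \<in> fin_support X"
  interpret W: semi_inner_product bounded_continuous "wip b_weight"
    by (rule semi_inner_product_wip[OF admissible_b_weight])
  show "0 \<le> Re (kernel_form L u u)"
    unfolding Re_kernel_form_eq[OF u]
    by (intro add_nonneg_nonneg W.ip_nonneg A.ip_nonneg bounded_continuous_bergman_comb
        bounded_continuous_co_analytic_part u)
qed

sublocale S: semi_inner_product "fin_support X" "kernel_form L"
  by (rule semi_inner_product_kernel_form[OF pos_kernel_L])

text \<open>The square root of the reciprocal of the Schwarz-Pick constant.\<close>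

definition lower_const :: real where "lower_const = 1 / (1 - cmod (b 0))"

lemma lower_const_pos: "lower_const > 0" using b_0 by (simp add: lower_const_def)

section \<open>Estimates in the weighted norm and membership of polynomials\<close>

lemma norm_bergman_comb_le:
  assumes u: "u \<in> fin_support X"
  shows "ip_norm (wip (defect 2)) (bergman_comb u) \<le> lower_const * ip_norm (kernel_form L) u"
proof -
  note hb = bounded_continuous_bergman_comb[OF u]
  have "Re (wip (defect 2) (bergman_comb u) (bergman_comb u)) \<le> lower_const\<^sup>2 * Re (wip b_weight (bergman_comb u) (bergman_comb u))"
  proof (rule Re_wip_mono[OF admissible_defect hb admissible_b_weight hb])
    fix z assume z: "z \<in> X"
    have "1 - norm z ^ 2 \<le> lower_const\<^sup>2 * b_weight z"
      using b_weight_lower[OF z] b_0 by (simp add: lower_const_def power_divide field_simps)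
    then have "(cmod (bergman_comb u z))\<^sup>2 * (1 - norm z ^ 2) \<le> (cmod (bergman_comb u z))\<^sup>2 * (lower_const\<^sup>2 * b_weight z)"
      by (intro mult_left_mono) auto
    then show "(cmod (bergman_comb u z))\<^sup>2 * (1 - norm z ^ 2) \<le> lower_const\<^sup>2 * ((cmod (bergman_comb u z))\<^sup>2 * b_weight z)"
      by (simp add: mult_ac)
  qed
  also have "\<dots> \<le> lower_const\<^sup>2 * Re (kernel_form L u u)"
    unfolding Re_kernel_form_eq[OF u] using A.ip_nonneg[OF bounded_continuous_co_analytic_part[OF u]]
    by (intro mult_left_mono) auto
  finally have "sqrt (Re (wip (defect 2) (bergman_comb u) (bergman_comb u))) \<le> sqrt (lower_const\<^sup>2 * Re (kernel_form L u u))"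
    by simp
  then show ?thesis using lower_const_pos by (simp add: ip_norm_def real_sqrt_mult)
qed

lemma norm_co_analytic_part_le:
  assumes u: "u \<in> fin_support X"
  shows "ip_norm (wip one_weight) (co_analytic_part u) \<le> ip_norm (kernel_form L) u"
proof -
  interpret W: semi_inner_product bounded_continuous "wip b_weight"
    by (rule semi_inner_product_wip[OF admissible_b_weight])
  show ?thesis
    unfolding ip_norm_def Re_kernel_form_eq[OF u]
    using W.ip_nonneg[OF bounded_continuous_bergman_comb[OF u]] by simp
qed

text \<open>The twisted combination is \<open>cnj b h - g\<close>. As |b| is at most 1, the first
  term costs \<open>lower_const\<close>; as the weight is at most 1, the second costs 1.\<close>

lemma norm_bergman_comb_twist_le:
  assumes u: "u \<in> fin_support X"
  shows "ip_norm (wip (defect 2)) (bergman_comb (twist u)) \<le> (lower_const + 1) * ip_norm (kernel_form L) u"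
proof -
  note hb = bounded_continuous_bergman_comb[OF u]
  note gb = bounded_continuous_co_analytic_part[OF u]
  have cb: "(\<lambda>z. cnj (b z) * bergman_comb u z) \<in> bounded_continuous"
    by (intro bounded_continuous_mult bounded_continuous_cnj b_bounded_continuous hb)
  have "bergman_comb (twist u) = (\<lambda>z. cnj (b z) * bergman_comb u z + (-1) * co_analytic_part u z)"
    by (simp add: co_analytic_part_def)
  then have "ip_norm (wip (defect 2)) (bergman_comb (twist u)) \<le>
      ip_norm (wip (defect 2)) (\<lambda>z. cnj (b z) * bergman_comb u z) + ip_norm (wip (defect 2)) (\<lambda>z. (-1) * co_analytic_part u z)"
    using D.ip_norm_triangle[OF cb bounded_continuous_scale[OF gb, of "-1"]] by simp
  also have "ip_norm (wip (defect 2)) (\<lambda>z. (-1) * co_analytic_part u z) = ip_norm (wip (defect 2)) (co_analytic_part u)"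
    using D.ip_norm_scale[OF gb, of "-1"] by simp
  also have "ip_norm (wip (defect 2)) (co_analytic_part u) \<le> ip_norm (wip one_weight) (co_analytic_part u)"
  proof -
    have "Re (wip (defect 2) (co_analytic_part u) (co_analytic_part u)) \<le> 1 * Re (wip one_weight (co_analytic_part u) (co_analytic_part u))"
      by (rule Re_wip_mono[OF admissible_defect gb admissible_one gb]) (simp add: mult_left_le)
    then show ?thesis by (simp add: ip_norm_def)
  qed
  also have "\<dots> \<le> ip_norm (kernel_form L) u" by (rule norm_co_analytic_part_le[OF u])
  also have "ip_norm (wip (defect 2)) (\<lambda>z. cnj (b z) * bergman_comb u z) \<le> ip_norm (wip (defect 2)) (bergman_comb u)"
  proof -
    have "Re (wip (defect 2) (\<lambda>z. cnj (b z) * bergman_comb u z) (\<lambda>z. cnj (b z) * bergman_comb u z)) \<le>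
        1 * Re (wip (defect 2) (bergman_comb u) (bergman_comb u))"
    proof (rule Re_wip_mono[OF admissible_defect cb admissible_defect hb])
      fix z assume z: "z \<in> X"
      have "(cmod (b z))\<^sup>2 * (cmod (bergman_comb u z))\<^sup>2 \<le> 1 * (cmod (bergman_comb u z))\<^sup>2"
        using b_le[OF z] by (intro mult_right_mono) (auto simp: abs_square_le_1)
      then have "(cmod (cnj (b z) * bergman_comb u z))\<^sup>2 \<le> (cmod (bergman_comb u z))\<^sup>2"
        by (simp add: norm_mult power_mult_distrib)
      then show "(cmod (cnj (b z) * bergman_comb u z))\<^sup>2 * (1 - norm z ^ 2) \<le> 1 * ((cmod (bergman_comb u z))\<^sup>2 * (1 - norm z ^ 2))"
        using z by (simp add: mult_right_mono abs_square_le_1)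
    qed
    then show ?thesis by (simp add: ip_norm_def)
  qed
  also note norm_bergman_comb_le[OF u]
  finally show ?thesis by (simp add: algebra_simps)
qed

text \<open>The unweighted pairing of a kernel combination with a monomial is
  \<open>1 / \<rho>\<close> times the weighted one, and the weighted norm of the combination is
  controlled by its norm in the space of \<open>L\<close>.\<close>

lemma dominated_monomial: "\<exists>C\<ge>0. dominated X L (monomial \<alpha>) C"
proof -
  define \<rho> where "\<rho> = defect_ratio (total_degree \<alpha>)"
  have \<rho>: "\<rho> > 0" by (simp add: \<rho>_def defect_ratio_pos)
  note ma = poly_approximable_polynomial[OF monomial_in_analytic_polynomials[of \<alpha>]]
  note m = bounded_continuous_monomial[of \<alpha>]
  have m1: "cmod (monomial \<alpha> z) \<le> 1" if "z \<in> X" for z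
    using that by (intro norm_monomial_le) simp
  have "dominated X L (monomial \<alpha>) (lower_const / \<rho>)"
    unfolding dominated_def
  proof
    fix u assume u: "u \<in> fin_support X"
    note ha = bergman_comb_approximable[OF u] and hb = bounded_continuous_bergman_comb[OF u]
    have "(\<Sum>x | u x \<noteq> 0. u x * cnj (monomial \<alpha> x)) = wip one_weight (bergman_comb u) (monomial \<alpha>)"
      by (rule wip_bergman_comb_approximable[OF u ma, symmetric])
    moreover have "wip (defect 2) (bergman_comb u) (monomial \<alpha>) = of_real \<rho> * wip one_weight (bergman_comb u) (monomial \<alpha>)"
      unfolding \<rho>_def by (rule wip_defect_2_eq[OF ha])
    ultimately have "\<rho> * cmod (\<Sum>x | u x \<noteq> 0. u x * cnj (monomial \<alpha> x)) = cmod (wip (defect 2) (bergman_comb u) (monomial \<alpha>))"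
      using \<rho> by (simp add: norm_mult)
    also have "\<dots> \<le> ip_norm (wip (defect 2)) (bergman_comb u) * 1"
      by (rule norm_wip_le[OF admissible_defect hb m m1]) auto
    also have "\<dots> \<le> lower_const * ip_norm (kernel_form L) u" using norm_bergman_comb_le[OF u] by simp
    finally show "cmod (\<Sum>x | u x \<noteq> 0. u x * cnj (monomial \<alpha> x)) \<le> lower_const / \<rho> * ip_norm (kernel_form L) u"
      using \<rho> by (simp add: field_simps)
  qed
  then show ?thesis using lower_const_pos \<rho> by (intro exI[of _ "lower_const / \<rho>"]) simp
qed

lemma dominated_polynomial:
  assumes "p \<in> analytic_polynomials"
  shows "\<exists>C\<ge>0. dominated X L p C"
proof -
  obtain A c where A: "finite A" "p = (\<lambda>z. \<Sum>\<alpha>\<in>A. c \<alpha> * monomial \<alpha> z)"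
    using assms unfolding analytic_polynomials_iff by blast
  have "\<exists>C\<ge>0. dominated X L (\<lambda>z. \<Sum>\<alpha>\<in>A. c \<alpha> * monomial \<alpha> z) C"
    using A(1)
  proof induction
    case empty
    have "dominated X L (\<lambda>z. \<Sum>\<alpha>\<in>{}. c \<alpha> * monomial \<alpha> z) 0" by (simp add: dominated_def)
    then show ?case by (intro exI[of _ 0]) simp
  next
    case (insert \<alpha> A)
    obtain C D where C: "C \<ge> 0" "dominated X L (monomial \<alpha>) C"
      and D: "D \<ge> 0" "dominated X L (\<lambda>z. \<Sum>\<alpha>\<in>A. c \<alpha> * monomial \<alpha> z) D"
      using dominated_monomial insert.IH by blast
    have "dominated X L (\<lambda>z. c \<alpha> * monomial \<alpha> z + (\<Sum>\<alpha>\<in>A. c \<alpha> * monomial \<alpha> z)) (cmod (c \<alpha>) * C + D)"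
      by (rule dominated_add[OF dominated_scale[OF C(2)] D(2)])
    then show ?case using insert.hyps C(1) D(1) by (intro exI[of _ "cmod (c \<alpha>) * C + D"]) simp
  qed
  then show ?thesis using A(2) by simp
qed

section \<open>Weak limits of kernel combinations\<close>

lemma weakly_null:
  fixes F :: "nat \<Rightarrow> complex^'d \<Rightarrow> complex"
  assumes F: "\<And>k. F k \<in> bounded_continuous" and C: "\<And>k. ip_norm (wip (defect 2)) (F k) \<le> C" "C > 0"
    and null: "\<And>\<alpha>. (\<lambda>k. wip (defect 2) (F k) (monomial \<alpha>)) \<longlonglongrightarrow> 0"
    and G: "G \<in> poly_approximable"
  shows "(\<lambda>k. wip (defect 2) (F k) G) \<longlonglongrightarrow> 0"
proof (rule LIMSEQ_I)
  fix e :: real assume e: "e > 0"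
  note Gb = bounded_continuous_poly_approximable[OF G]
  \<comment> \<open>Replacing \<open>G\<close> by a polynomial costs at most \<open>C\<close> times
    the tolerance, uniformly in \<open>k\<close>, because the norms of \<open>F k\<close> are
    bounded; a polynomial is a finite sum of monomials.\<close>
  obtain p where p: "p \<in> analytic_polynomials" "\<And>z. z \<in> X \<Longrightarrow> cmod (G z - p z) < e / (2 * C)"
    using G e C(2) unfolding poly_approximable_def by (auto dest: spec[of _ "e / (2 * C)"])
  note pb = bounded_continuous_polynomial[OF p(1)]
  obtain A c where A: "finite A" "p = (\<lambda>z. \<Sum>\<alpha>\<in>A. c \<alpha> * monomial \<alpha> z)"
    using p(1) unfolding analytic_polynomials_iff by blast
  have "wip (defect 2) (F k) p = (\<Sum>\<alpha>\<in>A. cnj (c \<alpha>) * wip (defect 2) (F k) (monomial \<alpha>))" for k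
  proof -
    have "wip (defect 2) p (F k) = (\<Sum>\<alpha>\<in>A. c \<alpha> * wip (defect 2) (monomial \<alpha>) (F k))"
      unfolding A(2)
      by (subst D.ip_sum) (auto simp: D.ip_scale F bounded_continuous_monomial bounded_continuous_scale)
    then show ?thesis
      using D.ip_cnj[OF pb F] D.ip_cnj[OF bounded_continuous_monomial F] by simp
  qed
  moreover have "(\<lambda>k. \<Sum>\<alpha>\<in>A. cnj (c \<alpha>) * wip (defect 2) (F k) (monomial \<alpha>)) \<longlonglongrightarrow> (\<Sum>\<alpha>\<in>A. cnj (c \<alpha>) * 0)"
    by (intro tendsto_intros null)
  ultimately have "(\<lambda>k. wip (defect 2) (F k) p) \<longlonglongrightarrow> 0" by simp
  then obtain N where N: "\<And>k. k \<ge> N \<Longrightarrow> cmod (wip (defect 2) (F k) p) < e / 2"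
    using LIMSEQ_D[of _ 0 "e / 2"] e by fastforce
  have "cmod (wip (defect 2) (F k) G) < e" if k: "k \<ge> N" for k
  proof -
    have "wip (defect 2) (F k) G = wip (defect 2) (F k) (\<lambda>z. G z - p z) + wip (defect 2) (F k) p"
      by (simp add: D.ip_diff_right[OF Gb pb F])
    then have "cmod (wip (defect 2) (F k) G) \<le> cmod (wip (defect 2) (F k) (\<lambda>z. G z - p z)) + cmod (wip (defect 2) (F k) p)"
      by (simp only: norm_triangle_ineq)
    also have "cmod (wip (defect 2) (F k) (\<lambda>z. G z - p z)) \<le> ip_norm (wip (defect 2)) (F k) * (e / (2 * C))"
      using p(2) e C(2) by (intro norm_wip_le[OF admissible_defect F D.diff_mem[OF Gb pb]]) (auto intro: less_imp_le)
    also have "\<dots> \<le> C * (e / (2 * C))" using C e by (intro mult_right_mono) auto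
    finally show ?thesis using N[OF k] C(2) by simp
  qed
  then show "\<exists>no. \<forall>n\<ge>no. cmod (wip (defect 2) (F n) G - 0) < e" by auto
qed

text \<open>Dominated convergence, since |z|^(2j) tends to zero in the open ball. It disposes of the
  part of the weight that orthogonality does not remove.\<close>

lemma radial_power_null:
  assumes g: "g \<in> bounded_continuous"
  shows "(\<lambda>j. wip (\<lambda>z. norm z ^ (2 * j)) g (monomial \<alpha>)) \<longlonglongrightarrow> 0"
proof -
  note m = bounded_continuous_monomial[of \<alpha>]
  have "(\<lambda>j. wip (\<lambda>z. norm z ^ (2 * j)) g (monomial \<alpha>)) \<longlonglongrightarrow> (\<integral>z. 0 \<partial>\<nu>)"
    unfolding weighted_ip_def
  proof (rule integral_dominated_convergence)
    show "(\<lambda>z. g z * cnj (monomial \<alpha> z) * of_real (norm z ^ (2 * j))) \<in> borel_measurable \<nu>" for j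
      by (intro measurable_bounded_continuous bounded_continuous_wip[OF admissible_norm_power] g m)
    show "integrable \<nu> (\<lambda>z. cmod (g z * cnj (monomial \<alpha> z)))"
      by (intro integrable_norm integrable_bounded_continuous bounded_continuous_mult bounded_continuous_cnj g m)
    show "AE z in \<nu>. (\<lambda>j. g z * cnj (monomial \<alpha> z) * of_real (norm z ^ (2 * j))) \<longlonglongrightarrow> 0"
    proof (rule AE_I2)
      fix z assume "z \<in> space \<nu>"
      then have "(norm z)\<^sup>2 < 1" by (simp add: space_ball_prob abs_square_less_1)
      then have "(\<lambda>j. ((norm z)\<^sup>2) ^ j) \<longlonglongrightarrow> 0" by (intro LIMSEQ_realpow_zero) auto
      then have "(\<lambda>j. complex_of_real (((norm z)\<^sup>2) ^ j)) \<longlonglongrightarrow> of_real 0" by (rule tendsto_of_real)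
      from tendsto_mult_left[OF this, of "g z * cnj (monomial \<alpha> z)"]
      show "(\<lambda>j. g z * cnj (monomial \<alpha> z) * of_real (norm z ^ (2 * j))) \<longlonglongrightarrow> 0"
        by (simp add: power_mult)
    qed
    show "AE z in \<nu>. cmod (g z * cnj (monomial \<alpha> z) * of_real (norm z ^ (2 * j))) \<le> cmod (g z * cnj (monomial \<alpha> z))" for j
      by (rule AE_I2) (auto simp: space_ball_prob norm_mult norm_power intro!: mult_right_le_one_le power_le_one)
  qed simp
  then show ?thesis by simp
qed

text \<open>The weight 1 - |z|^(2j) is at most \<open>j\<close> times 1 - |z|^2 by Bernoulli's
  inequality. For fixed \<open>j\<close> the bound thus vanishes together with the weighted norm of
  the combination.\<close>

lemma norm_wip_defect_conj_mult_le:
  assumes u: "u \<in> fin_support X"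
  shows "cmod (wip (defect (2 * j)) (\<lambda>z. cnj (b z) * bergman_comb u z) (monomial \<alpha>)) \<le>
    sqrt (real j) * ip_norm (wip (defect 2)) (bergman_comb u)"
proof -
  note hb = bounded_continuous_bergman_comb[OF u]
  have cb: "(\<lambda>z. cnj (b z) * bergman_comb u z) \<in> bounded_continuous"
    by (intro bounded_continuous_mult bounded_continuous_cnj b_bounded_continuous hb)
  have m1: "cmod (monomial \<alpha> z) \<le> 1" if "z \<in> X" for z
    using that by (intro norm_monomial_le) simp
  have "cmod (wip (defect (2 * j)) (\<lambda>z. cnj (b z) * bergman_comb u z) (monomial \<alpha>)) \<le>
      ip_norm (wip (defect (2 * j))) (\<lambda>z. cnj (b z) * bergman_comb u z) * 1"
    by (rule norm_wip_le[OF admissible_defect cb bounded_continuous_monomial m1]) auto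
  also have "\<dots> \<le> sqrt (real j) * ip_norm (wip (defect 2)) (bergman_comb u)"
  proof -
    have "Re (wip (defect (2 * j)) (\<lambda>z. cnj (b z) * bergman_comb u z) (\<lambda>z. cnj (b z) * bergman_comb u z)) \<le>
        real j * Re (wip (defect 2) (bergman_comb u) (bergman_comb u))"
    proof (rule Re_wip_mono[OF admissible_defect cb admissible_defect hb])
      fix z assume z: "z \<in> X"
      have n1: "(norm z)\<^sup>2 \<le> 1" using z by (simp add: abs_square_le_1)
      define x where "x = norm z ^ 2"
      have "1 + real j * (x - 1) \<le> (1 + (x - 1)) ^ j"
        by (rule Bernoulli_inequality) (simp add: x_def)
      then have "1 - x ^ j \<le> real j * (1 - x)" by (simp add: algebra_simps)
      then have bern: "1 - norm z ^ (2 * j) \<le> real j * (1 - norm z ^ 2)"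
        by (simp only: x_def power_mult)
      have "(cmod (cnj (b z) * bergman_comb u z))\<^sup>2 \<le> (cmod (bergman_comb u z))\<^sup>2"
        using b_le[OF z] by (intro power_mono) (simp_all add: norm_mult mult_left_le_one_le)
      then have "(cmod (cnj (b z) * bergman_comb u z))\<^sup>2 * (1 - norm z ^ (2 * j)) \<le>
          (cmod (bergman_comb u z))\<^sup>2 * (real j * (1 - norm z ^ 2))"
        using bern z by (intro mult_mono) (auto simp: power_le_one)
      then show "(cmod (cnj (b z) * bergman_comb u z))\<^sup>2 * (1 - norm z ^ (2 * j)) \<le>
          real j * ((cmod (bergman_comb u z))\<^sup>2 * (1 - norm z ^ 2))"
        by (simp add: mult_ac)
    qed
    then show ?thesis by (simp add: ip_norm_def flip: real_sqrt_mult)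
  qed
  finally show ?thesis .
qed

text \<open>The twisted combination is \<open>cnj b h - g\<close>, where \<open>g\<close> is known
  to be Cauchy but not to be small. After the change to the weight with exponent
  \<open>2 * j\<close>, the part \<open>g\<close> pairs with a monomial only through |z|^(2j): the
  difference to a fixed \<open>g'\<close> is controlled by the Cauchy property and \<open>g'\<close>
  itself by a large \<open>j\<close>. The order of choices is \<open>N\<close>, then
  \<open>j\<close>, then \<open>n\<close>.\<close>

lemma twist_parts_null:
  fixes U :: "nat \<Rightarrow> complex^'d \<Rightarrow> complex"
  assumes U: "\<And>n. U n \<in> fin_support X" and cU: "S.Cauchy_ip U"
    and hnull: "(\<lambda>n. ip_norm (wip (defect 2)) (bergman_comb (U n))) \<longlonglongrightarrow> 0"
  shows "(\<lambda>n. wip (defect 2) (bergman_comb (twist (U n))) (monomial \<alpha>)) \<longlonglongrightarrow> 0"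
proof (rule LIMSEQ_I)
  fix e :: real assume e: "e > 0"
  note m = bounded_continuous_monomial[of \<alpha>]
  note ma = poly_approximable_polynomial[OF monomial_in_analytic_polynomials[of \<alpha>]]
  have m1: "cmod (monomial \<alpha> z) \<le> 1" if "z \<in> X" for z
    using that by (intro norm_monomial_le) simp
  note gb = bounded_continuous_co_analytic_part[OF U]
  obtain N where N: "\<And>j k. j \<ge> N \<Longrightarrow> k \<ge> N \<Longrightarrow> ip_norm (kernel_form L) (\<lambda>z. U j z - U k z) < e / 3"
    using cU e unfolding S.Cauchy_ip_def by (meson divide_pos_pos zero_less_numeral)
  have "\<forall>\<^sub>F j in sequentially. cmod (wip (\<lambda>z. norm z ^ (2 * j)) (co_analytic_part (U N)) (monomial \<alpha>)) < e / 3"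
    using order_tendstoD(2)[OF tendsto_norm_zero[OF radial_power_null[OF gb[of N]]], of "e / 3"] e by simp
  then obtain J where J: "\<And>j. j \<ge> J \<Longrightarrow> cmod (wip (\<lambda>z. norm z ^ (2 * j)) (co_analytic_part (U N)) (monomial \<alpha>)) < e / 3"
    unfolding eventually_sequentially by blast
  \<comment> \<open>The lower bound 1 is needed for the comparison with the weight 1 -
    |z|^2.\<close>
  define j where "j = max J 1"
  have j: "j \<ge> 1" "j \<ge> J" by (auto simp: j_def)
  interpret R: semi_inner_product bounded_continuous "wip (\<lambda>z. norm z ^ (2 * j))"
    by (rule semi_inner_product_wip[OF admissible_norm_power])
  interpret E: semi_inner_product bounded_continuous "wip (defect (2 * j))"
    by (rule semi_inner_product_wip[OF admissible_defect])
  have "(\<lambda>n. sqrt (real j) * ip_norm (wip (defect 2)) (bergman_comb (U n))) \<longlonglongrightarrow> sqrt (real j) * 0"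
    by (intro tendsto_mult_left hnull)
  then have "\<forall>\<^sub>F n in sequentially. sqrt (real j) * ip_norm (wip (defect 2)) (bergman_comb (U n)) < e / 3"
    using order_tendstoD(2)[of _ "sqrt (real j) * 0" sequentially "e / 3"] e by simp
  then obtain M where M: "\<And>n. n \<ge> M \<Longrightarrow> sqrt (real j) * ip_norm (wip (defect 2)) (bergman_comb (U n)) < e / 3"
    unfolding eventually_sequentially by blast
  have "cmod (wip (defect 2) (bergman_comb (twist (U n))) (monomial \<alpha>)) < e" if n: "n \<ge> max N M" for n
  proof -
    define h where "h = (\<lambda>z. cnj (b z) * bergman_comb (U n) z)"
    define g where "g = co_analytic_part (U n)"
    define g' where "g' = co_analytic_part (U N)"
    have hb: "h \<in> bounded_continuous"
      unfolding h_def by (intro bounded_continuous_mult bounded_continuous_cnj b_bounded_continuous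
          bounded_continuous_bergman_comb U)
    have gb': "g \<in> bounded_continuous" "g' \<in> bounded_continuous" unfolding g_def g'_def by (rule gb)+
    have t: "bergman_comb (twist (U n)) = (\<lambda>z. h z - g z)" by (simp add: h_def g_def co_analytic_part_def)
    have "cmod (wip (defect 2) (bergman_comb (twist (U n))) (monomial \<alpha>)) \<le>
        cmod (wip (defect (2 * j)) (bergman_comb (twist (U n))) (monomial \<alpha>))"
      by (intro norm_wip_defect_2_le bergman_comb_approximable twist_fin_support U j)
    also have "\<dots> \<le> cmod (wip (defect (2 * j)) h (monomial \<alpha>)) + cmod (wip (defect (2 * j)) g (monomial \<alpha>))"
      unfolding t E.ip_diff[OF hb gb'(1) m] by (rule norm_triangle_ineq4)
    also have "cmod (wip (defect (2 * j)) h (monomial \<alpha>)) < e / 3"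
      using norm_wip_defect_conj_mult_le[OF U[of n], of j \<alpha>] M[of n] n by (simp add: h_def)
    \<comment> \<open>Unweighted orthogonality to the monomial removes the constant part of the
      weight.\<close>
    also have "wip (defect (2 * j)) g (monomial \<alpha>) = - wip (\<lambda>z. norm z ^ (2 * j)) g (monomial \<alpha>)"
      using wip_defect[OF gb'(1) m, of "2 * j"] co_analytic_part_orthogonal[OF U ma] by (simp add: g_def)
    also have "wip (\<lambda>z. norm z ^ (2 * j)) g (monomial \<alpha>) =
        wip (\<lambda>z. norm z ^ (2 * j)) (\<lambda>z. g z - g' z) (monomial \<alpha>) + wip (\<lambda>z. norm z ^ (2 * j)) g' (monomial \<alpha>)"
      by (simp add: R.ip_diff[OF gb' m])
    also have "cmod (- (wip (\<lambda>z. norm z ^ (2 * j)) (\<lambda>z. g z - g' z) (monomial \<alpha>) + wip (\<lambda>z. norm z ^ (2 * j)) g' (monomial \<alpha>))) \<le>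
        cmod (wip (\<lambda>z. norm z ^ (2 * j)) (\<lambda>z. g z - g' z) (monomial \<alpha>)) + cmod (wip (\<lambda>z. norm z ^ (2 * j)) g' (monomial \<alpha>))"
      unfolding norm_minus_cancel by (rule norm_triangle_ineq)
    also have "cmod (wip (\<lambda>z. norm z ^ (2 * j)) g' (monomial \<alpha>)) < e / 3"
      unfolding g'_def by (rule J[OF j(2)])
    also have "cmod (wip (\<lambda>z. norm z ^ (2 * j)) (\<lambda>z. g z - g' z) (monomial \<alpha>)) \<le> e / 3"
    proof -
      note db = bounded_continuous_diff[OF gb']
      have "cmod (wip (\<lambda>z. norm z ^ (2 * j)) (\<lambda>z. g z - g' z) (monomial \<alpha>)) \<le>
          ip_norm (wip (\<lambda>z. norm z ^ (2 * j))) (\<lambda>z. g z - g' z) * 1"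
        by (rule norm_wip_le[OF admissible_norm_power db m m1]) auto
      also have "ip_norm (wip (\<lambda>z. norm z ^ (2 * j))) (\<lambda>z. g z - g' z) \<le> ip_norm (wip one_weight) (\<lambda>z. g z - g' z)"
      proof -
        have "Re (wip (\<lambda>z. norm z ^ (2 * j)) (\<lambda>z. g z - g' z) (\<lambda>z. g z - g' z)) \<le>
            1 * Re (wip one_weight (\<lambda>z. g z - g' z) (\<lambda>z. g z - g' z))"
          by (rule Re_wip_mono[OF admissible_norm_power db admissible_one db])
            (simp add: mult_left_le power_le_one)
        then show ?thesis by (simp add: ip_norm_def)
      qed
      also have "ip_norm (wip one_weight) (\<lambda>z. g z - g' z) \<le> ip_norm (kernel_form L) (\<lambda>x. U n x - U N x)"
      proof -
        have "(\<lambda>z. g z - g' z) = co_analytic_part (\<lambda>x. U n x - U N x)"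
          by (simp add: g_def g'_def co_analytic_part_diff U fun_eq_iff)
        then show ?thesis using norm_co_analytic_part_le[OF fin_support_diff[OF U[of n] U[of N]]] by simp
      qed
      also have "\<dots> < e / 3" using N[of n N] n by simp
      finally show ?thesis by simp
    qed
    finally show ?thesis by simp
  qed
  then show "\<exists>no. \<forall>n\<ge>no. cmod (wip (defect 2) (bergman_comb (twist (U n))) (monomial \<alpha>) - 0) < e"
    by (intro exI[of _ "max N M"]) simp
qed

lemma orthogonal_polynomials_trivial:
  assumes "reproducing_kernel_hilbert_space X H ip L" and f: "f \<in> H"
    and orth: "\<And>p. p \<in> analytic_polynomials \<Longrightarrow> ip (zero_ext X p) f = 0"
  shows "f = (\<lambda>z. 0)"
proof -
  interpret H: reproducing_kernel_hilbert_space X H ip L by fact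
  obtain U where U: "\<And>n :: nat. U n \<in> fin_support X"
    and lim: "(\<lambda>n. ip_norm ip (\<lambda>z. kernel_comb X L (U n) z - f z)) \<longlonglongrightarrow> 0"
    using H.kernel_comb_dense_seq[OF f] by blast
  note kH = H.kernel_comb_mem[OF U]
  have "H.Cauchy_ip (\<lambda>n. kernel_comb X L (U n))" by (rule H.convergent_imp_Cauchy_ip[OF kH f lim])
  moreover have "ip_norm ip (\<lambda>z. kernel_comb X L (U j) z - kernel_comb X L (U k) z) =
      ip_norm (kernel_form L) (\<lambda>z. U j z - U k z)" for j k
  proof -
    have "kernel_comb X L (\<lambda>z. U j z + (-1) * U k z) = (\<lambda>z. kernel_comb X L (U j) z + (-1) * kernel_comb X L (U k) z)"
      unfolding kernel_comb_add[OF U[of j] fin_support_mult(2)[OF U[of k], of "\<lambda>_. -1"]]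
        kernel_comb_scale[OF U[of k]] ..
    then show ?thesis using H.ip_norm_kernel_comb[OF fin_support_diff[OF U[of j] U[of k]]] by simp
  qed
  ultimately have cU: "S.Cauchy_ip U" by (simp add: H.Cauchy_ip_def S.Cauchy_ip_def)
  obtain C where C: "C > 0" "\<And>n. ip_norm (kernel_form L) (U n) \<le> C"
    using S.Cauchy_ip_bounded[OF U cU] by blast
  note hb = bounded_continuous_bergman_comb[OF U] and ha = bergman_comb_approximable[OF U]
  note tb = bounded_continuous_bergman_comb[OF twist_fin_support[OF U]]
    and ta = bergman_comb_approximable[OF twist_fin_support[OF U]]
  have hC: "ip_norm (wip (defect 2)) (bergman_comb (U n)) \<le> lower_const * C" for n
    using norm_bergman_comb_le[OF U[of n]] C(2)[of n] lower_const_pos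
    by (meson less_imp_le mult_left_mono order_trans)
  have tC: "ip_norm (wip (defect 2)) (bergman_comb (twist (U n))) \<le> (lower_const + 1) * C" for n
  proof -
    have "ip_norm (wip (defect 2)) (bergman_comb (twist (U n))) \<le> (lower_const + 1) * ip_norm (kernel_form L) (U n)"
      by (rule norm_bergman_comb_twist_le[OF U])
    also have "\<dots> \<le> (lower_const + 1) * C" using C(2)[of n] lower_const_pos by (intro mult_left_mono) auto
    finally show ?thesis .
  qed
  have hmono: "(\<lambda>n. wip (defect 2) (bergman_comb (U n)) (monomial \<alpha>)) \<longlonglongrightarrow> 0" for \<alpha>
  proof -
    note ma = monomial_in_analytic_polynomials[of \<alpha>]
    obtain D where "D \<ge> 0" "dominated X L (monomial \<alpha>) D" using dominated_monomial by blast
    then have zH: "zero_ext X (monomial \<alpha>) \<in> H" by (intro H.dominated_mem(1))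
    \<comment> \<open>Both sides are the sum of the coefficients times the conjugate values of the
      monomial, so the unweighted pairing converges together with the pairing in
      \<open>H\<close>.\<close>
    have "wip one_weight (bergman_comb (U n)) (monomial \<alpha>) = ip (kernel_comb X L (U n)) (zero_ext X (monomial \<alpha>))" for n
    proof -
      have "(\<Sum>x | U n x \<noteq> 0. U n x * cnj (monomial \<alpha> x)) = (\<Sum>x | U n x \<noteq> 0. U n x * cnj (zero_ext X (monomial \<alpha>) x))"
        using fin_support_mem[OF U[of n]] by (intro sum.cong refl) (simp add: zero_ext_def)
      then show ?thesis
        using wip_bergman_comb_approximable[OF U poly_approximable_polynomial[OF ma], of n] H.ip_kernel_comb[OF U zH, of n] by simp
    qed
    moreover have "(\<lambda>n. ip (kernel_comb X L (U n)) (zero_ext X (monomial \<alpha>))) \<longlonglongrightarrow> ip f (zero_ext X (monomial \<alpha>))"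
      by (rule H.tendsto_ip_const[OF kH f zH lim])
    moreover have "ip f (zero_ext X (monomial \<alpha>)) = 0"
      using orth[OF ma] H.ip_cnj[OF zH f] by simp
    ultimately have "(\<lambda>n. wip one_weight (bergman_comb (U n)) (monomial \<alpha>)) \<longlonglongrightarrow> 0" by simp
    from tendsto_mult_left[OF this, of "of_real (defect_ratio (total_degree \<alpha>))"]
    show ?thesis by (simp add: wip_defect_2_eq[OF ha])
  qed
  have hweak: "(\<lambda>n. wip (defect 2) (bergman_comb (U n)) G) \<longlonglongrightarrow> 0" if "G \<in> poly_approximable" for G
    using C lower_const_pos by (intro weakly_null[OF hb hC _ hmono that]) simp
  \<comment> \<open>The combinations are Cauchy and weakly null, hence null in norm;
    \<open>twist_parts_null\<close> needs the norm.\<close>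
  have hnull: "(\<lambda>n. ip_norm (wip (defect 2)) (bergman_comb (U n))) \<longlonglongrightarrow> 0"
  proof (rule D.Cauchy_ip_null[OF hb])
    show "D.Cauchy_ip (\<lambda>n. bergman_comb (U n))"
      unfolding D.Cauchy_ip_def
    proof (intro allI impI)
      fix e :: real assume e: "e > 0"
      then obtain N where N: "\<And>j k. j \<ge> N \<Longrightarrow> k \<ge> N \<Longrightarrow> ip_norm (kernel_form L) (\<lambda>z. U j z - U k z) < e / lower_const"
        using cU lower_const_pos unfolding S.Cauchy_ip_def by (meson divide_pos_pos)
      have "ip_norm (wip (defect 2)) (\<lambda>z. bergman_comb (U j) z - bergman_comb (U k) z) < e" if jk: "j \<ge> N" "k \<ge> N" for j k
      proof -
        have "(\<lambda>z. bergman_comb (U j) z - bergman_comb (U k) z) = bergman_comb (\<lambda>z. U j z - U k z)"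
          by (simp add: bergman_comb_diff U fun_eq_iff)
        then have "ip_norm (wip (defect 2)) (\<lambda>z. bergman_comb (U j) z - bergman_comb (U k) z) \<le>
            lower_const * ip_norm (kernel_form L) (\<lambda>z. U j z - U k z)"
          using norm_bergman_comb_le[OF fin_support_diff[OF U U]] by simp
        also have "\<dots> < lower_const * (e / lower_const)" by (intro mult_strict_left_mono N jk lower_const_pos)
        finally show ?thesis using lower_const_pos by simp
      qed
      then show "\<exists>N. \<forall>j\<ge>N. \<forall>k\<ge>N. ip_norm (wip (defect 2)) (\<lambda>z. bergman_comb (U j) z - bergman_comb (U k) z) < e"
        by blast
    qed
    show "(\<lambda>k. wip (defect 2) (bergman_comb (U n)) (bergman_comb (U k))) \<longlonglongrightarrow> 0" for n
    proof -
      have "(\<lambda>k. wip (defect 2) (bergman_comb (U n)) (bergman_comb (U k))) =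
          (\<lambda>k. cnj (wip (defect 2) (bergman_comb (U k)) (bergman_comb (U n))))"
        by (intro ext D.ip_cnj hb)
      then show ?thesis using tendsto_cnj[OF hweak[OF ha[of n]]] by simp
    qed
  qed
  have tweak: "(\<lambda>n. wip (defect 2) (bergman_comb (twist (U n))) G) \<longlonglongrightarrow> 0" if "G \<in> poly_approximable" for G
    using C lower_const_pos
    by (intro weakly_null[OF tb tC _ twist_parts_null[OF U cU hnull] that]) simp
  show ?thesis
  proof
    fix w
    show "f w = 0"
    proof (cases "w \<in> X")
      case True
      \<comment> \<open>Evaluation at \<open>w\<close> is pairing with the kernel of the weighted
        inner product, so weak convergence gives pointwise convergence of both parts.\<close>
      note ka = defect_kernel_approximable[OF True]
      have "(\<lambda>n. bergman_comb (U n) w) \<longlonglongrightarrow> 0"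
        using hweak[OF ka] by (simp add: defect_reproducing[OF True ha])
      moreover have "(\<lambda>n. bergman_comb (twist (U n)) w) \<longlonglongrightarrow> 0"
        using tweak[OF ka] by (simp add: defect_reproducing[OF True ta])
      ultimately have "(\<lambda>n. bergman_comb (U n) w - b w * bergman_comb (twist (U n)) w) \<longlonglongrightarrow> 0 - b w * 0"
        by (intro tendsto_intros)
      then have "(\<lambda>n. kernel_comb X L (U n) w) \<longlonglongrightarrow> 0" by (simp add: kernel_comb_eq_bergman[OF U True])
      moreover have "(\<lambda>n. kernel_comb X L (U n) w) \<longlonglongrightarrow> f w"
        using H.tendsto_ip_const[OF kH f H.kernel_mem[OF True] lim]
        by (simp add: H.reproducing[OF kH True] H.reproducing[OF f True])
      ultimately show ?thesis using LIMSEQ_unique by blast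
    qed (rule H.vanish_outside[OF f])
  qed
qed

text \<open>Density at exponent one, restated as a domination so that it can be multiplied. Kernel
  functions are enough, because pairing with them determines all values of a function.\<close>

lemma kernel_approximation:
  assumes w: "w \<in> X" and e: "e > 0"
  obtains p where "p \<in> analytic_polynomials" "dominated X L (\<lambda>z. L z w - p z) e"
proof -
  define H where "H = kernel_space X L"
  define ip where "ip = kernel_ip X L"
  have rk: "reproducing_kernel_hilbert_space X H ip L"
    unfolding H_def ip_def by (rule kernel_space_RKHS[OF pos_kernel_L])
  interpret H: reproducing_kernel_hilbert_space X H ip L by (rule rk)
  let ?S = "zero_ext X ` analytic_polynomials :: (complex^'d \<Rightarrow> complex) set"
  have S: "?S \<subseteq> H"
  proof
    fix g :: "complex^'d \<Rightarrow> complex" assume "g \<in> ?S"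
    then obtain p where p: "p \<in> analytic_polynomials" "g = zero_ext X p" by blast
    obtain D where "D \<ge> 0" "dominated X L p D" using dominated_polynomial[OF p(1)] by blast
    then show "g \<in> H" unfolding p(2) by (intro H.dominated_mem(1))
  qed
  have triv: "f = (\<lambda>z. 0)" if f: "f \<in> H" and o: "\<And>v. v \<in> ?S \<Longrightarrow> ip v f = 0" for f
    by (rule orthogonal_polynomials_trivial[OF rk f]) (rule o, rule imageI)
  note kw = H.kernel_mem[OF w]
  obtain F where F: "\<And>n :: nat. F n \<in> ?S" "(\<lambda>n. ip_norm ip (\<lambda>z. F n z - zero_ext X (\<lambda>z. L z w) z)) \<longlonglongrightarrow> 0"
    by (rule H.dense_of_trivial_complement[OF S zero_ext_polynomials_zero zero_ext_polynomials_add
          zero_ext_polynomials_scale triv kw]) auto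
  have "\<forall>\<^sub>F n in sequentially. ip_norm ip (\<lambda>z. F n z - zero_ext X (\<lambda>z. L z w) z) < e"
    using order_tendstoD(2)[OF F(2) e] .
  then obtain n where n: "ip_norm ip (\<lambda>z. F n z - zero_ext X (\<lambda>z. L z w) z) < e"
    by (auto simp: eventually_sequentially)
  obtain p where p: "p \<in> analytic_polynomials" "F n = zero_ext X p" using F(1)[of n] by blast
  have FH: "F n \<in> H" using F(1) S by blast
  have dm: "(\<lambda>z. zero_ext X (\<lambda>z. L z w) z - F n z) \<in> H" by (rule H.diff_mem[OF kw FH])
  have "dominated X L (\<lambda>z. zero_ext X (\<lambda>z. L z w) z - F n z) (ip_norm ip (\<lambda>z. zero_ext X (\<lambda>z. L z w) z - F n z))"
    by (rule H.mem_dominated[OF dm])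
  then have "dominated X L (\<lambda>z. L z w - p z) (ip_norm ip (\<lambda>z. zero_ext X (\<lambda>z. L z w) z - F n z))"
    by (rule dominated_cong) (simp add: p(2) zero_ext_def)
  moreover have "ip_norm ip (\<lambda>z. zero_ext X (\<lambda>z. L z w) z - F n z) \<le> e"
    using n H.ip_norm_diff_commute[OF FH kw] by simp
  ultimately show ?thesis using that[OF p(1)] dominated_mono[OF pos_kernel_L] by blast
qed

section \<open>Powers of the kernel\<close>

lemma pos_kernel_power: "pos_kernel X (\<lambda>z w. L z w ^ m)"
proof (induction m)
  case 0
  then show ?case using pos_kernel_rank_one[of X "\<lambda>_. 1"] by simp
next
  case (Suc m)
  then show ?case using pos_kernel_mult[OF pos_kernel_L] by simp
qed

text \<open>The constant 1 lies in the space of \<open>L\<close>, so multiplying by it carries a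
  polynomial from one power of the kernel to the next.\<close>

lemma dominated_polynomial_power:
  assumes p: "p \<in> analytic_polynomials"
  shows "\<exists>C\<ge>0. dominated X (\<lambda>z w. L z w ^ Suc m) p C"
proof (induction m)
  case 0
  then show ?case using dominated_polynomial[OF p] by simp
next
  case (Suc m)
  obtain C where C: "C \<ge> 0" "dominated X (\<lambda>z w. L z w ^ Suc m) p C" using Suc by blast
  obtain D where D: "D \<ge> 0" "dominated X L (\<lambda>z. 1) D"
    using dominated_polynomial[OF analytic_polynomials_const] by blast
  have "dominated X (\<lambda>z w. L z w * L z w ^ Suc m) (\<lambda>z. 1 * p z) (D * C)"
    by (rule dominated_mult[OF pos_kernel_L pos_kernel_power D(1) C(1) D(2) C(2)])
  then show ?case using C(1) D(1) by (intro exI[of _ "D * C"]) simp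
qed

text \<open>Based on \<open>L * L^m - q * p = L * (L^m - p) + (L - q) * p\<close>. The bound
  \<open>C\<close> on \<open>p\<close> is part of the induction because the tolerance for
  \<open>q\<close> depends on it.\<close>

lemma kernel_power_approximation:
  assumes w: "w \<in> X"
  shows "e > 0 \<Longrightarrow> \<exists>p\<in>analytic_polynomials. \<exists>C\<ge>0. dominated X (\<lambda>z w. L z w ^ m) p C \<and>
    dominated X (\<lambda>z w. L z w ^ m) (\<lambda>z. L z w ^ m - p z) e"
proof (induction m arbitrary: e)
  case 0
  have sq: "Re (kernel_form (\<lambda>z w. 1) u u) = (cmod (\<Sum>x | u x \<noteq> 0. u x))\<^sup>2" for u :: "complex^'d \<Rightarrow> complex"
    using kernel_form_rank_one[of "\<lambda>_. 1" u] by (simp only: complex_cnj_one mult_1_right Re_complex_of_real)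
  have "dominated X (\<lambda>z w. 1) (\<lambda>z. 1) 1"
    by (simp add: dominated_def ip_norm_def sq)
  moreover have "dominated X (\<lambda>z w. 1) (\<lambda>z. 0) e"
    using 0 by (simp add: dominated_def ip_norm_def sq)
  ultimately show ?case
    by (intro bexI[OF _ analytic_polynomials_const[of 1]] exI[of _ 1]) simp
next
  case (Suc m)
  obtain H ip where "reproducing_kernel_hilbert_space X H ip L"
    using kernel_space_RKHS[OF pos_kernel_L] by blast
  then interpret H: reproducing_kernel_hilbert_space X H ip L .
  \<comment> \<open>The added 1 keeps the divisor in the tolerance positive.\<close>
  define A where "A = ip_norm ip (zero_ext X (\<lambda>z. L z w)) + 1"
  have A: "A > 0" using H.ip_norm_nonneg[OF H.kernel_mem[OF w]] by (simp add: A_def)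
  have "dominated X L (zero_ext X (\<lambda>z. L z w)) (A - 1)"
    using H.mem_dominated[OF H.kernel_mem[OF w]] by (simp add: A_def)
  then have "dominated X L (\<lambda>z. L z w) (A - 1)" by (rule dominated_cong) (simp add: zero_ext_def)
  then have dA: "dominated X L (\<lambda>z. L z w) A" by (rule dominated_mono[OF pos_kernel_L]) simp
  have "e / (2 * A) > 0" using Suc.prems A by simp
  then obtain p C where p: "p \<in> analytic_polynomials" "C \<ge> 0" "dominated X (\<lambda>z w. L z w ^ m) p C"
      "dominated X (\<lambda>z w. L z w ^ m) (\<lambda>z. L z w ^ m - p z) (e / (2 * A))"
    using Suc.IH by blast
  \<comment> \<open>The divisor uses \<open>C + 1\<close> because \<open>C\<close> may be
    zero.\<close>
  have e2: "e / (2 * (C + 1)) > 0" using Suc.prems p(2) by simp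
  obtain q where q: "q \<in> analytic_polynomials" "dominated X L (\<lambda>z. L z w - q z) (e / (2 * (C + 1)))"
    using kernel_approximation[OF w e2] by blast
  have pq: "(\<lambda>z. q z * p z) \<in> analytic_polynomials" by (rule analytic_polynomials_mult[OF q(1) p(1)])
  have "dominated X (\<lambda>z w. L z w * L z w ^ m) (\<lambda>z. L z w * (L z w ^ m - p z) + (L z w - q z) * p z)
      (A * (e / (2 * A)) + e / (2 * (C + 1)) * C)"
    using A Suc.prems p(2) e2
    by (intro dominated_add dominated_mult pos_kernel_L pos_kernel_power dA p q) auto
  moreover have "A * (e / (2 * A)) + e / (2 * (C + 1)) * C \<le> e"
  proof -
    have "e / (2 * (C + 1)) * C \<le> e / (2 * (C + 1)) * (C + 1)" using e2 by (intro mult_left_mono) auto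
    also have "\<dots> = e / 2"
    proof -
      have "e / (2 * x) * x = e / 2" if "x \<noteq> 0" for x :: real using that by simp
      then show ?thesis using p(2) by (metis add_nonneg_eq_0_iff zero_le_one zero_neq_one)
    qed
    finally have "e / (2 * (C + 1)) * C \<le> e / 2" .
    moreover have "A * (e / (2 * A)) = e / 2" using A by simp
    ultimately show ?thesis by linarith
  qed
  ultimately have "dominated X (\<lambda>z w. L z w * L z w ^ m) (\<lambda>z. L z w * (L z w ^ m - p z) + (L z w - q z) * p z) e"
    by (rule dominated_mono[OF pos_kernel_mult[OF pos_kernel_L pos_kernel_power]])
  moreover have "(\<lambda>z. L z w * (L z w ^ m - p z) + (L z w - q z) * p z) = (\<lambda>z. L z w ^ Suc m - q z * p z)"
    by (simp add: fun_eq_iff algebra_simps)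
  ultimately have "dominated X (\<lambda>z w. L z w ^ Suc m) (\<lambda>z. L z w ^ Suc m - q z * p z) e" by simp
  moreover obtain E where "E \<ge> 0" "dominated X (\<lambda>z w. L z w ^ Suc m) (\<lambda>z. q z * p z) E"
    using dominated_polynomial_power[OF pq] by blast
  ultimately show ?case using pq by (intro bexI[of _ "\<lambda>z. q z * p z"]) auto
qed

text \<open>For \<open>f\<close> orthogonal to polynomials, \<open>f w\<close> is also the pairing
  of \<open>f\<close> with the kernel function at \<open>w\<close> minus a polynomial, and this
  difference can be made arbitrarily small. The argument rests on the reproducing property, so it
  covers every space with this kernel.\<close>

lemma polynomials_dense_power:
  assumes rk: "reproducing_kernel_hilbert_space X H ip (\<lambda>z w. L z w ^ Suc m)"
  shows "dense_subset_of H ip (zero_ext X ` analytic_polynomials)"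
proof -
  interpret H: reproducing_kernel_hilbert_space X H ip "\<lambda>z w. L z w ^ Suc m" by (rule rk)
  let ?S = "zero_ext X ` analytic_polynomials :: (complex^'d \<Rightarrow> complex) set"
  have pH: "zero_ext X p \<in> H" if "p \<in> analytic_polynomials" for p
  proof -
    obtain D where "D \<ge> 0" "dominated X (\<lambda>z w. L z w ^ Suc m) p D" using dominated_polynomial_power[OF \<open>p \<in> _\<close>] by blast
    then show ?thesis by (intro H.dominated_mem(1))
  qed
  then have S: "?S \<subseteq> H" by blast
  have triv: "f = (\<lambda>z. 0)" if f: "f \<in> H" and orth: "\<And>v. v \<in> ?S \<Longrightarrow> ip v f = 0" for f
  proof
    fix w
    show "f w = 0"
    proof (cases "w \<in> X")
      case True
      let ?k = "zero_ext X (\<lambda>z. L z w ^ Suc m)"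
      have "cmod (f w) \<le> 0 + e" if e: "e > 0" for e
      proof -
        define \<epsilon> where "\<epsilon> = e / (ip_norm ip f + 1)"
        have n: "ip_norm ip f \<ge> 0" by (rule H.ip_norm_nonneg[OF f])
        have \<epsilon>: "\<epsilon> > 0" using e n by (simp add: \<epsilon>_def)
        obtain p where p: "p \<in> analytic_polynomials" "dominated X (\<lambda>z w. L z w ^ Suc m) (\<lambda>z. L z w ^ Suc m - p z) \<epsilon>"
          using kernel_power_approximation[OF True \<epsilon>] by blast
        let ?d = "zero_ext X (\<lambda>z. L z w ^ Suc m - p z)"
        have d: "?d \<in> H" "ip_norm ip ?d \<le> \<epsilon>" using H.dominated_mem[OF p(2)] \<epsilon> by auto
        have "?k = (\<lambda>z. ?d z + zero_ext X p z)" by (auto simp: zero_ext_def)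
        then have "ip f ?k = ip f ?d + ip f (zero_ext X p)"
          using H.ip_add_right[OF d(1) pH[OF p(1)] f] by simp
        moreover have "ip f (zero_ext X p) = 0"
          using orth[OF imageI[OF p(1)]] H.ip_cnj[OF pH[OF p(1)] f] by simp
        ultimately have "f w = ip f ?d" using H.reproducing[OF f True] by simp
        then have "cmod (f w) \<le> ip_norm ip f * ip_norm ip ?d" using H.Cauchy_Schwarz_ip[OF f d(1)] by simp
        also have "\<dots> \<le> (ip_norm ip f + 1) * \<epsilon>" using d(2) n \<epsilon> H.ip_norm_nonneg[OF d(1)] by (intro mult_mono) auto
        also have "\<dots> = e" using n by (simp add: \<epsilon>_def)
        finally show ?thesis by simp
      qed
      then have "cmod (f w) \<le> 0" by (rule field_le_epsilon)
      then show ?thesis by simp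
    qed (rule H.vanish_outside[OF f])
  qed
  show ?thesis
    unfolding dense_subset_of_def
  proof (intro conjI S ballI allI impI)
    fix f :: "complex^'d \<Rightarrow> complex" and e :: real
    assume f: "f \<in> H" and e: "e > 0"
    obtain F where F: "\<And>n :: nat. F n \<in> ?S" "(\<lambda>n. ip_norm ip (\<lambda>z. F n z - f z)) \<longlonglongrightarrow> 0"
      by (rule H.dense_of_trivial_complement[OF S zero_ext_polynomials_zero zero_ext_polynomials_add
            zero_ext_polynomials_scale triv f]) auto
    have "\<forall>\<^sub>F n in sequentially. ip_norm ip (\<lambda>z. F n z - f z) < e"
      using order_tendstoD(2)[OF F(2) e] .
    then obtain n where "ip_norm ip (\<lambda>z. F n z - f z) < e" by (auto simp: eventually_sequentially)
    then have "ip_norm ip (\<lambda>z. f z - F n z) < e"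
      using H.ip_norm_diff_commute[OF f, of "F n"] F(1)[of n] S by auto
    then show "\<exists>p\<in>?S. ip_norm ip (\<lambda>z. f z - p z) < e" using F(1) by blast
  qed
qed

end

section \<open>Roots of the kernel and the general exponent\<close>

lemma Hb_kernel_power:
  assumes "m \<ge> 1"
  shows "Hb_kernel \<beta> b m = (\<lambda>z w. Hb_kernel (\<beta> / real m) b (Suc 0) z w ^ m)"
proof (intro ext)
  fix z w
  \<comment> \<open>Both sides are the exponential of \<open>\<beta>\<close> times the principal
    logarithm, so the branches match; at \<open>x = 0\<close> both vanish because \<open>m\<close>
    is positive.\<close>
  have "(x powr of_real (\<beta> / real m)) ^ m = x powr of_real \<beta>" for x :: complex
  proof (cases "x = 0")
    case False
    then have "x powr of_real (\<beta> / real m) = exp (of_real (\<beta> / real m) * Ln x)" by (simp only: powr_def if_False)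
    then have "(x powr of_real (\<beta> / real m)) ^ m = exp (of_nat m * (of_real (\<beta> / real m) * Ln x))"
      by (simp only: exp_of_nat_mult)
    also have "of_nat m * (of_real (\<beta> / real m) * Ln x) = of_real \<beta> * Ln x" using assms by simp
    finally show ?thesis using False by (simp add: powr_def)
  qed (use assms in simp)
  then show "Hb_kernel \<beta> b m z w = Hb_kernel (\<beta> / real m) b (Suc 0) z w ^ m"
    by (simp add: Hb_kernel_def power_divide)
qed

text \<open>Density is claimed for every realisation of the space, and existence is included so that
  this claim is not vacuous.\<close>

theorem corollary3:
  fixes b :: "complex^'d \<Rightarrow> complex" and m :: nat and \<beta> :: real
  assumes "m \<ge> 1"
    and "real m * real CARD('d) < \<beta>"
    and "b \<in> H_infty"
    and "H_infty_norm b \<le> 1"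
    and "norm (b 0) < 1"
  shows "(\<exists>H ip. reproducing_kernel_hilbert_space (ball 0 1) H ip (Hb_kernel \<beta> b m)) \<and>
         (\<forall>H ip. reproducing_kernel_hilbert_space (ball 0 1) H ip (Hb_kernel \<beta> b m) \<longrightarrow>
            dense_subset_of H ip (zero_ext (ball 0 1) ` analytic_polynomials))"
proof -
  \<comment> \<open>Boundedness makes the supremum meaningful; only then does its value bound
    \<open>b\<close> pointwise.\<close>
  have le: "cmod (b z) \<le> 1" if z: "z \<in> ball 0 1" for z
  proof -
    obtain B where "\<forall>y\<in>b ` ball 0 1. cmod y \<le> B" using assms(3) by (auto simp: H_infty_def bounded_iff)
    then have "bdd_above ((\<lambda>z. cmod (b z)) ` ball 0 1)" by (intro bdd_aboveI2[where M = B]) auto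
    then have "cmod (b z) \<le> H_infty_norm b" unfolding H_infty_norm_def by (intro cSUP_upper z)
    then show ?thesis using assms(4) by simp
  qed
  interpret schur_ball "\<beta> / real m" "TYPE('d)" b
  proof
    show "real CARD('d) < \<beta> / real m" using assms(1,2) by (simp add: field_simps)
    show "analytic_several_on b (ball 0 1)" using assms(3) by (simp add: H_infty_def)
  qed (use le assms(5) in auto)
  obtain k where k: "m = Suc k" using assms(1) by (cases m) auto
  note K = Hb_kernel_power[OF assms(1), of \<beta> b]
  show ?thesis
    unfolding K unfolding k
    using kernel_space_RKHS[OF pos_kernel_power[of "Suc k"]] polynomials_dense_power[of _ _ k]
    unfolding k by blast
qed

end
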